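(* Let $k$ be a field and $d\ge1$. If $H$ is a cointerval $d$-graph, then the edge ideal $I_H\subseteq S=k[x_v:v\in V(H)]$ has a minimal cellular resolution supported on a subcomplex of a mixed subdivision of a dilated simplex.
   Context: A $d$-graph $H$ is a finite vertex set $V(H)\subseteq\mathbb{Z}$ with a set $E(H)$ of $d$-element subsets of $V(H)$, called edges. For $v\in V(H)$, the $v$-layer of $H$ is the $(d-1)$-graph on $V(H)\setminus\{v\}$ with edge set $\{\{v_1,\dots,v_{d-1}\}: \{v,v_1,\dots,v_{d-1}\}\in E(H),\ v<v_1,\dots,v_{d-1}\}$. Cointerval $d$-graphs are defined recursively: every $1$-graph is cointerval; for $d>1$, $H$ is cointerval if (1) for every $i\in V(H)$ the $i$-layer of $H$ is cointerval, and (2) for all vertices $i<j$, every edge of the $j$-layer of $H$ is an edge of the $i$-layer. Edge ideal: $I_H=\langle \prod_{v\in e}x_v : e\in E(H)\rangle$. Mixed subdivisions: let $\Delta_m=\mathrm{conv}\{e_1,\dots,e_{m+1}\}\subseteq\mathbb{R}^{m+1}$; the dilated simplex $d\Delta_m$ is the $d$-fold Minkowski sum $\Delta_m+\cdots+\Delta_m$. A mixed cell of $d\Delta_m$ is an $m$-dimensional Minkowski sum $B_1+\cdots+B_d$ of faces $B_i$ of $\Delta_m$; it is fine if the $B_i$ lie in independent affine subspaces and their dimensions add up to $m$. A (fine) mixed subdivision of $d\Delta_m$ is a polyhedral subdivision of $d\Delta_m$ whose maximal cells are (fine) mixed cells. Cellular resolutions: for an oriented polyhedral complex $X$ whose vertices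 carry monomial labels and each of whose faces $F$ carries the lcm $\ell(F)$ of its vertex labels, $\mathcal{F}_X$ is the complex of free $S$-modules having one generator $e_F$ of multidegree $\ell(F)$ in homological degree $\dim F$ for each nonempty face $F$, with $\partial e_F=\sum_{G}\pm\frac{\ell(F)}{\ell(G)}e_G$, the sum being over facets $G$ of $F$, with signs from the cellular boundary map. $X$ supports a (minimal) cellular resolution of a monomial ideal $I$ if $\mathcal{F}_X$ together with the augmentation $e_v\mapsto\ell(v)$ is a (minimal) free resolution of $I$. *)

theory Defs
  imports
    "HOL-Analysis.Polytope"
    "HOL-Analysis.Finite_Function_Topology"
    "HOL-Algebra.Ideal"
    "Jordan_Normal_Form.Determinant"
begin

definition d_graph :: "nat \<Rightarrow> int set \<Rightarrow> int set set \<Rightarrow> bool" where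
  "d_graph d V E \<longleftrightarrow> finite V \<and> (\<forall>e\<in>E. e \<subseteq> V \<and> card e = d)"

definition layer_edges :: "int set set \<Rightarrow> int \<Rightarrow> int set set" where
  "layer_edges E v = {e. insert v e \<in> E \<and> (\<forall>w\<in>e. v < w)}"

text \<open>
  A \<open>d\<close>-graph with \<open>d > 1\<close> is cointerval if (1) its layers are cointerval and (2) for vertices \<open>i < j\<close>
  every edge of the \<open>j\<close>-layer is an edge of the \<open>i\<close>-layer. Written with \<open>V - {v}\<close> as the vertex set of
  the \<open>v\<close>-layer, this has a pitfall: a vertex \<open>k < v\<close> has an empty layer inside the \<open>v\<close>-layer, so that
  (2), applied there to \<open>k\<close> and any \<open>j > k\<close>, leaves the \<open>v\<close>-layer without edges as soon as \<open>d > 2\<close> and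
  \<open>v\<close> is not the least vertex; not even the complete 3-graph on four vertices would be cointerval.
  The vertices of the \<open>v\<close>-layer are therefore taken to be those that can occur in its edges, the
  \<open>w \<in> V\<close> with \<open>v < w\<close>. The recursion on \<open>V - {v}\<close> is \<open>cointerval_verbatim\<close>; every graph that is
  cointerval in that sense is \<open>cointerval\<close>. The value at \<open>d = 0\<close> carries no meaning.
\<close>

fun cointerval :: "nat \<Rightarrow> int set \<Rightarrow> int set set \<Rightarrow> bool" where
  "cointerval 0 V E = False"
| "cointerval (Suc 0) V E = True"
| "cointerval (Suc (Suc d)) V E \<longleftrightarrow>
     (\<forall>i\<in>V. cointerval (Suc d) {w \<in> V. i < w} (layer_edges E i)) \<and>
     (\<forall>i\<in>V. \<forall>j\<in>V. i < j \<longrightarrow> layer_edges E j \<subseteq> layer_edges E i)"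

fun cointerval_verbatim :: "nat \<Rightarrow> int set \<Rightarrow> int set set \<Rightarrow> bool" where
  "cointerval_verbatim 0 V E = False"
| "cointerval_verbatim (Suc 0) V E = True"
| "cointerval_verbatim (Suc (Suc d)) V E \<longleftrightarrow>
     (\<forall>i\<in>V. cointerval_verbatim (Suc d) (V - {i}) (layer_edges E i)) \<and>
     (\<forall>i\<in>V. \<forall>j\<in>V. i < j \<longrightarrow> layer_edges E j \<subseteq> layer_edges E i)"

lemma cointerval_if_verbatim:
  assumes "cointerval_verbatim d W E" "V \<subseteq> W"
  shows "cointerval d V E"
  using assms
proof (induction d V E arbitrary: W rule: cointerval.induct)
  case (3 d V E)
  have "cointerval (Suc d) {w \<in> V. i < w} (layer_edges E i)" if "i \<in> V" for i
    using that "3.prems" by (intro "3.IH"[of i "W - {i}"]) auto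
  moreover have "layer_edges E j \<subseteq> layer_edges E i" if "i \<in> V" "j \<in> V" "i < j" for i j
    using that "3.prems" by (meson cointerval_verbatim.simps(3) subsetD)
  ultimately show ?case
    by simp
qed simp_all

text \<open>
  A polynomial in the variables \<open>x\<^sub>v\<close>, \<open>v :: int\<close>, is a finitely supported map from exponent vectors
  to coefficients, with the convolution product of \<open>Poly_Mapping\<close>.
\<close>

type_synonym expo = "int \<Rightarrow>\<^sub>0 nat"
type_synonym 'k pol = "expo \<Rightarrow>\<^sub>0 'k"

definition monomial :: "expo \<Rightarrow> 'k::field pol" where
  "monomial a = Poly_Mapping.single a 1"

definition var :: "int \<Rightarrow> 'k::field pol" where
  "var v = monomial (Poly_Mapping.single v 1)"

definition pol_ring :: "int set \<Rightarrow> 'k::field pol ring" where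
  "pol_ring V =
     \<lparr>carrier = {p. \<forall>a \<in> Poly_Mapping.keys p. Poly_Mapping.keys a \<subseteq> V},
      monoid.mult = (*), one = 1, zero = 0, add = (+)\<rparr>"

definition edge_ideal :: "int set \<Rightarrow> int set set \<Rightarrow> 'k::field pol set" where
  "edge_ideal V E = genideal (pol_ring V) ((\<lambda>e. \<Prod>v\<in>e. var v) ` E)"

text \<open>
  The dimension of a nonempty polytope, the dimension of the linear space parallel to its affine
  hull; the library's \<open>aff_dim\<close> and \<open>facet_of\<close> are restricted to Euclidean spaces. The value \<open>0\<close> on
  the empty set carries no meaning, and the empty face is excluded wherever \<open>pdim\<close> is used.
\<close>

definition differences :: "'a::real_vector set \<Rightarrow> 'a set" where
  "differences F = {x - y |x y. x \<in> F \<and> y \<in> F}"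

definition pdim :: "'a::real_vector set \<Rightarrow> nat" where
  "pdim F = dim (differences F)"

definition is_facet :: "'a::real_vector set \<Rightarrow> 'a set \<Rightarrow> bool" where
  "is_facet G F \<longleftrightarrow> G face_of F \<and> G \<noteq> {} \<and> pdim F = pdim G + 1"

text \<open>With the library's \<open>face_of\<close> the empty set is a face, hence a cell of every nonempty complex.\<close>

definition polyhedral_complex :: "'a::real_vector set set \<Rightarrow> bool" where
  "polyhedral_complex X \<longleftrightarrow>
     finite X \<and>
     (\<forall>F\<in>X. polytope F) \<and>
     (\<forall>F\<in>X. \<forall>G. G face_of F \<longrightarrow> G \<in> X) \<and>
     (\<forall>F\<in>X. \<forall>G\<in>X. F \<inter> G face_of F \<and> F \<inter> G face_of G)"

definition subcomplex :: "'a::real_vector set set \<Rightarrow> 'a set set \<Rightarrow> bool" where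
  "subcomplex X Y \<longleftrightarrow> polyhedral_complex X \<and> X \<subseteq> Y"

definition polyhedral_subdivision :: "'a::real_vector set set \<Rightarrow> 'a set \<Rightarrow> bool" where
  "polyhedral_subdivision Y P \<longleftrightarrow> polyhedral_complex Y \<and> \<Union>Y = P"

text \<open>
  \<open>\<real>\<^bsup>m+1\<^esup>\<close> is the subspace of \<open>nat \<Rightarrow>\<^sub>0 real\<close> of vectors supported on \<open>{0..m}\<close>, so that \<open>m\<close> can be
  quantified over. Sums of sets are Minkowski sums.
\<close>

definition std_simplex :: "nat \<Rightarrow> (nat \<Rightarrow>\<^sub>0 real) set" where
  "std_simplex m = convex hull ((\<lambda>i. Poly_Mapping.single i 1) ` {..m})"

definition dilated_simplex :: "nat \<Rightarrow> nat \<Rightarrow> (nat \<Rightarrow>\<^sub>0 real) set" where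
  "dilated_simplex r m = (\<Sum>i<r. std_simplex m)"

definition mixed_cell :: "nat \<Rightarrow> nat \<Rightarrow> (nat \<Rightarrow>\<^sub>0 real) set \<Rightarrow> bool" where
  "mixed_cell r m C \<longleftrightarrow> pdim C = m \<and>
     (\<exists>B. (\<forall>i<r. B i face_of std_simplex m \<and> B i \<noteq> {}) \<and> C = (\<Sum>i<r. B i))"

definition mixed_subdivision :: "nat \<Rightarrow> nat \<Rightarrow> (nat \<Rightarrow>\<^sub>0 real) set set \<Rightarrow> bool" where
  "mixed_subdivision r m Y \<longleftrightarrow>
     polyhedral_subdivision Y (dilated_simplex r m) \<and>
     (\<forall>C\<in>Y. (\<forall>D\<in>Y. C \<subseteq> D \<longrightarrow> C = D) \<longrightarrow> mixed_cell r m C)"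

text \<open>
  An orientation selects, for every nonempty cell, an ordered basis of the linear space parallel to
  the cell. The incidence number of a facet \<open>G\<close> of \<open>F\<close> is \<open>1\<close> if a vector pointing from \<open>F\<close> outwards
  through \<open>G\<close>, followed by the basis of \<open>G\<close>, is positively oriented with respect to the basis of \<open>F\<close>,
  and \<open>-1\<close> otherwise; the sign of the determinant does not depend on the choice of that vector. For an edge this is \<open>1\<close> at its head and \<open>-1\<close> at its tail.
\<close>

definition orientation :: "('a::real_vector set \<Rightarrow> 'a list) \<Rightarrow> 'a set set \<Rightarrow> bool" where
  "orientation b X \<longleftrightarrow>
     (\<forall>F \<in> X - {{}}. distinct (b F) \<and> independent (set (b F)) \<and>
        span (set (b F)) = span (differences F))"

definition outward :: "'a::real_vector set \<Rightarrow> 'a set \<Rightarrow> 'a" where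
  "outward F G = (SOME u. \<exists>p \<in> F - G. \<exists>q \<in> G. u = q - p)"

definition coord_det :: "'a::real_vector list \<Rightarrow> 'a list \<Rightarrow> real" where
  "coord_det bs vs =
     det (mat (length bs) (length bs) (\<lambda>(i, j). representation (set bs) (vs ! j) (bs ! i)))"

definition incidence :: "('a::real_vector set \<Rightarrow> 'a list) \<Rightarrow> 'a set \<Rightarrow> 'a set \<Rightarrow> int" where
  "incidence b F G = (if coord_det (b F) (outward F G # b G) > 0 then 1 else -1)"

text \<open>The exponent vector of the lcm of the labels of the vertices of \<open>F\<close>.\<close>

definition face_label :: "('a::real_vector \<Rightarrow> expo) \<Rightarrow> 'a set \<Rightarrow> expo" where
  "face_label l F =
     Abs_poly_mapping (\<lambda>i. Max ((\<lambda>v. Poly_Mapping.lookup (l v) i) ` {v. v extreme_point_of F}))"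

text \<open>
  \<open>chains V X i\<close> is the free module over \<open>pol_ring V\<close> on the nonempty \<open>i\<close>-dimensional faces, a chain
  being the family of its coefficients.
\<close>

definition chains ::
    "int set \<Rightarrow> 'a::real_vector set set \<Rightarrow> nat \<Rightarrow> ('a set \<Rightarrow> 'k::field pol) set" where
  "chains V X i =
     {c. (\<forall>F. c F \<in> carrier (pol_ring V)) \<and>
         (\<forall>F. c F \<noteq> 0 \<longrightarrow> F \<in> X \<and> F \<noteq> {} \<and> pdim F = i)}"

definition boundary :: "'a::real_vector set set \<Rightarrow> ('a set \<Rightarrow> 'a list) \<Rightarrow> ('a \<Rightarrow> expo) \<Rightarrow>
    ('a set \<Rightarrow> 'k::field pol) \<Rightarrow> 'a set \<Rightarrow> 'k pol" where
  "boundary X b l c G =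
     (\<Sum>F | F \<in> X \<and> is_facet G F.
        of_int (incidence b F G) * monomial (face_label l F - face_label l G) * c F)"

definition augmentation :: "'a::real_vector set set \<Rightarrow> ('a \<Rightarrow> expo) \<Rightarrow>
    ('a set \<Rightarrow> 'k::field pol) \<Rightarrow> 'k pol" where
  "augmentation X l c = (\<Sum>v | {v} \<in> X. monomial (l v) * c {v})"

definition cellular_resolution :: "int set \<Rightarrow> 'a::real_vector set set \<Rightarrow> ('a set \<Rightarrow> 'a list) \<Rightarrow>
    ('a \<Rightarrow> expo) \<Rightarrow> 'k::field pol set \<Rightarrow> bool" where
  "cellular_resolution V X b l I \<longleftrightarrow>
     augmentation X l ` chains V X 0 = I \<and>
     {c \<in> chains V X 0. augmentation X l c = (0 :: 'k pol)} = boundary X b l ` chains V X 1 \<and>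
     (\<forall>i\<ge>1. {c \<in> chains V X i. boundary X b l c = (\<lambda>_. 0 :: 'k pol)}
        = boundary X b l ` chains V X (i + 1))"

text \<open>
  Minimality of a resolution \<open>F\<close>: the differentials map each \<open>F\<^sub>i\<close> into \<open>\<mm>F\<^sub>i\<^sub>-\<^sub>1\<close>, where \<open>\<mm>\<close> is the
  ideal generated by the variables and \<open>\<mm>F\<^sub>i\<^sub>-\<^sub>1\<close> consists of the chains with coefficients in \<open>\<mm>\<close>.
\<close>

definition minimal_cellular_resolution :: "int set \<Rightarrow> 'a::real_vector set set \<Rightarrow>
    ('a set \<Rightarrow> 'a list) \<Rightarrow> ('a \<Rightarrow> expo) \<Rightarrow> 'k::field pol set \<Rightarrow> bool" where
  "minimal_cellular_resolution V X b l I \<longleftrightarrow>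
     cellular_resolution V X b l I \<and>
     (\<forall>i\<ge>1. \<forall>c \<in> chains V X i. \<forall>G.
        boundary X b l c G \<in> genideal (pol_ring V) (var ` V :: 'k pol set))"

definition supports_minimal_cellular_resolution ::
    "int set \<Rightarrow> 'a::real_vector set set \<Rightarrow> 'k::field pol set \<Rightarrow> bool" where
  "supports_minimal_cellular_resolution V X I \<longleftrightarrow>
     polyhedral_complex X \<and>
     (\<exists>b l. orientation b X \<and>
        (\<forall>v. {v} \<in> X \<longrightarrow> Poly_Mapping.keys (l v) \<subseteq> V) \<and>
        minimal_cellular_resolution V X b l I)"

end

theory Submission
  imports Defs
begin

text \<open>
  Identify the vertices with coordinates \<open>0, \<dots>, m\<close>. For sets \<open>B\<^sub>1 < \<dots> < B\<^sub>d\<close> of vertices, one after the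
  other, the sum of the faces \<open>conv {e\<^sub>a | a \<in> B\<^sub>i}\<close> of the simplex is a product of simplices; the
  complex \<open>X\<close> consists of those products all of whose vertices are edges of the graph, an edge \<open>f\<close> being
  the point \<open>\<Sum>a\<in>f. e\<^sub>a\<close>. It lies in the mixed subdivision of \<open>d\<Delta>\<^sub>m\<close> into the cells in which every
  partial sum \<open>y\<^sub>j = x\<^sub>0 + \<dots> + x\<^sub>j\<^sub>-\<^sub>1\<close> is confined to an interval between consecutive integers.

  The label of a cell is the product of the variables in \<open>\<Union>B\<^sub>i\<close>, so that passing to a facet removes one
  variable and minimality is clear. A multigraded strand of the cellular complex is the chain complex
  over \<open>k\<close> of the cells on a set \<open>W\<close> of vertices. There the matching that toggles in \<open>B\<^sub>1\<close> the least
  vertex \<open>v\<^sub>1\<close> that occurs in any \<open>B\<^sub>1\<close>, which a cointerval graph permits, leaves over only the cells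
  with \<open>B\<^sub>1 = {v\<^sub>1}\<close>; toggling then in \<open>B\<^sub>2\<close>, and so on, leaves a single vertex.
\<close>

text \<open>The cointerval condition lets a vertex of an edge be lowered only while a larger vertex
  remains in the edge, because 1-graphs satisfy no condition at all. Inserting the least vertex
  \<open>a\<close> into block \<open>j\<close> is therefore an exchange as long as \<open>j\<close>
  is not the last block. In the last block no exchange is available; there the wanted set is already
  an edge of the cell that contributes \<open>a\<close>, because all earlier blocks have been
  reduced to the same singletons. This is why the blocks are treated one after the other, from the
  left.

  The subdivision does not depend on the graph, and it also makes \<open>X\<close> a polyhedral
  complex: that two cells meet in a common face is read off from the inequalities on partial sums.

  Orientations are arbitrary bases, so there is no explicit sign formula. What is known of the signs
  is deduced from determinants: a double boundary vanishes, and the two ends of an edge have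
  opposite signs.\<close>

type_synonym point = "nat \<Rightarrow>\<^sub>0 real"

abbreviation lk :: "('a \<Rightarrow>\<^sub>0 'b::zero) \<Rightarrow> 'a \<Rightarrow> 'b" where
  "lk \<equiv> Poly_Mapping.lookup"

abbreviation ks :: "('a \<Rightarrow>\<^sub>0 'b::zero) \<Rightarrow> 'a set" where
  "ks \<equiv> Poly_Mapping.keys"

lemma lk_scaleR [simp]: "lk (r *\<^sub>R x) i = r *\<^sub>R lk x i"
proof -
  have "finite {i. r *\<^sub>R lk x i \<noteq> 0}"
    by (rule finite_subset[of _ "{i. lk x i \<noteq> 0}"]) auto
  then show ?thesis
    by (simp add: scaleR_poly_mapping_def)
qed

subsection \<open>Products of simplices on disjoint blocks\<close>

definition supp :: "nat \<Rightarrow> (nat \<Rightarrow> nat set) \<Rightarrow> nat set" where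
  "supp d B = (\<Union>i<d. B i)"

text \<open>Blocks with index at least \<open>d\<close> are empty, so that a cell determines its blocks.\<close>

definition blocks :: "nat \<Rightarrow> (nat \<Rightarrow> nat set) \<Rightarrow> bool" where
  "blocks d B \<longleftrightarrow> (\<forall>i<d. finite (B i) \<and> B i \<noteq> {}) \<and>
     (\<forall>i j. i < j \<and> j < d \<longrightarrow> (\<forall>a\<in>B i. \<forall>b\<in>B j. a < b)) \<and> (\<forall>i\<ge>d. B i = {})"

text \<open>The Minkowski sum of the simplices conv {e_a | a in \<open>B i\<close>}: since the
  blocks are disjoint, it is cut out by one equation per block. In this form faces are found by
  asking which coordinates vanish.\<close>

definition cell :: "nat \<Rightarrow> (nat \<Rightarrow> nat set) \<Rightarrow> point set" where
  "cell d B = {x. (\<forall>a. 0 \<le> lk x a) \<and> (\<forall>a. a \<notin> supp d B \<longrightarrow> lk x a = 0) \<and>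
     (\<forall>i<d. (\<Sum>a\<in>B i. lk x a) = 1)}"

definition lin :: "nat \<Rightarrow> (nat \<Rightarrow> nat set) \<Rightarrow> point set" where
  "lin d B = {x. (\<forall>a. a \<notin> supp d B \<longrightarrow> lk x a = 0) \<and> (\<forall>i<d. (\<Sum>a\<in>B i. lk x a) = 0)}"

definition del :: "(nat \<Rightarrow> nat set) \<Rightarrow> nat \<Rightarrow> nat \<Rightarrow> nat set" where
  "del B u = (\<lambda>i. B i - {u})"

text \<open>The point whose barycentric coordinates in block \<open>i\<close> are
  \<open>w i\<close>.\<close>

definition bpt :: "nat \<Rightarrow> (nat \<Rightarrow> nat set) \<Rightarrow> (nat \<Rightarrow> nat \<Rightarrow> real) \<Rightarrow> point" where
  "bpt d B w = (\<Sum>i<d. \<Sum>a\<in>B i. Poly_Mapping.single a (w i a))"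

lemma blocks_disjoint: "blocks d B \<Longrightarrow> a \<in> B i \<Longrightarrow> a \<in> B j \<Longrightarrow> i = j"
  unfolding blocks_def by (metis empty_iff less_irrefl linorder_neqE_nat not_le)

lemma blocks_finite: "blocks d B \<Longrightarrow> finite (B i)"
  unfolding blocks_def by (metis finite.emptyI not_le)

lemma blocks_empty: "blocks d B \<Longrightarrow> d \<le> i \<Longrightarrow> B i = {}"
  unfolding blocks_def by blast

lemma blocks_nonempty: "blocks d B \<Longrightarrow> i < d \<Longrightarrow> B i \<noteq> {}"
  unfolding blocks_def by blast

lemma blocks_less: "blocks d B \<Longrightarrow> a \<in> B i \<Longrightarrow> b \<in> B j \<Longrightarrow> i < j \<Longrightarrow> a < b"
  unfolding blocks_def by (metis empty_iff not_le)

lemma blocks_index: "blocks d B \<Longrightarrow> a \<in> B i \<Longrightarrow> i < d"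
  unfolding blocks_def by (metis empty_iff not_le)

lemma in_supp: "blocks d B \<Longrightarrow> a \<in> supp d B \<longleftrightarrow> (\<exists>i. a \<in> B i)"
  unfolding supp_def using blocks_index by blast

lemma finite_supp: "blocks d B \<Longrightarrow> finite (supp d B)"
  unfolding supp_def by (auto intro: blocks_finite)

lemma blocks_subset:
  assumes "blocks d B" "\<And>i. C i \<subseteq> B i" "\<And>i. i < d \<Longrightarrow> C i \<noteq> {}"
  shows "blocks d C"
  unfolding blocks_def
proof (intro conjI allI impI ballI)
  show "finite (C i)" for i
    using assms(2) blocks_finite[OF assms(1)] finite_subset by blast
  show "C i \<noteq> {}" if "i < d" for i using assms(3) that .
  show "a < b" if "i < j \<and> j < d" "a \<in> C i" "b \<in> C j" for i j a b
    using that assms(2) blocks_less[OF assms(1), of a i b j] by blast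
  show "C i = {}" if "d \<le> i" for i
    using that assms(1) assms(2)[of i] by (auto simp: blocks_def)
qed

lemma blocks_choose:
  assumes "blocks d B"
  obtains t where "\<And>i. i < d \<Longrightarrow> t i \<in> B i"
proof
  show "(SOME a. a \<in> B i) \<in> B i" if "i < d" for i
    using blocks_nonempty[OF assms that] by (simp add: some_in_eq)
qed

lemma lk_bpt:
  assumes "blocks d B"
  shows "a \<in> B j \<Longrightarrow> lk (bpt d B w) a = w j a"
    and "a \<notin> supp d B \<Longrightarrow> lk (bpt d B w) a = 0"
proof -
  have eq: "lk (bpt d B w) a = (\<Sum>i<d. if a \<in> B i then w i a else 0)"
    unfolding bpt_def using blocks_finite[OF assms]
    by (simp add: lookup_sum lookup_single when_def)
  show "lk (bpt d B w) a = w j a" if "a \<in> B j"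
  proof -
    have "a \<in> B i \<longleftrightarrow> i = j" for i
      using blocks_disjoint[OF assms _ that] that by blast
    then show ?thesis
      using eq blocks_index[OF assms that] by simp
  qed
  show "lk (bpt d B w) a = 0" if "a \<notin> supp d B"
    unfolding eq using that by (intro sum.neutral) (auto simp: supp_def)
qed

lemma bpt_in_cell:
  assumes "blocks d B" "\<And>i a. a \<in> B i \<Longrightarrow> 0 \<le> w i a" "\<And>i. i < d \<Longrightarrow> (\<Sum>a\<in>B i. w i a) = 1"
  shows "bpt d B w \<in> cell d B"
proof -
  have "0 \<le> lk (bpt d B w) a" for a
    using lk_bpt[OF assms(1)] assms(2) in_supp[OF assms(1)] by (cases "a \<in> supp d B") auto
  moreover have "(\<Sum>a\<in>B i. lk (bpt d B w) a) = 1" if "i < d" for i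
    using assms(3)[OF that] lk_bpt(1)[OF assms(1)] by (simp cong: sum.cong)
  ultimately show ?thesis
    by (simp add: cell_def lk_bpt(2)[OF assms(1)])
qed

lemma cell_interior:
  assumes "blocks d B"
  obtains x where "x \<in> cell d B" "\<And>a. a \<in> supp d B \<Longrightarrow> 0 < lk x a"
proof
  let ?w = "\<lambda>i (a::nat). 1 / real (card (B i))"
  have pos: "0 < card (B i)" if "i < d" for i
    using blocks_finite[OF assms] blocks_nonempty[OF assms that] by (simp add: card_gt_0_iff)
  then show "bpt d B ?w \<in> cell d B"
    by (intro bpt_in_cell assms) (auto simp: card_gt_0_iff)
  show "0 < lk (bpt d B ?w) a" if "a \<in> supp d B" for a
    using that lk_bpt[OF assms] pos by (auto simp: supp_def)
qed

lemma cell_nonempty: "blocks d B \<Longrightarrow> cell d B \<noteq> {}"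
  using cell_interior by blast

lemma convex_cell: "convex (cell d B)"
  unfolding convex_def cell_def
  by (auto simp: lookup_add sum.distrib simp flip: sum_distrib_left)

definition vert :: "nat \<Rightarrow> (nat \<Rightarrow> nat set) \<Rightarrow> (nat \<Rightarrow> nat) \<Rightarrow> point" where
  "vert d B t = bpt d B (\<lambda>i a. if a = t i then 1 else 0)"

lemma vert_in_cell:
  assumes "blocks d B" "\<And>i. i < d \<Longrightarrow> t i \<in> B i"
  shows "vert d B t \<in> cell d B"
  unfolding vert_def
  by (intro bpt_in_cell assms) (simp_all add: assms blocks_finite[OF assms(1)])

lemma lk_vert:
  assumes "blocks d B" "\<And>i. i < d \<Longrightarrow> t i \<in> B i"
  shows "lk (vert d B t) a = (if a \<in> t ` {..<d} then 1 else 0)"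
proof (cases "a \<in> supp d B")
  case True
  then obtain j where j: "j < d" "a \<in> B j" by (auto simp: supp_def)
  have "a = t j \<longleftrightarrow> a \<in> t ` {..<d}"
    using j assms blocks_disjoint[OF assms(1)] by blast
  then show ?thesis
    using lk_bpt(1)[OF assms(1) j(2)] by (simp add: vert_def)
next
  case False
  then show ?thesis
    using lk_bpt(2)[OF assms(1) False] assms(2) by (auto simp: vert_def supp_def)
qed

lemma sum_lk_blocks:
  assumes "blocks d B" "\<And>a. a \<notin> supp d B \<Longrightarrow> lk x a = 0" "finite Q"
  shows "(\<Sum>a\<in>Q. lk x a) = (\<Sum>i<d. \<Sum>a\<in>B i \<inter> Q. lk x a)"
proof -
  have "(\<Sum>a\<in>Q. lk x a) = (\<Sum>a\<in>(\<Union>i<d. B i \<inter> Q). lk x a)"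
    using assms by (intro sum.mono_neutral_right) (auto simp: supp_def)
  also have "\<dots> = (\<Sum>i<d. \<Sum>a\<in>B i \<inter> Q. lk x a)"
    using assms(3) by (intro sum.UNION_disjoint) (auto dest: blocks_disjoint[OF assms(1)])
  finally show ?thesis .
qed

text \<open>A vertex of \<open>B i\<close> outside \<open>C i\<close> lies in no other block of
  \<open>C\<close> either, as the blocks of \<open>B\<close> are disjoint. If its coordinate
  vanishes, the sums over \<open>B i\<close> and \<open>C i\<close> agree.\<close>

lemma cell_mono:
  assumes "blocks d B" "blocks d C" "\<And>i. C i \<subseteq> B i"
  shows "cell d C = {x \<in> cell d B. \<forall>a. a \<notin> supp d C \<longrightarrow> lk x a = 0}"
proof -
  have "(\<Sum>a\<in>B i. lk x a) = (\<Sum>a\<in>C i. lk x a)" if "i < d" "\<forall>a. a \<notin> supp d C \<longrightarrow> lk x a = 0" for x :: point and i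
  proof (rule sum.mono_neutral_right)
    show "\<forall>a\<in>B i - C i. lk x a = 0"
      using assms that blocks_disjoint[OF assms(1)] by (metis DiffE in_supp subsetD)
  qed (use assms blocks_finite in auto)
  moreover have "supp d C \<subseteq> supp d B"
    using assms(3) by (auto simp: supp_def)
  ultimately show ?thesis
    by (auto simp: cell_def)
qed

text \<open>The blocks are recovered from the order of the coordinates. A vertex of
  \<open>cell d C\<close> that uses \<open>a\<close> from \<open>C i\<close> carries mass
  \<open>i\<close> strictly below \<open>a\<close>; as a point of \<open>cell d B\<close> with
  \<open>a\<close> in \<open>B j\<close> it carries mass \<open>j\<close> there.\<close>

lemma cell_block_order:
  assumes "blocks d B" "blocks d C" "cell d C \<subseteq> cell d B"
  shows "C i \<subseteq> B i"
proof
  fix a assume a: "a \<in> C i"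
  have i: "i < d" using blocks_index[OF assms(2) a] .
  obtain t0 where t0: "\<And>j. j < d \<Longrightarrow> t0 j \<in> C j"
    using blocks_choose[OF assms(2)] by blast
  define t where "t = t0(i := a)"
  have t: "\<And>j. j < d \<Longrightarrow> t j \<in> C j" using t0 a by (simp add: t_def)
  define x where "x = vert d C t"
  have lkx: "lk x b = (if b \<in> t ` {..<d} then 1 else 0)" for b
    using lk_vert[OF assms(2) t] by (simp add: x_def)
  have x: "x \<in> cell d B" using vert_in_cell[OF assms(2) t] assms(3) by (auto simp: x_def)
  have ta: "t i = a" by (simp add: t_def)
  have mono: "t j < t l" if "j < l" "l < d" for j l
    using blocks_less[OF assms(2) t t] that by auto
  have inj: "inj_on t {..<d}"
    using mono by (metis inj_onI lessThan_iff less_irrefl linorder_neqE_nat)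
  have cnt: "(\<Sum>b\<in>Q. lk x b) = real (card (t ` {..<d} \<inter> Q))" if "finite Q" for Q
    using that by (simp add: lkx sum.If_cases Int_commute)
  have tl: "t ` {..<d} \<inter> {..<a} = t ` {..<i}"
  proof -
    have "t j < a \<longleftrightarrow> j < i" if "j < d" for j
      using mono[of j i] mono[of i j] i ta that by (metis less_asym linorder_neqE_nat)
    then show ?thesis using i by auto
  qed
  have lo: "(\<Sum>b<a. lk x b) = real i"
    using cnt[of "{..<a}"] inj i by (simp add: tl card_image inj_on_subset)
  have xa: "lk x a = 1" using lkx ta i by auto
  have "a \<in> supp d B" using xa x by (auto simp: cell_def)
  then obtain j where j: "a \<in> B j" "j < d"
    by (auto simp: supp_def)
  have nn: "0 \<le> lk x b" for b using x by (simp add: cell_def)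
  have z: "\<And>b. b \<notin> supp d B \<Longrightarrow> lk x b = 0" using x by (simp add: cell_def)
  have one: "(\<Sum>b\<in>B l. lk x b) = 1" if "l < d" for l using x that by (simp add: cell_def)
  have "(\<Sum>b<a. lk x b) = (\<Sum>l<d. \<Sum>b\<in>B l \<inter> {..<a}. lk x b)"
    by (rule sum_lk_blocks[OF assms(1) z]) auto
  also have "\<dots> = (\<Sum>l<d. if l < j then 1 else 0)"
  proof (rule sum.cong[OF refl])
    fix l assume l: "l \<in> {..<d}"
    consider "l < j" | "l = j" | "j < l" by linarith
    then show "(\<Sum>b\<in>B l \<inter> {..<a}. lk x b) = (if l < j then 1 else 0)"
    proof cases
      case 1
      then have "B l \<inter> {..<a} = B l" using blocks_less[OF assms(1) _ j(1)] by blast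
      then show ?thesis using one l 1 by simp
    next
      \<comment> \<open>The coordinate at \<open>a\<close> is 1 and uses up the mass of its block,
        so nothing of \<open>B j\<close> is left below \<open>a\<close>.\<close>
      case 2
      have "(\<Sum>b\<in>B j. lk x b) = lk x a + (\<Sum>b\<in>B j - {a}. lk x b)"
        using j blocks_finite[OF assms(1)] by (simp add: sum.remove)
      then have "(\<Sum>b\<in>B j - {a}. lk x b) = 0" using one j xa by simp
      moreover have "(\<Sum>b\<in>B l \<inter> {..<a}. lk x b) \<le> (\<Sum>b\<in>B j - {a}. lk x b)"
        using 2 nn blocks_finite[OF assms(1)] by (intro sum_mono2) auto
      ultimately show ?thesis using 2 nn by (simp add: order_antisym sum_nonneg)
    next
      case 3
      then have "B l \<inter> {..<a} = {}" using blocks_less[OF assms(1) j(1)] by fastforce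
      then show ?thesis using 3 by simp
    qed
  qed
  also have "\<dots> = real j"
  proof -
    have "(\<Sum>l<d. if l < j then 1 else 0) = (\<Sum>l<j. (1::real))"
      using j(2) by (intro sum.mono_neutral_cong_right) auto
    then show ?thesis by simp
  qed
  finally have "i = j" using lo by simp
  then show "a \<in> B i" using j by simp
qed

lemma cell_inject: "blocks d B \<Longrightarrow> blocks d C \<Longrightarrow> cell d B = cell d C \<longleftrightarrow> B = C"
  by (metis cell_block_order ext subset_antisym order_refl)

section \<open>Direction spaces and dimensions of cells\<close>

lemma subspace_lin: "subspace (lin d B)"
  unfolding subspace_def lin_def
  by (auto simp: lookup_add sum.distrib simp flip: sum_distrib_left)

text \<open>A cell has a point \<open>x\<close> with all coordinates on \<open>supp d B\<close>
  positive; from it a small step along any vector of \<open>lin d B\<close> stays inside the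
  cell.\<close>

lemma span_differences_cell:
  assumes "blocks d B"
  shows "span (differences (cell d B)) = lin d B"
proof
  have "differences (cell d B) \<subseteq> lin d B"
    by (auto simp: differences_def cell_def lin_def lookup_minus sum_subtractf)
  then show "span (differences (cell d B)) \<subseteq> lin d B"
    using subspace_lin by (simp add: span_minimal)
  show "lin d B \<subseteq> span (differences (cell d B))"
  proof
    fix z assume z: "z \<in> lin d B"
    obtain x where x: "x \<in> cell d B" "\<And>a. a \<in> supp d B \<Longrightarrow> 0 < lk x a"
      using cell_interior[OF assms] by blast
    \<comment> \<open>The inserted 1 covers an empty support and makes \<open>M\<close> at least 1.
      With the factor \<open>m / M\<close> no coordinate of \<open>x\<close> is lowered by more than
      \<open>m\<close>, hence none becomes negative.\<close>
    define m where "m = Min (insert 1 (lk x ` supp d B))"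
    define M where "M = Max (insert 1 ((\<lambda>a. \<bar>lk z a\<bar>) ` supp d B))"
    have fin: "finite (supp d B)" using finite_supp[OF assms] .
    have m: "0 < m" "\<And>a. a \<in> supp d B \<Longrightarrow> m \<le> lk x a"
      using fin x(2) by (auto simp: m_def)
    have M: "1 \<le> M" "\<And>a. a \<in> supp d B \<Longrightarrow> \<bar>lk z a\<bar> \<le> M"
      using fin by (auto simp: M_def)
    define y where "y = x + (m / M) *\<^sub>R z"
    have "0 \<le> lk y a" for a
    proof (cases "a \<in> supp d B")
      case True
      have "(m / M) * \<bar>lk z a\<bar> \<le> (m / M) * M"
        using m M True by (intro mult_left_mono) auto
      also have "\<dots> = m" using M by simp
      finally have "\<bar>(m / M) * lk z a\<bar> \<le> lk x a"
        using m True M by (simp add: abs_mult) (meson order_trans)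
      then have "- (lk x a) \<le> (m / M) * lk z a" by (metis abs_le_D2 minus_le_iff)
      then show ?thesis unfolding y_def by (simp only: lookup_add lk_scaleR real_scaleR_def)
    next
      case False
      then show ?thesis using x z by (simp add: y_def lookup_add cell_def lin_def)
    qed
    moreover have "(\<Sum>a\<in>B i. lk y a) = 1" if "i < d" for i
      using x z that
      by (simp add: y_def lookup_add cell_def lin_def sum.distrib flip: sum_distrib_left sum_divide_distrib)
    ultimately have "y \<in> cell d B"
      using x z by (simp add: cell_def lin_def y_def lookup_add)
    then have "y - x \<in> differences (cell d B)"
      using x by (auto simp: differences_def)
    then have "(M / m) *\<^sub>R (y - x) \<in> span (differences (cell d B))"
      by (intro span_scale span_base)
    moreover have "(M / m) *\<^sub>R (y - x) = z"
      using m M by (simp add: y_def)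
    ultimately show "z \<in> span (differences (cell d B))" by simp
  qed
qed

lemma supp_del: "supp d (del B u) = supp d B - {u}"
  by (auto simp: supp_def del_def)

lemma blocks_del:
  assumes "blocks d B" "u \<in> B i" "B i \<noteq> {u}"
  shows "blocks d (del B u)"
proof (rule blocks_subset[OF assms(1)])
  show "del B u j \<noteq> {}" if "j < d" for j
  proof (cases "j = i")
    case True
    then show ?thesis using assms by (auto simp: del_def)
  next
    case False
    then have "u \<notin> B j" using blocks_disjoint[OF assms(1,2)] by blast
    then show ?thesis using blocks_nonempty[OF assms(1) that] by (auto simp: del_def)
  qed
qed (auto simp: del_def)

lemma lin_del:
  assumes "blocks d B"
  shows "lin d (del B u) = {x \<in> lin d B. lk x u = 0}"
proof -
  have "(\<Sum>a\<in>B i. lk x a) = (\<Sum>a\<in>del B u i. lk x a)" if "lk x u = 0" for x :: point and i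
    using that by (intro sum.mono_neutral_right) (auto simp: del_def blocks_finite[OF assms])
  then show ?thesis
    by (auto simp: lin_def supp_del)
qed

text \<open>Makes the truncated difference in the dimension formula exact.\<close>

lemma card_supp_ge: "blocks d B \<Longrightarrow> d \<le> card (supp d B)"
proof -
  assume b: "blocks d B"
  obtain t where t: "\<And>i. i < d \<Longrightarrow> t i \<in> B i" using blocks_choose[OF b] by blast
  have "inj_on t {..<d}"
    using blocks_disjoint[OF b t] t by (intro inj_onI) (metis lessThan_iff)
  moreover have "t ` {..<d} \<subseteq> supp d B" using t by (auto simp: supp_def)
  ultimately show ?thesis
    using card_mono[OF finite_supp[OF b], of "t ` {..<d}"] by (simp add: card_image)
qed

lemma card_supp_singletons:
  assumes "blocks d B" "\<And>i. i < d \<Longrightarrow> is_singleton (B i)"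
  shows "card (supp d B) = d"
proof -
  have "card (supp d B) = (\<Sum>i<d. card (B i))"
    unfolding supp_def using blocks_finite[OF assms(1)]
    by (intro card_UN_disjoint) (auto dest: blocks_disjoint[OF assms(1)])
  also have "\<dots> = (\<Sum>i<d. 1)"
    using assms(2) by (intro sum.cong) (auto simp: is_singleton_altdef)
  finally show ?thesis by simp
qed

lemma edge_in_lin:
  assumes "blocks d B" "u \<in> B i" "w \<in> B i"
  shows "Poly_Mapping.single u 1 - Poly_Mapping.single w 1 \<in> lin d B"
proof -
  have "(\<Sum>a\<in>B j. lk (Poly_Mapping.single u 1 - Poly_Mapping.single w (1::real)) a) = 0" if "j < d" for j
  proof (cases "j = i")
    case True
    then show ?thesis
      using assms blocks_finite[OF assms(1)]
      by (simp add: lookup_minus lookup_single when_def sum_subtractf)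
  next
    case False
    then have "u \<notin> B j" "w \<notin> B j" using assms blocks_disjoint[OF assms(1)] by blast+
    then show ?thesis by (intro sum.neutral) (auto simp: lookup_minus lookup_single when_def)
  qed
  moreover have "u \<in> supp d B" "w \<in> supp d B"
    using assms blocks_index[OF assms(1)] by (auto simp: supp_def)
  ultimately show ?thesis by (auto simp: lin_def lookup_minus lookup_single when_def)
qed

lemma lin_singletons:
  assumes "blocks d B" "\<And>i. i < d \<Longrightarrow> is_singleton (B i)"
  shows "lin d B = {0}"
proof
  show "lin d B \<subseteq> {0}"
  proof
    fix x assume x: "x \<in> lin d B"
    have "lk x a = 0" for a
    proof (cases "a \<in> supp d B")
      case T: True
      then obtain i where i: "i < d" "a \<in> B i" by (auto simp: supp_def)
      then have "B i = {a}" using assms(2) by (metis is_singletonE singletonD)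
      then show ?thesis using x i by (auto simp: lin_def)
    qed (use x in \<open>simp add: lin_def\<close>)
    then show "x \<in> {0}" by (auto intro: poly_mapping_eqI)
  qed
qed (simp add: subspace_0[OF subspace_lin])

text \<open>A vertex \<open>u\<close> is removed from a block that also contains some
  \<open>w\<close>. This cuts \<open>lin d B\<close> with the hyperplane on which the coordinate
  \<open>u\<close> vanishes, and the edge direction e_u - e_w, which lies off it, completes a basis.
  When all blocks are singletons, nothing but 0 is left.\<close>

lemma lin_basis:
  assumes "blocks d B"
  shows "\<exists>Q. finite Q \<and> independent Q \<and> span Q = lin d B \<and> card Q = card (supp d B) - d"
  using assms
proof (induction "card (supp d B)" arbitrary: B rule: less_induct)
  case less
  note b = less.prems
  show ?case
  proof (cases "\<forall>i<d. is_singleton (B i)")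
    case True
    then have "lin d B = {0}" using lin_singletons[OF b] by blast
    then show ?thesis
      using card_supp_singletons[OF b] True by (intro exI[of _ "{}"]) (simp add: independent_empty)
  next
    case False
    then obtain i where i: "i < d" "\<not> is_singleton (B i)" by blast
    with blocks_nonempty[OF b i(1)] obtain u w where uw: "u \<in> B i" "w \<in> B i" "u \<noteq> w"
      by (metis is_singletonI' )
    have bd: "blocks d (del B u)" using uw by (intro blocks_del[OF b uw(1)]) auto
    have us: "u \<in> supp d B" using uw i by (auto simp: supp_def)
    have fin: "finite (supp d B)" using finite_supp[OF b] .
    have cd: "card (supp d (del B u)) < card (supp d B)"
      using card_Diff1_less[OF fin us] by (simp add: supp_del)
    from less.hyps[OF cd bd] obtain Q where Q: "finite Q" "independent Q"
      "span Q = lin d (del B u)" "card Q = card (supp d (del B u)) - d" by blast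
    define v :: point where "v = Poly_Mapping.single u 1 - Poly_Mapping.single w 1"
    have lkv: "lk v a = (if a = u then 1 else if a = w then -1 else 0)" for a
      using uw by (auto simp: v_def lookup_minus lookup_single when_def)
    have vl: "v \<in> lin d B" unfolding v_def by (rule edge_in_lin[OF b uw(1,2)])
    have vB: "v \<notin> span Q"
      using Q(3) lin_del[OF b] lkv[of u] by simp
    have "span (insert v Q) = lin d B"
    proof
      have "Q \<subseteq> lin d B" using Q(3) span_superset[of Q] lin_del[OF b] by blast
      then show "span (insert v Q) \<subseteq> lin d B"
        using vl subspace_lin by (intro span_minimal) auto
      show "lin d B \<subseteq> span (insert v Q)"
      proof
        fix x assume x: "x \<in> lin d B"
        have "x - lk x u *\<^sub>R v \<in> lin d B"
          using x vl subspace_lin by (intro subspace_diff subspace_scale)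
        then have "x - lk x u *\<^sub>R v \<in> span Q"
          using Q(3) by (simp add: lin_del[OF b] lookup_minus lkv)
        then show "x \<in> span (insert v Q)"
          using span_breakdown_eq[of x v Q] by blast
      qed
    qed
    moreover have "independent (insert v Q)" using Q vB by (simp add: independent_insert)
    moreover have "card (insert v Q) = card (supp d B) - d"
    proof -
      have "v \<notin> Q" using vB span_base by blast
      moreover have "card (supp d (del B u)) = card (supp d B) - 1"
        using us fin by (simp add: supp_del)
      ultimately show ?thesis using Q card_supp_ge[OF bd] cd by simp
    qed
    ultimately show ?thesis using Q(1) by blast
  qed
qed

lemma pdim_span: "pdim F = dim (span (differences F))"
  by (simp add: pdim_def dim_span)

lemma pdim_cell:
  assumes "blocks d B"
  shows "pdim (cell d B) = card (supp d B) - d"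
proof -
  obtain Q where "finite Q" "independent Q" "span Q = lin d B" "card Q = card (supp d B) - d"
    using lin_basis[OF assms] by blast
  then show ?thesis
    by (metis dim_eq_card_independent dim_span pdim_span span_differences_cell[OF assms])
qed

text \<open>The open segment between equal points is empty, so the definition of a face is silent
  about the case \<open>a = b\<close>, which is supplied here.\<close>

lemma face_of_positive_combination:
  assumes "T face_of S" "a \<in> S" "b \<in> S" "x \<in> T" "0 < u" "u < 1" "x = (1 - u) *\<^sub>R a + u *\<^sub>R b"
  shows "a \<in> T" "b \<in> T"
proof -
  have "a \<in> T \<and> b \<in> T"
  proof (cases "a = b")
    case True
    then have "x = a" using assms(7) by (simp flip: scaleR_left_distrib)
    then show ?thesis using assms True by simp
  next
    case False
    then have "x \<in> open_segment a b" using assms by (auto simp: in_segment)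
    then show ?thesis using face_ofD[OF assms(1) _ assms(2,3,4)] by blast
  qed
  then show "a \<in> T" "b \<in> T" by auto
qed

lemma cell_face_subblocks:
  assumes "blocks d B" "blocks d C" "\<And>i. C i \<subseteq> B i"
  shows "cell d C face_of cell d B"
  unfolding face_of_def
proof (intro conjI ballI impI convex_cell)
  show "cell d C \<subseteq> cell d B" using cell_mono[OF assms] by blast
  fix a b x assume ab: "a \<in> cell d B" "b \<in> cell d B" and x: "x \<in> cell d C" "x \<in> open_segment a b"
  from x(2) obtain u where u: "0 < u" "u < 1" "x = (1 - u) *\<^sub>R a + u *\<^sub>R b"
    by (auto simp: in_segment)
  have "lk a c = 0 \<and> lk b c = 0" if "c \<notin> supp d C" for c
  proof -
    have "lk x c = 0" using x that by (simp add: cell_def)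
    then have "(1 - u) * lk a c + u * lk b c = 0" using u by (simp add: lookup_add)
    moreover have "0 \<le> lk a c" "0 \<le> lk b c" using ab by (auto simp: cell_def)
    ultimately have "(1 - u) * lk a c = 0 \<and> u * lk b c = 0"
      using u by (subst (asm) add_nonneg_eq_0_iff) auto
    then show ?thesis using u by simp
  qed
  then show "a \<in> cell d C" "b \<in> cell d C"
    using ab by (auto simp: cell_mono[OF assms])
qed

text \<open>The midpoint of two points of \<open>T\<close> has the union of their supports as its
  support, so a support of largest cardinality contains all others. The point serves as a relatively
  interior point of a face.\<close>

lemma max_support_point:
  assumes "convex T" "T \<noteq> {}" "finite A"
    and "\<And>x a. x \<in> T \<Longrightarrow> 0 \<le> lk x a" "\<And>x a. x \<in> T \<Longrightarrow> a \<notin> A \<Longrightarrow> lk x a = (0::real)"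
  obtains x where "x \<in> T" "\<And>z. z \<in> T \<Longrightarrow> ks z \<subseteq> ks x"
proof -
  have kA: "ks x \<subseteq> A" if "x \<in> T" for x
    using assms(5)[OF that] by (auto simp: in_keys_iff)
  have bdd: "card (ks x) < Suc (card A)" if "x \<in> T" for x
    using kA[OF that] card_mono[OF assms(3)] by (simp add: less_Suc_eq_le)
  obtain x0 where x0: "x0 \<in> T" using assms(2) by blast
  obtain x where x: "x \<in> T" and mx: "\<forall>y. y \<in> T \<longrightarrow> card (ks y) \<le> card (ks x)"
    using ex_has_greatest_nat[of "\<lambda>x. x \<in> T" x0 "\<lambda>x. card (ks x)" "Suc (card A)"] x0 bdd
    by (metis less_imp_le)
  show thesis
  proof (rule that[OF x])
    fix z assume z: "z \<in> T"
    define y where "y = (1/2) *\<^sub>R x + (1/2) *\<^sub>R z"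
    have y: "y \<in> T" using assms(1) x z by (simp add: y_def convexD)
    have "lk y a = 0 \<longleftrightarrow> lk x a = 0 \<and> lk z a = 0" for a
      using assms(4)[OF x, of a] assms(4)[OF z, of a] by (simp add: y_def lookup_add) linarith
    then have "ks y = ks x \<union> ks z"
      unfolding set_eq_iff Un_iff in_keys_iff by blast
    moreover have "card (ks y) \<le> card (ks x)" using mx y by blast
    ultimately have "ks x \<union> ks z = ks x"
      by (metis Un_upper1 card_seteq finite_keys)
    then show "ks z \<subseteq> ks x" by blast
  qed
qed

text \<open>\<open>T\<close> is compared with the subproduct on the support of a point
  \<open>x\<close> of largest support. For \<open>z\<close> in the subproduct, the segment from
  \<open>z\<close> to \<open>x\<close> can be prolonged beyond \<open>x\<close> inside the cell; as
  \<open>x\<close> lies in \<open>T\<close>, so does \<open>z\<close>.\<close>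

lemma face_of_cell:
  assumes b: "blocks d B" and T: "T face_of cell d B" "T \<noteq> {}"
  obtains C where "blocks d C" "\<And>i. C i \<subseteq> B i" "T = cell d C"
proof -
  have Tc: "T \<subseteq> cell d B" "convex T" using T by (auto simp: face_of_def)
  obtain x where x: "x \<in> T" "\<And>z. z \<in> T \<Longrightarrow> ks z \<subseteq> ks x"
  proof (rule max_support_point[OF Tc(2) T(2) finite_supp[OF b]])
    show "0 \<le> lk y a" if "y \<in> T" for y a using Tc that by (auto simp: cell_def)
    show "lk y a = 0" if "y \<in> T" "a \<notin> supp d B" for y a using Tc that by (auto simp: cell_def)
  qed blast
  define A where "A = ks x"
  define C where "C i = B i \<inter> A" for i
  have xc: "x \<in> cell d B" using x Tc by blast
  have nn: "0 \<le> lk x a" for a using xc by (simp add: cell_def)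
  have st: "supp d C = A"
    using xc by (auto simp: supp_def C_def A_def in_keys_iff cell_def)
  have bt: "blocks d C"
  proof (rule blocks_subset[OF b])
    show "C i \<noteq> {}" if "i < d" for i
    proof
      assume "C i = {}"
      then have "(\<Sum>a\<in>B i. lk x a) = 0"
        by (intro sum.neutral) (auto simp: C_def A_def in_keys_iff)
      then show False using xc that by (simp add: cell_def)
    qed
  qed (auto simp: C_def)
  have sub: "C i \<subseteq> B i" for i by (auto simp: C_def)
  have ct: "cell d C = {y \<in> cell d B. \<forall>a. a \<notin> A \<longrightarrow> lk y a = 0}"
    using cell_mono[OF b bt sub] st by simp
  have "T = cell d C"
  proof
    show "T \<subseteq> cell d C"
    proof
      fix y assume y: "y \<in> T"
      then have "lk y a = 0" if "a \<notin> A" for a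
        using x(2)[OF y] that unfolding A_def in_keys_iff[symmetric] by (metis in_keys_iff subsetD)
      then show "y \<in> cell d C" using y Tc by (auto simp: ct)
    qed
    show "cell d C \<subseteq> T"
    proof
      fix z assume z: "z \<in> cell d C"
      have fin: "finite A" by (simp add: A_def)
      define m where "m = Min (insert 1 (lk x ` A))"
      have m: "\<And>a. a \<in> A \<Longrightarrow> m \<le> lk x a"
        using fin by (auto simp: m_def)
      have "0 < lk x a" if "a \<in> A" for a
        using nn[of a] that by (simp add: A_def in_keys_iff)
      then have m0: "0 < m" using fin by (simp add: m_def)
      have zs: "z \<in> cell d B" and z0: "\<And>a. a \<notin> A \<Longrightarrow> lk z a = 0" using z by (auto simp: ct)
      have z1: "lk z a \<le> 1" for a
      proof (cases "a \<in> supp d B")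
        case True
        then obtain i where "i < d" "a \<in> B i" by (auto simp: supp_def)
        then show ?thesis
          using zs member_le_sum[of a "B i" "lk z"] blocks_finite[OF b] by (auto simp: cell_def)
      qed (use zs in \<open>simp add: cell_def\<close>)
      \<comment> \<open>On \<open>A\<close> every coordinate of \<open>x\<close> is at least
        \<open>m\<close> and every coordinate of \<open>z\<close> at most 1, so \<open>m\<close>
        times \<open>z\<close> can be subtracted from \<open>x\<close>.\<close>
      define w where "w = x + m *\<^sub>R (x - z)"
      have wnn: "0 \<le> lk w a" for a
      proof (cases "a \<in> A")
        case True
        have "m * lk z a \<le> m * 1" using m0 z1 by (intro mult_left_mono) auto
        then have "0 \<le> lk x a - m * lk z a" using m[OF True] by linarith
        moreover have "0 \<le> m * lk x a" using m0 nn by simp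
        moreover have "lk w a = (lk x a - m * lk z a) + m * lk x a"
          by (simp add: w_def lookup_add lookup_minus algebra_simps)
        ultimately show ?thesis by linarith
      next
        case False
        then show ?thesis by (simp add: w_def lookup_add lookup_minus z0 A_def in_keys_iff)
      qed
      have "w \<in> cell d B"
        using xc zs wnn
        by (simp add: w_def cell_def lookup_add lookup_minus sum.distrib sum_subtractf flip: sum_distrib_left)
      moreover have "x = (1 - m / (1 + m)) *\<^sub>R w + (m / (1 + m)) *\<^sub>R z"
      proof -
        have "1 - m / (1 + m) = 1 / (1 + m)" using m0 by (simp add: field_simps)
        moreover have "(1 + m) *\<^sub>R x = w + m *\<^sub>R z" by (simp add: w_def algebra_simps)
        then have "x = (1 / (1 + m)) *\<^sub>R (w + m *\<^sub>R z)" using m0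
          by (metis add_pos_pos less_numeral_extra(1) less_numeral_extra(3) nonzero_divide_eq_eq scaleR_one scaleR_scaleR)
        ultimately show ?thesis by (simp add: scaleR_right_distrib)
      qed
      moreover have "0 < m / (1 + m)" "m / (1 + m) < 1" using m0 by auto
      ultimately show "z \<in> T"
        using face_of_positive_combination(2)[OF T(1) _ zs x(1)] by blast
    qed
  qed
  then show thesis using that[OF bt sub] by blast
qed

lemma supp_mono_eq:
  assumes "blocks d B" "\<And>i. C i \<subseteq> B i" "supp d C = supp d B" "blocks d C"
  shows "C = B"
proof
  fix i
  show "C i = B i"
  proof
    show "B i \<subseteq> C i"
    proof
      fix a assume a: "a \<in> B i"
      then have "a \<in> supp d C" using assms(3) in_supp[OF assms(1)] by blast
      then obtain j where j: "a \<in> C j" using in_supp[OF assms(4)] by blast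
      then have "i = j" using a assms(2) blocks_disjoint[OF assms(1)] by blast
      then show "a \<in> C i" using j by simp
    qed
  qed (rule assms(2))
qed

text \<open>The dimension is the size of the support minus \<open>d\<close>, so a face of
  codimension one misses exactly one vertex.\<close>

lemma is_facet_cell_iff:
  assumes "blocks d B"
  shows "is_facet G (cell d B) \<longleftrightarrow>
    (\<exists>u. u \<in> supp d B \<and> blocks d (del B u) \<and> G = cell d (del B u))"
proof
  assume f: "is_facet G (cell d B)"
  then have G: "G face_of cell d B" "G \<noteq> {}" by (auto simp: is_facet_def)
  then obtain C where C: "blocks d C" "\<And>i. C i \<subseteq> B i" "G = cell d C"
    using face_of_cell[OF assms] by metis
  have fin: "finite (supp d B)" using finite_supp[OF assms] .
  have sub: "supp d C \<subseteq> supp d B" using C(2) by (auto simp: supp_def)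
  have "card (supp d B) - d = card (supp d C) - d + 1"
    using f C(3) pdim_cell[OF assms] pdim_cell[OF C(1)] by (simp add: is_facet_def)
  then have "card (supp d B) = card (supp d C) + 1"
    using card_supp_ge[OF assms] card_supp_ge[OF C(1)] by linarith
  then have "card (supp d B - supp d C) = 1"
    using sub fin by (simp add: card_Diff_subset finite_subset)
  then obtain u where u: "supp d B - supp d C = {u}" by (metis card_1_singletonE)
  have sub': "C i \<subseteq> del B u i" for i
    using C(2)[of i] u in_supp[OF C(1)] by (auto simp: del_def)
  then have bd: "blocks d (del B u)"
    using blocks_nonempty[OF C(1)] by (intro blocks_subset[OF assms]) (auto simp: del_def, blast)
  have "C = del B u"
    using u sub by (intro supp_mono_eq[OF bd sub' _ C(1)]) (auto simp: supp_del)
  then show "\<exists>u. u \<in> supp d B \<and> blocks d (del B u) \<and> G = cell d (del B u)"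
    using u bd C(3) by blast
next
  assume "\<exists>u. u \<in> supp d B \<and> blocks d (del B u) \<and> G = cell d (del B u)"
  then obtain u where u: "u \<in> supp d B" "blocks d (del B u)" "G = cell d (del B u)" by blast
  have "G face_of cell d B"
    unfolding u(3) by (rule cell_face_subblocks[OF assms u(2)]) (auto simp: del_def)
  moreover have "card (supp d (del B u)) = card (supp d B) - 1"
    using u(1) finite_supp[OF assms] by (simp add: supp_del)
  ultimately show "is_facet G (cell d B)"
    using u cell_nonempty[OF u(2)] pdim_cell[OF assms] pdim_cell[OF u(2)] card_supp_ge[OF u(2)]
      card_supp_ge[OF assms] card_gt_0_iff[of "supp d B"] finite_supp[OF assms]
    by (auto simp: is_facet_def)
qed

subsection \<open>Incidence signs\<close>

definition lbasis :: "'a::real_vector list \<Rightarrow> 'a set \<Rightarrow> bool" where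
  "lbasis bs U \<longleftrightarrow> distinct bs \<and> independent (set bs) \<and> span (set bs) = U"

lemma lbasis_length: "lbasis bs U \<Longrightarrow> length bs = dim U"
  unfolding lbasis_def by (metis dim_eq_card_independent dim_span distinct_card)

lemma lbasis_subset: "lbasis bs U \<Longrightarrow> set bs \<subseteq> U"
  unfolding lbasis_def using span_superset by blast

lemma representation_chain:
  assumes A: "lbasis A U" and B: "lbasis B U" and v: "v \<in> U"
  shows "representation (set A) v a =
    (\<Sum>k<length B. representation (set A) (B ! k) a * representation (set B) v (B ! k))"
proof -
  have "v = (\<Sum>b\<in>set B. representation (set B) v b *\<^sub>R b)"
    using B v sum_representation_eq[of "set B" v "set B"] by (simp add: lbasis_def)
  also have "\<dots> = (\<Sum>k<length B. representation (set B) v (B ! k) *\<^sub>R (B ! k))"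
    using B bij_betw_nth[of B "{..<length B}" "set B"]
    by (intro sum.reindex_bij_betw[symmetric]) (auto simp: lbasis_def)
  finally have eq: "v = \<dots>" .
  have inA: "B ! k \<in> span (set A)" if "k < length B" for k
    using lbasis_subset[OF B] A that by (auto simp: lbasis_def)
  let ?c = "\<lambda>k. representation (set B) v (B ! k)"
  have iA: "independent (set A)" using A by (simp add: lbasis_def)
  have "representation (set A) v a = representation (set A) (\<Sum>k<length B. ?c k *\<^sub>R (B ! k)) a"
    by (rule arg_cong[OF eq])
  also have "\<dots> = (\<Sum>k<length B. representation (set A) (?c k *\<^sub>R (B ! k)) a)"
    using inA by (subst representation_sum[OF iA]) (auto intro: span_scale)
  also have "\<dots> = (\<Sum>k<length B. representation (set A) (B ! k) a * ?c k)"
    using inA by (intro sum.cong) (simp_all add: representation_scale[OF iA] mult.commute)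
  finally show ?thesis .
qed

text \<open>The matrix of \<open>vs\<close> over \<open>A\<close> is the change-of-basis matrix
  times the matrix of \<open>vs\<close> over \<open>B\<close>.\<close>

lemma coord_det_chain:
  assumes A: "lbasis A U" and B: "lbasis B U" and vs: "set vs \<subseteq> U" "length vs = length B"
  shows "coord_det A vs = coord_det A B * coord_det B vs"
proof -
  have len: "length A = length B" using lbasis_length[OF A] lbasis_length[OF B] by simp
  let ?n = "length B"
  let ?M = "\<lambda>A vs. mat ?n ?n (\<lambda>(i, j). representation (set A) (vs ! j) (A ! i))"
  have "?M A vs = ?M A B * ?M B vs"
  proof (rule eq_matI)
    fix i j assume ij: "i < dim_row (?M A B * ?M B vs)" "j < dim_col (?M A B * ?M B vs)"
    then have "vs ! j \<in> U" using vs by (simp add: subset_iff)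
    then show "?M A vs $$ (i, j) = (?M A B * ?M B vs) $$ (i, j)"
      using ij representation_chain[OF A B, of "vs ! j" "A ! i"]
      by (simp add: scalar_prod_def atLeast0LessThan)
  qed auto
  then have "det (?M A vs) = det (?M A B) * det (?M B vs)"
    by (simp add: det_mult[of _ ?n])
  then show ?thesis using len by (simp add: coord_det_def)
qed

lemma coord_det_self:
  assumes "lbasis A U"
  shows "coord_det A A = 1"
proof -
  have "mat (length A) (length A) (\<lambda>(i, j). representation (set A) (A ! j) (A ! i)) = 1\<^sub>m (length A)"
    using assms by (intro eq_matI) (auto simp: lbasis_def representation_basis nth_eq_iff_index_eq)
  then show ?thesis by (simp add: coord_det_def)
qed

lemma coord_det_nonzero:
  assumes "lbasis A U" "lbasis B U"
  shows "coord_det A B \<noteq> 0"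
proof -
  have "coord_det A B * coord_det B A = 1"
    using coord_det_chain[OF assms, of A] coord_det_self[OF assms(1)]
      lbasis_subset[OF assms(1)] lbasis_length[OF assms(1)] lbasis_length[OF assms(2)] by simp
  then show ?thesis by auto
qed

text \<open>With a common first vector and the others in the span of \<open>B\<close>, the matrix is
  block diagonal with a 1 in the corner.\<close>

lemma coord_det_Cons:
  assumes v: "lbasis (v # B) U" and ws: "set ws \<subseteq> span (set B)" "length ws = length B"
  shows "coord_det (v # B) (v # ws) = coord_det B ws"
proof -
  let ?n = "length B"
  let ?R = "representation (set (v # B))"
  have ind: "independent (set (v # B))" and vB: "v \<notin> set B"
    using v by (auto simp: lbasis_def)
  have indB: "independent (set B)" by (rule independent_mono[OF ind]) auto
  have rep: "?R w = representation (set B) w" if "w \<in> set ws" for w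
    using ws that ind by (intro representation_extend) auto
  have rv: "representation (set B) w v = 0" for w
    using vB representation_ne_zero by blast
  let ?M = "mat ?n ?n (\<lambda>(i, j). representation (set B) (ws ! j) (B ! i))"
  let ?F = "four_block_mat (1\<^sub>m 1) (0\<^sub>m 1 ?n) (0\<^sub>m ?n 1) ?M"
  have "mat (Suc ?n) (Suc ?n) (\<lambda>(i, j). ?R ((v # ws) ! j) ((v # B) ! i)) = ?F"
  proof (rule eq_matI)
    fix i j assume "i < dim_row ?F" "j < dim_col ?F"
    then have ij: "i < Suc ?n" "j < Suc ?n" by auto
    show "mat (Suc ?n) (Suc ?n) (\<lambda>(i, j). ?R ((v # ws) ! j) ((v # B) ! i)) $$ (i, j) = ?F $$ (i, j)"
    proof (cases j)
      case 0
      have "?R v = (\<lambda>w. if w = v then 1 else 0)"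
        using ind by (intro representation_basis) auto
      then show ?thesis using 0 ij vB by (cases i) (auto simp: nth_mem)
    next
      case (Suc k)
      then have "ws ! k \<in> set ws" using ij ws by simp
      then show ?thesis using Suc ij rep rv by (cases i) auto
    qed
  qed auto
  then have "coord_det (v # B) (v # ws) = det ?F"
    by (simp add: coord_det_def)
  also have "\<dots> = det ?M"
    by (subst det_four_block_mat_lower_left_zero[of _ 1 _ ?n]) auto
  finally show ?thesis by (simp add: coord_det_def)
qed

lemma det_2x2:
  assumes "A \<in> carrier_mat 2 2"
  shows "det (A :: real mat) = A $$ (0,0) * A $$ (1,1) - A $$ (0,1) * A $$ (1,0)"
proof -
  let ?e = "\<lambda>i j. mat 1 1 (\<lambda>_. A $$ (i, j))"
  have "A = four_block_mat (?e 0 0) (?e 0 1) (?e 1 0) (?e 1 1)"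
    using assms by (intro eq_matI) (auto simp: less_Suc_eq)
  then have "det A = det (?e 0 0 * ?e 1 1 - ?e 0 1 * ?e 1 0)"
    by (subst (1) \<open>A = _\<close>, subst det_four_block_mat[of _ 1])
      (auto intro!: eq_matI simp: scalar_prod_def mult.commute)
  also have "\<dots> = A $$ (0,0) * A $$ (1,1) - A $$ (0,1) * A $$ (1,0)"
    by (subst det_single) (auto simp: scalar_prod_def)
  finally show ?thesis .
qed

text \<open>All columns but the first two are unit vectors, so only the upper left 2 x 2 block
  counts.\<close>

lemma coord_det_two:
  assumes C: "lbasis (p # q # G) U"
  shows "coord_det (p # q # G) (x # y # G) =
    representation (set (p # q # G)) x p * representation (set (p # q # G)) y q -
    representation (set (p # q # G)) y p * representation (set (p # q # G)) x q"
proof -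
  let ?n = "length G"
  let ?R = "representation (set (p # q # G))"
  let ?f = "\<lambda>(i, j). ?R ((x # y # G) ! j) ((p # q # G) ! i)"
  let ?F = "four_block_mat (mat 2 2 ?f) (0\<^sub>m 2 ?n) (mat ?n 2 (\<lambda>(i, j). ?f (i + 2, j))) (1\<^sub>m ?n)"
  have d: "distinct (p # q # G)" and ind: "independent (set (p # q # G))"
    using C by (auto simp: lbasis_def)
  have "mat (Suc (Suc ?n)) (Suc (Suc ?n)) ?f = ?F"
  proof (rule eq_matI)
    fix i j assume "i < dim_row ?F" "j < dim_col ?F"
    then have ij: "i < Suc (Suc ?n)" "j < Suc (Suc ?n)" by auto
    show "mat (Suc (Suc ?n)) (Suc (Suc ?n)) ?f $$ (i, j) = ?F $$ (i, j)"
    proof (cases "j < 2")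
      case True
      then show ?thesis using ij by (auto simp: numeral_2_eq_2)
    next
      case False
      then obtain k where k: "j = Suc (Suc k)" "k < ?n"
        using ij by (metis Suc_less_eq Suc_1 less_2_cases_iff not_less_eq old.nat.exhaust numeral_2_eq_2 zero_less_Suc)
      have "?R (G ! k) = (\<lambda>w. if w = G ! k then 1 else 0)"
        using k ind by (intro representation_basis) auto
      moreover have "p \<noteq> G ! k" "q \<noteq> G ! k" using d k by auto
      moreover have "G ! l = G ! k \<longleftrightarrow> l = k" if "l < ?n" for l
        using d k that by (simp add: nth_eq_iff_index_eq)
      ultimately show ?thesis
        using k ij by (cases i; cases "i - 1") (auto simp: less_2_cases_iff)
    qed
  qed auto
  then have "coord_det (p # q # G) (x # y # G) = det ?F"
    by (simp add: coord_det_def)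
  also have "\<dots> = det (mat 2 2 ?f)"
    by (subst det_four_block_mat_upper_right_zero[of _ 2 _ ?n]) auto
  also have "\<dots> = ?R x p * ?R y q - ?R y p * ?R x q"
    by (subst det_2x2) auto
  finally show ?thesis .
qed

lemma lbasis_Cons:
  assumes H: "lbasis H {x \<in> U. f x = 0}" and f: "linear f" and U: "subspace U"
    and p: "p \<in> U" "f p \<noteq> (0::real)"
  shows "lbasis (p # H) U"
proof -
  have pn: "p \<notin> span (set H)" using H p by (auto simp: lbasis_def)
  then have "distinct (p # H)" using H span_base by (auto simp: lbasis_def)
  moreover have "independent (set (p # H))"
    using H pn by (auto simp: lbasis_def independent_insert)
  moreover have "span (set (p # H)) = U"
  proof
    have "set H \<subseteq> U" using lbasis_subset[OF H] by blast
    then show "span (set (p # H)) \<subseteq> U" using p U by (intro span_minimal) auto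
    show "U \<subseteq> span (set (p # H))"
    proof
      fix x assume x: "x \<in> U"
      have "f (x - (f x / f p) *\<^sub>R p) = 0"
        using f p by (simp add: linear_diff linear_scale)
      then have "x - (f x / f p) *\<^sub>R p \<in> span (set H)"
        using H x p U by (auto simp: lbasis_def intro!: subspace_diff subspace_scale)
      then show "x \<in> span (set (p # H))"
        using span_breakdown_eq[of x p "set H"] by auto
    qed
  qed
  ultimately show ?thesis by (simp add: lbasis_def)
qed

text \<open>
  The product of the two incidence numbers along \<open>F, H\<^sub>1, G\<close> is the sign of \<open>o\<^sub>1, p\<^sub>1\<close> followed by the
  basis of \<open>G\<close>, taken with respect to the basis of \<open>F\<close>. Modulo the span of \<open>G\<close> the pairs \<open>o\<^sub>1, p\<^sub>1\<close> and
  \<open>o\<^sub>2, p\<^sub>2\<close> are oppositely oriented.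
\<close>

lemma incidence_sign_diamond:
  fixes f g :: "'a::real_vector \<Rightarrow> real"
  assumes f: "linear f" and g: "linear g" and U: "subspace U"
    and F: "lbasis F U" and H1: "lbasis H1 {x \<in> U. f x = 0}" and H2: "lbasis H2 {x \<in> U. g x = 0}"
    and G: "lbasis G {x \<in> U. f x = 0 \<and> g x = 0}"
    and o1: "o1 \<in> U" "f o1 < 0" and p1: "p1 \<in> U" "f p1 = 0" "g p1 < 0"
    and o2: "o2 \<in> U" "g o2 < 0" and p2: "p2 \<in> U" "g p2 = 0" "f p2 < 0"
  shows "(coord_det F (o1 # H1) > 0 \<longleftrightarrow> coord_det H1 (p1 # G) > 0) \<longleftrightarrow>
    \<not> (coord_det F (o2 # H2) > 0 \<longleftrightarrow> coord_det H2 (p2 # G) > 0)"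
proof -
  have Uf: "subspace {x \<in> U. f x = 0}" and Ug: "subspace {x \<in> U. g x = 0}"
    using U f g by (auto simp: subspace_def linear_0 linear_add linear_scale)
  have B1: "lbasis (o1 # H1) U" using lbasis_Cons[OF H1 f U o1(1)] o1 by simp
  have B2: "lbasis (o2 # H2) U" using lbasis_Cons[OF H2 g U o2(1)] o2 by simp
  have G1: "lbasis (p1 # G) {x \<in> U. f x = 0}"
    using p1 G by (intro lbasis_Cons[where f = g] g Uf) (auto simp: conj_assoc)
  have G2: "lbasis (p2 # G) {x \<in> U. g x = 0}"
    using p2 G by (intro lbasis_Cons[where f = f] f Ug) (auto simp: conj_ac)
  have C1: "lbasis (o1 # p1 # G) U" using lbasis_Cons[OF G1 f U o1(1)] o1 by simp
  have C2: "lbasis (o2 # p2 # G) U" using lbasis_Cons[OF G2 g U o2(1)] o2 by simp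
  have e1: "coord_det F (o1 # p1 # G) = coord_det F (o1 # H1) * coord_det H1 (p1 # G)"
    using coord_det_chain[OF F B1, of "o1 # p1 # G"] coord_det_Cons[OF B1, of "p1 # G"]
      lbasis_subset[OF C1] lbasis_length[OF C1] lbasis_length[OF B1] lbasis_subset[OF G1] H1
    by (simp add: lbasis_def)
  have e2: "coord_det F (o2 # p2 # G) = coord_det F (o2 # H2) * coord_det H2 (p2 # G)"
    using coord_det_chain[OF F B2, of "o2 # p2 # G"] coord_det_Cons[OF B2, of "p2 # G"]
      lbasis_subset[OF C2] lbasis_length[OF C2] lbasis_length[OF B2] lbasis_subset[OF G2] H2
    by (simp add: lbasis_def)
  let ?R = "representation (set (o1 # p1 # G))"
  have Gz: "f b = 0" "g b = 0" if "b \<in> set G" for b using lbasis_subset[OF G] that by auto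
  have dG: "o1 \<noteq> p1" "o1 \<notin> set G" "p1 \<notin> set G" using C1 by (auto simp: lbasis_def)
  have val: "h x = ?R x o1 * h o1 + ?R x p1 * h p1"
    if h: "linear h" "\<And>b. b \<in> set G \<Longrightarrow> h b = 0" and x: "x \<in> U" for h :: "'a \<Rightarrow> real" and x
  proof -
    have "x = (\<Sum>b\<in>set (o1 # p1 # G). ?R x b *\<^sub>R b)"
      using C1 x sum_representation_eq[of "set (o1 # p1 # G)" x "set (o1 # p1 # G)"]
      by (simp add: lbasis_def)
    then have "h x = h (\<Sum>b\<in>set (o1 # p1 # G). ?R x b *\<^sub>R b)"
      by (rule arg_cong)
    also have "\<dots> = (\<Sum>b\<in>set (o1 # p1 # G). ?R x b * h b)"
      by (simp only: linear_sum[OF h(1)] linear_scale[OF h(1)] real_scaleR_def)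
    also have "\<dots> = ?R x o1 * h o1 + (?R x p1 * h p1 + (\<Sum>b\<in>set G. ?R x b * h b))"
      using dG by simp
    also have "(\<Sum>b\<in>set G. ?R x b * h b) = 0" using h(2) by (intro sum.neutral) auto
    finally show ?thesis by simp
  qed
  \<comment> \<open>Coordinates of \<open>o2\<close> and \<open>p2\<close> with respect to
    \<open>o1\<close> and \<open>p1\<close>, modulo the span of \<open>G\<close>. Their 2 x 2
    determinant gives the orientation of the second pair relative to the first.\<close>
  define a b c e where abce: "a = ?R o2 o1" "b = ?R o2 p1" "c = ?R p2 o1" "e = ?R p2 p1"
  have g_o2: "g o2 = a * g o1 + b * g p1" and g_p2: "0 = c * g o1 + e * g p1" and f_p2: "f p2 = c * f o1"
    using val[OF g Gz(2) o2(1)] val[OF g Gz(2) p2(1)] val[OF f Gz(1) p2(1)] p1 p2 by (simp_all add: abce)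
  have c: "0 < c" using f_p2 p2 o1 by (metis mult_nonpos_nonpos not_le less_imp_le)
  \<comment> \<open>Multiplying by \<open>g p1\<close> allows \<open>e\<close> and \<open>b\<close>
    to be eliminated through the values of \<open>g\<close> at \<open>p2\<close> and
    \<open>o2\<close>. The right-hand side is positive, while \<open>g p1\<close> is
    negative.\<close>
  have "(a * e - c * b) * g p1 = - (c * g o2)"
  proof -
    have "(a * e - c * b) * g p1 = a * (e * g p1) - c * (b * g p1)" by (simp add: algebra_simps)
    also have "e * g p1 = - (c * g o1)" using g_p2 by linarith
    finally show ?thesis by (simp add: g_o2 algebra_simps)
  qed
  moreover have "0 < - (c * g o2)" using c o2 by (simp add: mult_pos_neg)
  ultimately have neg: "a * e - c * b < 0"
    using p1(3) by (metis mult_nonneg_nonpos less_imp_le not_le)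
  have "coord_det F (o2 # p2 # G) = coord_det F (o1 # p1 # G) * (a * e - c * b)"
    using coord_det_chain[OF F C1, of "o2 # p2 # G"] lbasis_subset[OF C2] lbasis_length[OF C2]
      lbasis_length[OF C1] coord_det_two[OF C1, of o2 p2] by (simp add: abce)
  moreover have "coord_det F (o1 # p1 # G) \<noteq> 0" using coord_det_nonzero[OF F C1] .
  moreover have "coord_det F (o1 # H1) \<noteq> 0" "coord_det F (o2 # H2) \<noteq> 0"
    "coord_det H1 (p1 # G) \<noteq> 0" "coord_det H2 (p2 # G) \<noteq> 0"
    using coord_det_nonzero F B1 B2 H1 G1 H2 G2 by blast+
  ultimately show ?thesis
    using neg e1 e2 by (smt (verit) mult_less_0_iff zero_less_mult_iff)
qed

subsection \<open>Faces of polytopes\<close>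

text \<open>In a convex combination that represents a point of \<open>F\<close>, every
  \<open>s\<close> with nonzero weight lies in \<open>F\<close>: the point is on the segment from
  \<open>s\<close> to the normalised remainder of the combination.\<close>

lemma face_of_convex_hull_finite:
  fixes S :: "'a::real_vector set"
  assumes S: "finite S" and F: "F face_of convex hull S"
  shows "F = convex hull (F \<inter> S)"
proof
  have "convex F" using F by (simp add: face_of_def)
  then show "convex hull (F \<inter> S) \<subseteq> F" by (intro hull_minimal) auto
  show "F \<subseteq> convex hull (F \<inter> S)"
  proof
    fix x assume x: "x \<in> F"
    then have "x \<in> convex hull S" using F by (auto simp: face_of_def)
    then obtain u where u: "\<And>s. s \<in> S \<Longrightarrow> 0 \<le> u s" "sum u S = 1" "(\<Sum>s\<in>S. u s *\<^sub>R s) = x"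
      using convex_hull_finite[OF S] by auto
    have inF: "s \<in> F" if s: "s \<in> S" "u s \<noteq> 0" for s
    proof -
      have pos: "0 < u s" using u(1) s by (simp add: less_le)
      have rest: "sum u (S - {s}) = 1 - u s" using u(2) S s by (simp add: sum_diff1)
      show ?thesis
      proof (cases "u s = 1")
        case True
        have "u t = 0" if "t \<in> S - {s}" for t
        proof -
          have "sum u (S - {s}) = 0" using rest True by simp
          then show ?thesis using S u(1) that by (subst (asm) sum_nonneg_eq_0_iff) auto
        qed
        then have "(\<Sum>t\<in>S - {s}. u t *\<^sub>R t) = 0" by (intro sum.neutral) simp
        then have "x = s" using u(3) True S s by (simp add: sum.remove)
        then show ?thesis using x by simp
      next
        case False
        have "0 \<le> sum u (S - {s})" using u(1) by (intro sum_nonneg) auto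
        then have l: "u s < 1" using rest False by simp
        define y where "y = (\<Sum>t\<in>S - {s}. (u t / (1 - u s)) *\<^sub>R t)"
        have "y \<in> convex hull S"
          unfolding y_def
        proof (rule convex_sum)
          show "(\<Sum>t\<in>S - {s}. u t / (1 - u s)) = 1"
            using rest l by (simp flip: sum_divide_distrib)
        qed (use S u(1) l in \<open>auto intro: hull_inc\<close>)
        moreover have "x = (1 - u s) *\<^sub>R y + u s *\<^sub>R s"
          using u(3) S s l by (simp add: y_def scaleR_sum_right sum.remove add.commute)
        ultimately show ?thesis
          using face_of_positive_combination(2)[OF F _ _ x pos l] s by (simp add: hull_inc)
      qed
    qed
    have "(\<Sum>s\<in>F \<inter> S. u s *\<^sub>R s) = (\<Sum>s\<in>S. u s *\<^sub>R s)" "sum u (F \<inter> S) = sum u S"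
      using S inF by (intro sum.mono_neutral_left; force)+
    then show "x \<in> convex hull (F \<inter> S)"
      using convex_hull_finite[of "F \<inter> S"] S u by auto
  qed
qed

text \<open>Each face is the hull of some of the finitely many generators.\<close>

lemma polytope_faces:
  fixes P :: "'a::real_vector set"
  assumes "polytope P"
  shows "finite {F. F face_of P}" "F face_of P \<Longrightarrow> polytope F"
proof -
  obtain S where S: "finite S" "P = convex hull S" using assms by (auto simp: polytope_def)
  have "{F. F face_of P} \<subseteq> (\<lambda>A. convex hull A) ` Pow S"
    using face_of_convex_hull_finite[OF S(1)] S(2) by blast
  then show "finite {F. F face_of P}" by (rule finite_subset) (simp add: S(1))
  show "polytope F" if "F face_of P" for F
    using face_of_convex_hull_finite[OF S(1), of F] S that unfolding polytope_def
    by (metis finite_Int)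
qed

lemma polytope_set_plus:
  fixes P Q :: "'a::real_vector set"
  assumes "polytope P" "polytope Q"
  shows "polytope (P + Q)"
  using assms unfolding polytope_def by (metis convex_hull_set_plus finite_set_plus)

lemma polytope_set_sum:
  fixes P :: "'i \<Rightarrow> 'a::real_vector set"
  assumes "\<And>i. i \<in> I \<Longrightarrow> polytope (P i)"
  shows "polytope (sum P I)"
  using assms
proof (induction I rule: infinite_finite_induct)
  case (insert i I)
  then show ?case by (simp add: polytope_set_plus)
qed (auto simp: polytope_def set_zero intro: exI[of _ "{0}"])

subsection \<open>The staircase subdivision of a dilated simplex\<close>

text \<open>Encoded as a cell with a single block, so that the results on faces of cells
  apply.\<close>

definition face_simplex :: "nat set \<Rightarrow> point set" where
  "face_simplex A = cell 1 (\<lambda>i. if i = 0 then A else {})"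

lemma supp_single [simp]: "supp (Suc 0) (\<lambda>i. if i = 0 then A else {}) = A"
  by (auto simp: supp_def)

lemma blocks_single: "finite A \<Longrightarrow> A \<noteq> {} \<Longrightarrow> blocks 1 (\<lambda>i. if i = 0 then A else {})"
  by (auto simp: blocks_def)

lemma face_simplex_iff:
  "x \<in> face_simplex A \<longleftrightarrow>
    (\<forall>a. 0 \<le> lk x a) \<and> (\<forall>a. a \<notin> A \<longrightarrow> lk x a = 0) \<and> (\<Sum>a\<in>A. lk x a) = 1"
  by (simp add: face_simplex_def cell_def)

lemma face_simplex_hull:
  assumes "finite A"
  shows "face_simplex A = convex hull ((\<lambda>a. Poly_Mapping.single a 1) ` A)"
proof
  have "Poly_Mapping.single a 1 \<in> face_simplex A" if "a \<in> A" for a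
    using that assms by (auto simp: face_simplex_iff lookup_single when_def)
  then show "convex hull ((\<lambda>a. Poly_Mapping.single a 1) ` A) \<subseteq> face_simplex A"
    unfolding face_simplex_def by (intro hull_minimal convex_cell) auto
  show "face_simplex A \<subseteq> convex hull ((\<lambda>a. Poly_Mapping.single a 1) ` A)"
  proof
    fix x assume x: "x \<in> face_simplex A"
    have "(\<Sum>a\<in>A. lk x a *\<^sub>R Poly_Mapping.single a 1) = x"
    proof (rule poly_mapping_eqI)
      fix b
      have "lk (\<Sum>a\<in>A. lk x a *\<^sub>R Poly_Mapping.single a (1::real)) b = (\<Sum>a\<in>A. if a = b then lk x a else 0)"
        unfolding lookup_sum by (intro sum.cong) (auto simp: lookup_single when_def)
      then show "lk (\<Sum>a\<in>A. lk x a *\<^sub>R Poly_Mapping.single a (1::real)) b = lk x b"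
        using x assms by (simp add: face_simplex_iff)
    qed
    moreover have "(\<Sum>a\<in>A. lk x a *\<^sub>R Poly_Mapping.single a (1::real))
        \<in> convex hull ((\<lambda>a. Poly_Mapping.single a 1) ` A)"
      using x assms by (intro convex_sum) (auto simp: face_simplex_iff intro: hull_inc)
    ultimately show "x \<in> convex hull ((\<lambda>a. Poly_Mapping.single a 1) ` A)" by simp
  qed
qed

lemma std_simplex_eq: "std_simplex m = face_simplex {..m}"
  by (simp add: std_simplex_def face_simplex_hull)

lemma polytope_face_simplex: "finite A \<Longrightarrow> polytope (face_simplex A)"
  unfolding polytope_def using face_simplex_hull by blast

lemma face_simplex_face:
  assumes "finite A" "B \<subseteq> A" "B \<noteq> {}"
  shows "face_simplex B face_of face_simplex A"
  unfolding face_simplex_def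
  by (rule cell_face_subblocks; (rule blocks_single)?) (use assms in \<open>auto intro: finite_subset\<close>)

lemma face_simplex_mono: "finite A \<Longrightarrow> B \<subseteq> A \<Longrightarrow> B \<noteq> {} \<Longrightarrow> face_simplex B \<subseteq> face_simplex A"
  using face_simplex_face face_of_imp_subset by blast

text \<open>
  For a nondecreasing \<open>k\<close> from \<open>0\<close> to \<open>r - 1\<close> the cell \<open>maxcell r m k\<close> is the Minkowski sum of the
  simplices on \<open>stair_block m k i\<close>, \<open>i < r\<close>. A point of the cell is decomposed by clamping its partial
  sums to the unit interval above \<open>i\<close>.
\<close>

definition psum :: "nat \<Rightarrow> point \<Rightarrow> real" where
  "psum j x = (\<Sum>a<j. lk x a)"

definition big_simplex :: "nat \<Rightarrow> nat \<Rightarrow> point set" where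
  "big_simplex r m = {x. (\<forall>a. 0 \<le> lk x a) \<and> (\<forall>a>m. lk x a = 0) \<and> (\<Sum>a\<le>m. lk x a) = real r}"

text \<open>\<open>k j\<close> is the lower end of the unit interval that confines
  \<open>psum j\<close>. Beyond \<open>m\<close> this partial sum is \<open>r\<close>, the upper end
  of the last interval, hence the value \<open>r - 1\<close>; fixing it there leaves finitely many
  stairs.\<close>

definition stair :: "nat \<Rightarrow> nat \<Rightarrow> (nat \<Rightarrow> nat) \<Rightarrow> bool" where
  "stair r m k \<longleftrightarrow> mono k \<and> k 0 = 0 \<and> (\<forall>j>m. k j = r - 1)"

definition maxcell :: "nat \<Rightarrow> nat \<Rightarrow> (nat \<Rightarrow> nat) \<Rightarrow> point set" where
  "maxcell r m k = {x \<in> big_simplex r m. \<forall>j. real (k j) \<le> psum j x \<and> psum j x \<le> real (k j) + 1}"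

text \<open>The coordinates in which the partial sum may move inside the unit interval above
  \<open>i\<close>. Consecutive blocks below \<open>r\<close> share the coordinate in which the sum
  passes from one interval to the next, so in general the lemmas on disjoint \<open>blocks\<close>
  do not cover \<open>maxcell\<close>.\<close>

definition stair_block :: "nat \<Rightarrow> (nat \<Rightarrow> nat) \<Rightarrow> nat \<Rightarrow> nat set" where
  "stair_block m k i = {a. a \<le> m \<and> k a \<le> i \<and> i \<le> k (Suc a)}"

definition staircase_subdivision :: "nat \<Rightarrow> nat \<Rightarrow> point set set" where
  "staircase_subdivision r m = {F. \<exists>k. stair r m k \<and> F face_of maxcell r m k}"

lemma psum_Suc: "psum (Suc j) x = psum j x + lk x j"
  by (simp add: psum_def)

lemma psum_0 [simp]: "psum 0 x = 0"
  by (simp add: psum_def)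

lemma psum_mono: "(\<And>a. 0 \<le> lk x a) \<Longrightarrow> i \<le> j \<Longrightarrow> psum i x \<le> psum j x"
  unfolding psum_def by (rule sum_mono2) auto

lemma psum_add: "psum j (x + y) = psum j x + psum j y"
  by (simp add: psum_def lookup_add sum.distrib)

lemma psum_scaleR: "psum j (r *\<^sub>R x) = r * psum j x"
  by (simp add: psum_def sum_distrib_left)

lemma psum_sum: "psum j (\<Sum>i\<in>I. s i) = (\<Sum>i\<in>I. psum j (s i))"
  unfolding psum_def lookup_sum by (rule sum.swap)

lemma psum_big_simplex:
  assumes "x \<in> big_simplex r m" "m < j"
  shows "psum j x = real r"
proof -
  have "psum j x = (\<Sum>a\<le>m. lk x a)"
    unfolding psum_def using assms
    by (intro sum.mono_neutral_right) (auto simp: big_simplex_def)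
  then show ?thesis using assms by (simp add: big_simplex_def)
qed

lemma convex_big_simplex: "convex (big_simplex r m)"
  unfolding convex_def big_simplex_def
  by (auto simp: lookup_add sum.distrib simp flip: sum_distrib_left distrib_right)

lemma stair_le:
  assumes "stair r m k"
  shows "k j \<le> r - 1"
proof -
  have "k j \<le> k (max j (Suc m))" using assms monoD[of k j "max j (Suc m)"] by (simp add: stair_def)
  also have "\<dots> = r - 1" using assms by (auto simp: stair_def)
  finally show ?thesis .
qed

text \<open>The last \<open>a\<close> with \<open>k a \<le> i\<close> works: one step further
  \<open>k\<close> exceeds \<open>i\<close>, or the end value \<open>r - 1\<close> has been
  reached.\<close>

lemma stair_block_nonempty:
  assumes "stair r m k" "i < r"
  shows "stair_block m k i \<noteq> {}"
proof -
  let ?S = "{a. a \<le> m \<and> k a \<le> i}"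
  have "0 \<in> ?S" using assms by (simp add: stair_def)
  then have a: "Max ?S \<in> ?S" by (intro Max_in) auto
  have "i \<le> k (Suc (Max ?S))"
  proof (cases "Suc (Max ?S) \<le> m")
    case True
    have fin: "finite ?S" by simp
    have "Suc (Max ?S) \<notin> ?S" using Max_ge[OF fin, of "Suc (Max ?S)"] by (metis Suc_n_not_le_n)
    then show ?thesis using True by auto
  next
    case False
    then show ?thesis using assms by (simp add: stair_def)
  qed
  then show ?thesis using a by (auto simp: stair_block_def)
qed

lemma finite_stair_block [simp]: "finite (stair_block m k i)"
  unfolding stair_block_def by simp

lemma unit_steps_sum:
  fixes p :: "nat \<Rightarrow> real"
  assumes "K < r" "\<And>i. i < K \<Longrightarrow> p i = 1" "0 \<le> p K" "p K \<le> 1" "\<And>i. K < i \<Longrightarrow> i < r \<Longrightarrow> p i = 0"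
  shows "real K \<le> (\<Sum>i<r. p i)" "(\<Sum>i<r. p i) \<le> real K + 1"
proof -
  have "(\<Sum>i<r. p i) = (\<Sum>i<Suc K. p i)"
    using assms by (intro sum.mono_neutral_right) auto
  also have "\<dots> = (\<Sum>i<K. 1) + p K"
    using assms(2) by simp
  finally show "real K \<le> (\<Sum>i<r. p i)" "(\<Sum>i<r. p i) \<le> real K + 1" using assms by auto
qed

text \<open>Summand \<open>i\<close> is the length of the part of [0, t] between \<open>i\<close>
  and \<open>i + 1\<close>.\<close>

lemma clamp_sum:
  fixes t :: real
  assumes "0 \<le> t"
  shows "(\<Sum>i<r. min 1 (max 0 (t - real i))) = min t (real r)"
  using assms by (induction r) (auto simp: min_def max_def)

lemma maxcell_eq_sum:
  assumes k: "stair r m k" and r: "1 \<le> r"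
  shows "maxcell r m k = (\<Sum>i<r. face_simplex (stair_block m k i))"
proof (intro subset_antisym subsetI)
  fix x assume x: "x \<in> maxcell r m k"
  then have xb: "x \<in> big_simplex r m" and nn: "\<And>a. 0 \<le> lk x a"
    by (auto simp: maxcell_def big_simplex_def)
  have y: "real (k j) \<le> psum j x" "psum j x \<le> real (k j) + 1" for j
    using x by (auto simp: maxcell_def)
  \<comment> \<open>\<open>Y i j\<close> is to be the partial sum of the summand \<open>s i\<close>
    before coordinate \<open>j\<close>; over all \<open>i\<close> these add up to
    \<open>psum j x\<close> by \<open>clamp_sum\<close>.\<close>
  define Y where "Y i j = min 1 (max 0 (psum j x - real i))" for i j
  define s where "s i = (\<Sum>a\<le>m. Poly_Mapping.single a (Y i (Suc a) - Y i a))" for i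
  have lks: "lk (s i) a = (if a \<le> m then Y i (Suc a) - Y i a else 0)" for i a
    by (simp add: s_def lookup_sum lookup_single when_def)
  have Ymono: "Y i a \<le> Y i (Suc a)" for i a
    unfolding Y_def using nn[of a] by (intro min.mono max.mono) (simp_all add: psum_Suc)
  have "s i \<in> face_simplex (stair_block m k i)" if i: "i < r" for i
    unfolding face_simplex_iff
  proof (intro conjI allI impI)
    show "0 \<le> lk (s i) a" for a using Ymono by (simp add: lks)
    show z: "lk (s i) a = 0" if a: "a \<notin> stair_block m k i" for a
    proof (cases "a \<le> m")
      case True
      \<comment> \<open>Outside the block the partial sum is already at least \<open>i + 1\<close>
        or still at most \<open>i\<close>, so that its clamped value does not change at
        \<open>a\<close>.\<close>
      then consider "Suc i \<le> k a" | "Suc (k (Suc a)) \<le> i"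
        using a by (auto simp: stair_block_def)
      then show ?thesis
      proof cases
        case 1
        then have "real i + 1 \<le> psum a x" using y(1)[of a] by linarith
        moreover from this have "real i + 1 \<le> psum (Suc a) x" using nn[of a] by (simp add: psum_Suc)
        ultimately have "Y i a = 1" "Y i (Suc a) = 1" by (simp_all add: Y_def min_def max_def)
        then show ?thesis by (simp add: lks)
      next
        case 2
        then have "psum (Suc a) x \<le> real i" using y(2)[of "Suc a"] by linarith
        then show ?thesis using nn[of a] by (simp add: lks Y_def psum_Suc)
      qed
    qed (simp add: lks)
    have "(\<Sum>a\<in>stair_block m k i. lk (s i) a) = (\<Sum>a\<le>m. lk (s i) a)"
      using z by (intro sum.mono_neutral_left) (auto simp: stair_block_def)
    also have "\<dots> = (\<Sum>a<Suc m. Y i (Suc a) - Y i a)"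
      by (intro sum.cong) (auto simp: lks)
    also have "\<dots> = Y i (Suc m) - Y i 0" by (rule sum_lessThan_telescope)
    also have "\<dots> = 1" using i psum_big_simplex[OF xb, of "Suc m"] by (simp add: Y_def)
    finally show "(\<Sum>a\<in>stair_block m k i. lk (s i) a) = 1" .
  qed
  moreover have "x = (\<Sum>i<r. s i)"
  proof (rule poly_mapping_eqI)
    fix a
    have Ysum: "(\<Sum>i<r. Y i j) = psum j x" for j
    proof -
      have "psum j x \<le> real r"
        using y(2)[of j] stair_le[OF k, of j] r by linarith
      moreover have "0 \<le> psum j x" using nn by (simp add: psum_def sum_nonneg)
      ultimately show ?thesis using clamp_sum[of "psum j x" r] by (simp add: Y_def)
    qed
    show "lk x a = lk (\<Sum>i<r. s i) a"
    proof (cases "a \<le> m")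
      case True
      then have "lk (\<Sum>i<r. s i) a = psum (Suc a) x - psum a x"
        by (simp add: lookup_sum lks sum_subtractf Ysum)
      then show ?thesis by (simp add: psum_Suc)
    next
      case False
      then show ?thesis using xb by (simp add: lookup_sum lks big_simplex_def)
    qed
  qed
  ultimately show "x \<in> (\<Sum>i<r. face_simplex (stair_block m k i))"
    by (auto simp: set_sum_alt)
next
  fix x assume "x \<in> (\<Sum>i<r. face_simplex (stair_block m k i))"
  then obtain s where s: "\<And>i. i < r \<Longrightarrow> s i \<in> face_simplex (stair_block m k i)" and x: "x = (\<Sum>i<r. s i)"
    by (auto simp: set_sum_alt)
  have nn: "0 \<le> lk (s i) a" and z: "a \<notin> stair_block m k i \<Longrightarrow> lk (s i) a = 0"
    and one: "(\<Sum>a\<in>stair_block m k i. lk (s i) a) = 1" if "i < r" for i a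
    using s[OF that] by (auto simp: face_simplex_iff)
  have whole: "(\<Sum>a\<in>B. lk (s i) a) = 1" if "i < r" "stair_block m k i \<subseteq> B" "finite B" for i B
  proof -
    have "(\<Sum>a\<in>B. lk (s i) a) = (\<Sum>a\<in>stair_block m k i. lk (s i) a)"
      using that z by (intro sum.mono_neutral_right) auto
    then show ?thesis using one that by simp
  qed
  have "x \<in> big_simplex r m"
  proof -
    have "(\<Sum>a\<le>m. lk x a) = (\<Sum>i<r. \<Sum>a\<le>m. lk (s i) a)"
      unfolding x lookup_sum by (rule sum.swap)
    also have "\<dots> = (\<Sum>i<r. 1)"
      using whole[of _ "{..m}"] by (intro sum.cong) (simp_all add: stair_block_def Collect_mono_iff subset_iff)
    finally have "(\<Sum>a\<le>m. lk x a) = real r" by simp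
    moreover have "lk x a = 0" if "m < a" for a
      unfolding x lookup_sum using that z by (intro sum.neutral) (auto simp: stair_block_def)
    moreover have "0 \<le> lk x a" for a
      unfolding x lookup_sum using nn by (intro sum_nonneg) auto
    ultimately show ?thesis by (simp add: big_simplex_def)
  qed
  moreover have "real (k j) \<le> psum j x \<and> psum j x \<le> real (k j) + 1" for j
  proof -
    have mono: "mono k" using k by (simp add: stair_def)
    have K: "k j < r" using stair_le[OF k, of j] r by linarith
    \<comment> \<open>Before coordinate \<open>j\<close> the summands below \<open>k j\<close> are
      complete and those above \<open>k j\<close> have not begun, so only the summand
      \<open>k j\<close> is cut.\<close>
    have lo: "psum j (s i) = 1" if "i < k j" for i
      unfolding psum_def
    proof (rule whole)
      show "stair_block m k i \<subseteq> {..<j}"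
      proof
        fix a assume "a \<in> stair_block m k i"
        then have "k a < k j" using that by (simp add: stair_block_def)
        then show "a \<in> {..<j}" using monoD[OF mono, of j a] by (meson lessThan_iff not_le)
      qed
    qed (use that K in auto)
    have hi: "psum j (s i) = 0" if "k j < i" "i < r" for i
      unfolding psum_def
    proof (rule sum.neutral, rule ballI, rule z[OF that(2)])
      fix a assume "a \<in> {..<j}"
      then have "k (Suc a) \<le> k j" using monoD[OF mono, of "Suc a" j] by simp
      then show "a \<notin> stair_block m k i" using that by (simp add: stair_block_def)
    qed
    have "0 \<le> psum j (s (k j))" using nn[OF K] by (simp add: psum_def sum_nonneg)
    moreover have "psum j (s (k j)) \<le> 1"
    proof -
      have "psum j (s (k j)) \<le> (\<Sum>a\<in>{..<j} \<union> stair_block m k (k j). lk (s (k j)) a)"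
        unfolding psum_def using nn[OF K] by (intro sum_mono2) auto
      also have "\<dots> = 1" using K by (intro whole) auto
      finally show ?thesis .
    qed
    ultimately show ?thesis
      using unit_steps_sum[of "k j" r "\<lambda>i. psum j (s i)", OF K lo _ _ hi] by (simp add: x psum_sum)
  qed
  ultimately show "x \<in> maxcell r m k" by (simp add: maxcell_def)
qed

lemma maxcell_cover:
  assumes r: "1 \<le> r" and x: "x \<in> big_simplex r m"
  shows "\<exists>k. stair r m k \<and> x \<in> maxcell r m k"
proof -
  have nn: "0 \<le> lk x a" for a using x by (simp add: big_simplex_def)
  \<comment> \<open>The integer part, capped at \<open>r - 1\<close> because the partial sum may
    reach \<open>r\<close>, the upper end of the last interval.\<close>
  define k where "k j = min (nat \<lfloor>psum j x\<rfloor>) (r - 1)" for j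
  have p0: "0 \<le> psum j x" for j using nn by (simp add: psum_def sum_nonneg)
  have pr: "psum j x \<le> real r" for j
    using psum_mono[OF nn, of j "max j (Suc m)"] psum_big_simplex[OF x, of "max j (Suc m)"] by simp
  have "mono k"
  proof (rule monoI)
    fix i j :: nat assume "i \<le> j"
    then have "nat \<lfloor>psum i x\<rfloor> \<le> nat \<lfloor>psum j x\<rfloor>"
      using psum_mono[OF nn, of i j] by (intro nat_mono floor_mono) auto
    then show "k i \<le> k j" unfolding k_def by (rule min.mono) simp
  qed
  moreover have "k j = r - 1" if "m < j" for j
    using psum_big_simplex[OF x that] by (simp add: k_def)
  ultimately have "stair r m k" by (simp add: stair_def k_def)
  moreover have "real (k j) \<le> psum j x \<and> psum j x \<le> real (k j) + 1" for j
  proof (cases "nat \<lfloor>psum j x\<rfloor> \<le> r - 1")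
    case True
    then have "real (k j) = real_of_int \<lfloor>psum j x\<rfloor>" using p0[of j] by (simp add: k_def)
    then show ?thesis by linarith
  next
    case False
    then have "real (k j) = real r - 1" using r by (simp add: k_def of_nat_diff)
    moreover have "real r - 1 \<le> psum j x" using False p0[of j] r by linarith
    ultimately show ?thesis using pr by simp
  qed
  ultimately show ?thesis using x by (auto simp: maxcell_def)
qed

text \<open>That a point of the big simplex is a sum of \<open>r\<close> points of the small one is
  read off from the decomposition of a \<open>maxcell\<close> that contains it.\<close>

lemma dilated_simplex_eq:
  assumes r: "1 \<le> r"
  shows "dilated_simplex r m = big_simplex r m"
proof (intro subset_antisym subsetI)
  fix x assume "x \<in> big_simplex r m"
  then obtain k where k: "stair r m k" "x \<in> maxcell r m k" using maxcell_cover[OF r] by blast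
  then obtain s where s: "\<And>i. i < r \<Longrightarrow> s i \<in> face_simplex (stair_block m k i)" "x = (\<Sum>i<r. s i)"
    using maxcell_eq_sum[OF k(1) r] by (auto simp: set_sum_alt)
  have "s i \<in> std_simplex m" if "i < r" for i
    using s(1)[OF that] face_simplex_mono[of "{..m}" "stair_block m k i"] stair_block_nonempty[OF k(1) that]
    unfolding std_simplex_eq by (auto simp: stair_block_def)
  then show "x \<in> dilated_simplex r m"
    using s(2) unfolding dilated_simplex_def by (auto simp: set_sum_alt)
next
  fix x assume "x \<in> dilated_simplex r m"
  then obtain s where s: "\<And>i. i < r \<Longrightarrow> s i \<in> face_simplex {..m}" and x: "x = (\<Sum>i<r. s i)"
    unfolding dilated_simplex_def by (auto simp: set_sum_alt std_simplex_eq)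
  have "(\<Sum>a\<le>m. lk x a) = (\<Sum>i<r. \<Sum>a\<le>m. lk (s i) a)"
    unfolding x lookup_sum by (rule sum.swap)
  also have "\<dots> = (\<Sum>i<r. 1)" using s by (intro sum.cong) (auto simp: face_simplex_iff)
  finally have "(\<Sum>a\<le>m. lk x a) = real r" by simp
  moreover have "lk x a = 0" if "m < a" for a
    unfolding x lookup_sum using that s by (intro sum.neutral) (auto simp: face_simplex_iff)
  moreover have "0 \<le> lk x a" for a
    unfolding x lookup_sum using s by (intro sum_nonneg) (auto simp: face_simplex_iff)
  ultimately show "x \<in> big_simplex r m" by (simp add: big_simplex_def)
qed

text \<open>The vectors e_a - e_(a+1) with \<open>a < m\<close> span all vectors of total 0 and
  occur as differences of points of the cell, because some block contains both \<open>a\<close> and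
  \<open>a + 1\<close>.\<close>

lemma pdim_maxcell:
  assumes k: "stair r m k" and r: "1 \<le> r"
  shows "pdim (maxcell r m k) = m"
proof -
  let ?B = "\<lambda>i::nat. if i = 0 then {..m} else {}"
  have lin: "x \<in> lin (Suc 0) ?B \<longleftrightarrow> (\<forall>a>m. lk x a = 0) \<and> (\<Sum>a\<le>m. lk x a) = 0" for x
    by (simp add: lin_def not_le)
  have "differences (maxcell r m k) \<subseteq> lin (Suc 0) ?B"
    by (auto simp: differences_def lin maxcell_def big_simplex_def lookup_minus sum_subtractf)
  then have 1: "span (differences (maxcell r m k)) \<subseteq> lin (Suc 0) ?B"
    by (intro span_minimal subspace_lin)
  define e :: "nat \<Rightarrow> point" where "e a = Poly_Mapping.single a 1" for a
  have step: "e a - e (Suc a) \<in> differences (maxcell r m k)" if a: "a < m" for a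
  proof -
    \<comment> \<open>The block with index \<open>k (Suc a)\<close> contains both coordinates: it is
      the last one that can contain \<open>a\<close> and the first one that can contain
      \<open>Suc a\<close>.\<close>
    define c where "c = k (Suc a)"
    have mono: "mono k" using k by (simp add: stair_def)
    have c: "c < r" using stair_le[OF k, of "Suc a"] r by (simp add: c_def)
    have in2: "a \<in> stair_block m k c" "Suc a \<in> stair_block m k c"
      using a monoD[OF mono, of a "Suc a"] monoD[OF mono, of "Suc a" "Suc (Suc a)"]
      by (auto simp: stair_block_def c_def)
    have ein: "e b \<in> face_simplex (stair_block m k i)" if "b \<in> stair_block m k i" for b i
      using that by (auto simp: e_def face_simplex_iff lookup_single when_def)
    define s where "s b = (\<lambda>i. if i = c then e b else e (SOME b. b \<in> stair_block m k i))" for b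
    have "(\<Sum>i<r. s b i) \<in> maxcell r m k" if "b \<in> stair_block m k c" for b
    proof -
      have "s b i \<in> face_simplex (stair_block m k i)" if "i < r" for i
        using \<open>b \<in> stair_block m k c\<close> stair_block_nonempty[OF k that]
        by (auto simp: s_def some_in_eq intro!: ein)
      then show ?thesis unfolding maxcell_eq_sum[OF k r] by (auto simp: set_sum_alt)
    qed
    moreover have "(\<Sum>i<r. s a i) - (\<Sum>i<r. s (Suc a) i) = e a - e (Suc a)"
    proof -
      have "(\<Sum>i<r. s a i) - (\<Sum>i<r. s (Suc a) i) = (\<Sum>i<r. if i = c then e a - e (Suc a) else 0)"
        unfolding sum_subtractf[symmetric] by (intro sum.cong) (auto simp: s_def)
      then show ?thesis using c by simp
    qed
    ultimately show ?thesis using in2 unfolding differences_def by (metis (mono_tags, lifting) mem_Collect_eq)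
  qed
  have 2: "lin (Suc 0) ?B \<subseteq> span (differences (maxcell r m k))"
  proof
    fix x assume x: "x \<in> lin (Suc 0) ?B"
    have tot: "psum m x + lk x m = 0"
      using x by (simp add: lin psum_def flip: lessThan_Suc_atMost)
    have lke: "lk (e a - e (Suc a)) b = (if b = a then 1 else 0) - (if b = Suc a then 1 else 0)" for a b
      by (simp add: e_def lookup_minus lookup_single when_def)
    \<comment> \<open>Abel summation: the coefficients are the partial sums, and the total of
      \<open>x\<close> is 0.\<close>
    have "x = (\<Sum>a<m. psum (Suc a) x *\<^sub>R (e a - e (Suc a)))"
    proof (rule poly_mapping_eqI)
      fix b
      have "lk (\<Sum>a<m. psum (Suc a) x *\<^sub>R (e a - e (Suc a))) b
        = (\<Sum>a<m. if b = a then psum (Suc a) x else 0) - (\<Sum>a<m. if b = Suc a then psum (Suc a) x else 0)"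
        unfolding sum_subtractf[symmetric] lookup_sum by (intro sum.cong) (auto simp: lke)
      also have "(\<Sum>a<m. if b = a then psum (Suc a) x else 0) = (if b < m then psum (Suc b) x else 0)"
        by simp
      also have "(\<Sum>a<m. if b = Suc a then psum (Suc a) x else 0) = (if b \<le> m then psum b x else 0)"
      proof (cases b)
        case (Suc c)
        then show ?thesis by (auto simp: Suc_le_eq)
      qed simp
      finally show "lk x b = lk (\<Sum>a<m. psum (Suc a) x *\<^sub>R (e a - e (Suc a))) b"
        using x tot by (cases "b = m") (auto simp: lin psum_Suc)
    qed
    moreover have "(\<Sum>a<m. psum (Suc a) x *\<^sub>R (e a - e (Suc a))) \<in> span (differences (maxcell r m k))"
      using step by (intro span_sum span_scale span_base) auto
    ultimately show "x \<in> span (differences (maxcell r m k))" by simp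
  qed
  have b: "blocks (Suc 0) ?B" using blocks_single[of "{..m}"] by simp
  have "pdim (maxcell r m k) = pdim (cell (Suc 0) ?B)"
    unfolding pdim_span using 1 2 span_differences_cell[OF b] by simp
  then show ?thesis using pdim_cell[OF b] by simp
qed

lemma mixed_cell_maxcell:
  assumes k: "stair r m k" and r: "1 \<le> r"
  shows "mixed_cell r m (maxcell r m k)"
  unfolding mixed_cell_def
proof (intro conjI exI[of _ "\<lambda>i. face_simplex (stair_block m k i)"] allI impI)
  show "pdim (maxcell r m k) = m" using pdim_maxcell[OF assms] .
  show "maxcell r m k = (\<Sum>i<r. face_simplex (stair_block m k i))" using maxcell_eq_sum[OF assms] .
  fix i assume i: "i < r"
  show "face_simplex (stair_block m k i) face_of std_simplex m"
    unfolding std_simplex_eq using stair_block_nonempty[OF k i]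
    by (intro face_simplex_face) (auto simp: stair_block_def)
  show "face_simplex (stair_block m k i) \<noteq> {}"
    unfolding face_simplex_def using stair_block_nonempty[OF k i]
    by (intro cell_nonempty blocks_single) auto
qed

lemma polytope_maxcell:
  assumes "stair r m k" "1 \<le> r"
  shows "polytope (maxcell r m k)"
  unfolding maxcell_eq_sum[OF assms] by (intro polytope_set_sum polytope_face_simplex) simp

lemma convex_maxcell: "convex (maxcell r m k)"
  unfolding convex_def
proof (intro ballI allI impI)
  fix x y and u v :: real
  assume xy: "x \<in> maxcell r m k" "y \<in> maxcell r m k" and uv: "0 \<le> u" "0 \<le> v" "u + v = 1"
  have "real (k j) \<le> u * psum j x + v * psum j y \<and> u * psum j x + v * psum j y \<le> real (k j) + 1" for j
  proof -
    have "u * real (k j) \<le> u * psum j x" "v * real (k j) \<le> v * psum j y"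
      "u * psum j x \<le> u * (real (k j) + 1)" "v * psum j y \<le> v * (real (k j) + 1)"
      using xy uv by (auto simp: maxcell_def intro!: mult_left_mono)
    moreover have "u * real (k j) + v * real (k j) = real (k j)"
      "u * (real (k j) + 1) + v * (real (k j) + 1) = real (k j) + 1"
      using uv by (simp_all flip: distrib_right)
    ultimately show ?thesis by linarith
  qed
  moreover have "u *\<^sub>R x + v *\<^sub>R y \<in> big_simplex r m"
    using xy uv convex_big_simplex by (auto simp: maxcell_def convex_def)
  ultimately show "u *\<^sub>R x + v *\<^sub>R y \<in> maxcell r m k"
    by (simp add: maxcell_def psum_add psum_scaleR)
qed

text \<open>Two unit intervals with integer ends meet in nothing, in an endpoint or in everything,
  and each of these is a face of the first.\<close>

lemma unit_interval_faces:
  fixes a b u :: real and k l :: nat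
  assumes "real k \<le> a" "a \<le> real k + 1" "real k \<le> b" "b \<le> real k + 1" "0 < u" "u < 1"
    and "real l \<le> (1 - u) * a + u * b" "(1 - u) * a + u * b \<le> real l + 1"
  shows "real l \<le> a \<and> a \<le> real l + 1 \<and> real l \<le> b \<and> b \<le> real l + 1"
proof -
  have e: "(1 - u) * c + u * c = c" for c :: real by (simp add: algebra_simps)
  consider "k = l" | "k + 1 \<le> l" | "l + 1 \<le> k" by linarith
  then show ?thesis
  proof cases
    case 2
    then have l: "real k + 1 \<le> real l" by linarith
    have "(1 - u) * (real k + 1 - a) + u * (real k + 1 - b) \<le> 0"
      using assms(7) l e[of "real k + 1"] by (simp add: algebra_simps)
    moreover have "0 \<le> (1 - u) * (real k + 1 - a)" "0 \<le> u * (real k + 1 - b)" using assms by auto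
    ultimately have "(1 - u) * (real k + 1 - a) = 0" "u * (real k + 1 - b) = 0" by linarith+
    then have ab: "a = real k + 1" "b = real k + 1" using assms by auto
    then show ?thesis using assms(7,8) l e[of "real k + 1"] by simp
  next
    case 3
    then have l: "real l + 1 \<le> real k" by linarith
    have "(1 - u) * (a - real k) + u * (b - real k) \<le> 0"
      using assms(8) l e[of "real k"] by (simp add: algebra_simps)
    moreover have "0 \<le> (1 - u) * (a - real k)" "0 \<le> u * (b - real k)" using assms by auto
    ultimately have "(1 - u) * (a - real k) = 0" "u * (b - real k) = 0" by linarith+
    then have ab: "a = real k" "b = real k" using assms by auto
    then show ?thesis using assms(7,8) l e[of "real k"] by simp
  qed (use assms in simp)
qed

lemma maxcell_Int_face: "maxcell r m k \<inter> maxcell r m l face_of maxcell r m k"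
  unfolding face_of_def
proof (intro conjI ballI impI)
  show "convex (maxcell r m k \<inter> maxcell r m l)" by (intro convex_Int convex_maxcell)
  fix a b x assume ab: "a \<in> maxcell r m k" "b \<in> maxcell r m k"
    and x: "x \<in> maxcell r m k \<inter> maxcell r m l" "x \<in> open_segment a b"
  from x(2) obtain u where u: "0 < u" "u < 1" "x = (1 - u) *\<^sub>R a + u *\<^sub>R b"
    by (auto simp: in_segment)
  have "real (l j) \<le> psum j a \<and> psum j a \<le> real (l j) + 1 \<and> real (l j) \<le> psum j b \<and> psum j b \<le> real (l j) + 1" for j
    by (rule unit_interval_faces[of "k j" _ _ u])
      (use ab x(1) u in \<open>auto simp: maxcell_def psum_add psum_scaleR\<close>)
  then show "a \<in> maxcell r m k \<inter> maxcell r m l" "b \<in> maxcell r m k \<inter> maxcell r m l"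
    using ab by (auto simp: maxcell_def)
qed auto

lemma finite_stairs: "finite {k. stair r m k}"
proof (rule finite_subset)
  show "{k. stair r m k} \<subseteq> {k. \<forall>j. (j \<in> {..m} \<longrightarrow> k j \<in> {..r - 1}) \<and> (j \<notin> {..m} \<longrightarrow> k j = r - 1)}"
    using stair_le by (auto simp: stair_def)
  show "finite \<dots>" by (rule finite_set_of_finite_funs) auto
qed

lemma polyhedral_complex_staircase:
  assumes r: "1 \<le> r"
  shows "polyhedral_complex (staircase_subdivision r m)"
  unfolding polyhedral_complex_def
proof (intro conjI ballI allI impI)
  have "staircase_subdivision r m = (\<Union>k\<in>{k. stair r m k}. {F. F face_of maxcell r m k})"
    by (auto simp: staircase_subdivision_def)
  then show "finite (staircase_subdivision r m)"
    using finite_stairs polytope_faces(1)[OF polytope_maxcell[OF _ r]] by auto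
  show "polytope F" if "F \<in> staircase_subdivision r m" for F
    using that polytope_faces(2)[OF polytope_maxcell[OF _ r]] by (auto simp: staircase_subdivision_def)
  show "G \<in> staircase_subdivision r m" if "F \<in> staircase_subdivision r m" "G face_of F" for F G
    using that face_of_trans by (auto simp: staircase_subdivision_def)
  fix F G assume "F \<in> staircase_subdivision r m" "G \<in> staircase_subdivision r m"
  then obtain k l where "F face_of maxcell r m k" "G face_of maxcell r m l"
    by (auto simp: staircase_subdivision_def)
  moreover have "maxcell r m k \<inter> maxcell r m l face_of maxcell r m l"
    using maxcell_Int_face[of r m l k] by (simp add: Int_commute)
  ultimately show "F \<inter> G face_of F" "F \<inter> G face_of G"
    using face_of_Int_subface[OF maxcell_Int_face[of r m k l]] by blast+
qed

lemma mixed_subdivision_staircase: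
  assumes r: "1 \<le> r"
  shows "mixed_subdivision r m (staircase_subdivision r m)"
  unfolding mixed_subdivision_def polyhedral_subdivision_def
proof (intro conjI ballI impI)
  show "polyhedral_complex (staircase_subdivision r m)" using polyhedral_complex_staircase[OF r] .
  have self: "maxcell r m k \<in> staircase_subdivision r m" if "stair r m k" for k
    unfolding staircase_subdivision_def using that face_of_refl[OF convex_maxcell] by blast
  show "\<Union>(staircase_subdivision r m) = dilated_simplex r m"
    unfolding dilated_simplex_eq[OF r]
  proof
    show "\<Union>(staircase_subdivision r m) \<subseteq> big_simplex r m"
    proof (rule Union_least)
      fix F assume "F \<in> staircase_subdivision r m"
      then obtain k where "F face_of maxcell r m k" by (auto simp: staircase_subdivision_def)
      then have "F \<subseteq> maxcell r m k" by (rule face_of_imp_subset)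
      then show "F \<subseteq> big_simplex r m" by (auto simp: maxcell_def)
    qed
    show "big_simplex r m \<subseteq> \<Union>(staircase_subdivision r m)"
      using maxcell_cover[OF r] self by blast
  qed
  fix C assume C: "C \<in> staircase_subdivision r m" "\<forall>D\<in>staircase_subdivision r m. C \<subseteq> D \<longrightarrow> C = D"
  then obtain k where k: "stair r m k" "C face_of maxcell r m k"
    unfolding staircase_subdivision_def by blast
  then have "C = maxcell r m k"
    using C(2) self[OF k(1)] face_of_imp_subset[OF k(2)] by simp
  then show "mixed_cell r m C" using mixed_cell_maxcell[OF k(1) r] by simp
qed

text \<open>The stair counts the blocks completed so far, and the block in progress adds at most 1.
  For the face property, the points of the cell attain the lower bound on the partial sum at the end
  of every block but the last. Points of \<open>maxcell\<close> with a proper convex combination in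
  the cell then attain these bounds too, and block sums are differences of such partial
  sums.\<close>

lemma cell_in_staircase:
  assumes r: "1 \<le> r" and b: "blocks r B" and sm: "supp r B \<subseteq> {..m}"
  shows "cell r B \<in> staircase_subdivision r m"
proof -
  \<comment> \<open>The first block that is not complete before coordinate \<open>j\<close>. The
    alternative \<open>r - 1 \<le> i\<close> caps the value when all blocks are complete.\<close>
  define k where "k j = (LEAST i. r - 1 \<le> i \<or> \<not> B i \<subseteq> {..<j})" for j
  have kr: "k j \<le> r - 1" for j unfolding k_def by (rule Least_le) simp
  have kbelow: "B i \<subseteq> {..<j}" if "i < k j" for i j
    using not_less_Least[OF that[unfolded k_def]] by blast
  have kat: "r - 1 \<le> k j \<or> \<not> B (k j) \<subseteq> {..<j}" for j
    unfolding k_def by (rule LeastI[of _ "r - 1"]) simp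
  have kge: "i < k j" if "i < r - 1" "B i \<subseteq> {..<j}" for i j
  proof (rule ccontr)
    assume "\<not> i < k j"
    then have le: "k j \<le> i" by simp
    have "\<not> r - 1 \<le> k j" using le that(1) by simp
    then obtain c where c: "c \<in> B (k j)" "j \<le> c" using kat[of j] by (metis lessThan_iff not_le subsetI)
    have "k j \<noteq> i" using c that(2) by auto
    then have "k j < i" using le by simp
    have "i < r" using that(1) by simp
    then obtain a where "a \<in> B i" using blocks_nonempty[OF b, of i] by blast
    then show False using blocks_less[OF b c(1) _ \<open>k j < i\<close>] c(2) that(2) by fastforce
  qed
  have above: "B i \<inter> {..<j} = {}" if "k j < i" "i < r" for i j
  proof -
    have "\<not> r - 1 \<le> k j" using that by simp
    then obtain c where c: "c \<in> B (k j)" "j \<le> c" using kat[of j] by (metis lessThan_iff not_le subsetI)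
    then show ?thesis using blocks_less[OF b c(1) _ that(1)] by fastforce
  qed
  have k: "stair r m k"
    unfolding stair_def
  proof (intro conjI allI impI)
    show "mono k"
    proof (rule monoI)
      fix i j :: nat assume "i \<le> j"
      then have "r - 1 \<le> k j \<or> \<not> B (k j) \<subseteq> {..<i}" using kat[of j] by (meson lessThan_subset_iff order_trans)
      then show "k i \<le> k j" unfolding k_def[of i] by (rule Least_le)
    qed
    show "k 0 = 0"
      unfolding k_def using blocks_nonempty[OF b, of 0] r by (intro Least_eq_0) auto
    show "k j = r - 1" if "m < j" for j
    proof (rule ccontr)
      assume "k j \<noteq> r - 1"
      then have "k j < r - 1" using kr[of j] by simp
      moreover have "B (k j) \<subseteq> {..<j}"
        using sm that \<open>k j < r - 1\<close> by (fastforce simp: supp_def)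
      ultimately show False using kat[of j] by simp
    qed
  qed
  have zero: "lk x a = 0" if "x \<in> cell r B" "a \<notin> supp r B" for x a using that by (simp add: cell_def)
  have "cell r B \<subseteq> maxcell r m k"
  proof
    fix x assume x: "x \<in> cell r B"
    have nn: "0 \<le> lk x a" for a using x by (simp add: cell_def)
    have one: "(\<Sum>a\<in>B i. lk x a) = 1" if "i < r" for i using x that by (simp add: cell_def)
    have "(\<Sum>a\<le>m. lk x a) = (\<Sum>i<r. \<Sum>a\<in>B i \<inter> {..m}. lk x a)"
      by (rule sum_lk_blocks[OF b zero[OF x]]) auto
    also have "\<dots> = (\<Sum>i<r. 1)"
    proof (rule sum.cong[OF refl])
      fix i assume "i \<in> {..<r}"
      then have "B i \<inter> {..m} = B i" "i < r" using sm by (auto simp: supp_def)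
      then show "(\<Sum>a\<in>B i \<inter> {..m}. lk x a) = 1" using one by simp
    qed
    finally have "x \<in> big_simplex r m"
      using nn zero[OF x] sm by (auto simp: big_simplex_def) (meson atMost_iff leD subsetD)
    moreover have "real (k j) \<le> psum j x \<and> psum j x \<le> real (k j) + 1" for j
    proof -
      have K: "k j < r" using kr[of j] r by linarith
      have "psum j x = (\<Sum>i<r. \<Sum>a\<in>B i \<inter> {..<j}. lk x a)"
        unfolding psum_def by (rule sum_lk_blocks[OF b zero[OF x]]) auto
      moreover have "(\<Sum>a\<in>B i \<inter> {..<j}. lk x a) = 1" if "i < k j" for i
        using kbelow[OF that] one[of i] that K by (simp add: Int_absorb2)
      moreover have "(\<Sum>a\<in>B i \<inter> {..<j}. lk x a) = 0" if "k j < i" "i < r" for i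
        using above[OF that] by simp
      moreover have "0 \<le> (\<Sum>a\<in>B (k j) \<inter> {..<j}. lk x a)" using nn by (simp add: sum_nonneg)
      moreover have "(\<Sum>a\<in>B (k j) \<inter> {..<j}. lk x a) \<le> 1"
        unfolding one[OF K, symmetric] using nn blocks_finite[OF b] by (intro sum_mono2) auto
      ultimately show ?thesis
        using unit_steps_sum[OF K, of "\<lambda>i. \<Sum>a\<in>B i \<inter> {..<j}. lk x a"] by simp
    qed
    ultimately show "x \<in> maxcell r m k" by (simp add: maxcell_def)
  qed
  moreover have "a \<in> cell r B \<and> c \<in> cell r B"
    if ac: "a \<in> maxcell r m k" "c \<in> maxcell r m k" and x: "x \<in> cell r B"
      and u: "0 < u" "u < 1" "x = (1 - u) *\<^sub>R a + u *\<^sub>R c" for a c x and u :: real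
  proof -
    have nna: "0 \<le> lk a v" "0 \<le> lk c v" for v using ac by (auto simp: maxcell_def big_simplex_def)
    have za: "lk a v = 0 \<and> lk c v = 0" if "v \<notin> supp r B" for v
    proof -
      have "(1 - u) * lk a v + u * lk c v = 0" using zero[OF x that] u by (simp add: lookup_add)
      then have "(1 - u) * lk a v = 0 \<and> u * lk c v = 0"
        using u nna by (subst (asm) add_nonneg_eq_0_iff) auto
      then show ?thesis using u by simp
    qed
    have prefix: "psum (Suc (Max (B i))) y = (\<Sum>l<Suc i. \<Sum>v\<in>B l. lk y v)"
      if i: "i < r" and y: "\<And>v. v \<notin> supp r B \<Longrightarrow> lk y v = 0" for i and y :: "point"
    proof -
      have M: "Max (B i) \<in> B i" using blocks_finite[OF b] blocks_nonempty[OF b i] by simp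
      have "psum (Suc (Max (B i))) y = (\<Sum>l<r. \<Sum>v\<in>B l \<inter> {..<Suc (Max (B i))}. lk y v)"
        unfolding psum_def by (rule sum_lk_blocks[OF b y]) auto
      also have "\<dots> = (\<Sum>l<Suc i. \<Sum>v\<in>B l. lk y v)"
      proof (rule sum.mono_neutral_cong_right)
        show "\<forall>l\<in>{..<r} - {..<Suc i}. (\<Sum>v\<in>B l \<inter> {..<Suc (Max (B i))}. lk y v) = 0"
        proof
          fix l assume "l \<in> {..<r} - {..<Suc i}"
          then have "B l \<inter> {..<Suc (Max (B i))} = {}" using blocks_less[OF b M, of _ l] by fastforce
          then show "(\<Sum>v\<in>B l \<inter> {..<Suc (Max (B i))}. lk y v) = 0" by simp
        qed
        show "(\<Sum>v\<in>B l \<inter> {..<Suc (Max (B i))}. lk y v) = (\<Sum>v\<in>B l. lk y v)" if "l \<in> {..<Suc i}" for l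
        proof -
          have "B l \<subseteq> {..<Suc (Max (B i))}"
          proof (cases "l = i")
            case True
            then show ?thesis using blocks_finite[OF b] by (auto simp: less_Suc_eq_le)
          next
            case False
            then show ?thesis using blocks_less[OF b _ M, of _ l] that by fastforce
          qed
          then show ?thesis by (simp add: Int_absorb2)
        qed
      qed (use i in auto)
      finally show ?thesis .
    qed
    have pre: "(\<Sum>l<Suc i. \<Sum>v\<in>B l. lk a v) = real (Suc i) \<and> (\<Sum>l<Suc i. \<Sum>v\<in>B l. lk c v) = real (Suc i)"
      if i: "i < r" for i
    proof (cases "i < r - 1")
      case True
      let ?j = "Suc (Max (B i))"
      have "B i \<subseteq> {..<?j}" using blocks_finite[OF b] by (auto simp: less_Suc_eq_le)
      then have "Suc i \<le> k ?j" using kge[OF True] by (simp add: Suc_le_eq)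
      then have kj: "real (Suc i) \<le> real (k ?j)" by linarith
      have "(\<Sum>l<Suc i. \<Sum>v\<in>B l. lk x v) = (\<Sum>l<Suc i. 1)"
        using x i by (intro sum.cong) (auto simp: cell_def)
      then have "psum ?j x = real (Suc i)" using prefix[OF i zero[OF x]] by simp
      then have "(1 - u) * psum ?j a + u * psum ?j c = real (Suc i)"
        by (simp add: u(3) psum_add psum_scaleR)
      then have "(1 - u) * (psum ?j a - real (Suc i)) + u * (psum ?j c - real (Suc i)) = 0"
        by (simp add: algebra_simps)
      moreover have "0 \<le> psum ?j a - real (Suc i)" "0 \<le> psum ?j c - real (Suc i)"
        using ac kj by (auto simp: maxcell_def intro: order_trans)
      ultimately have "(1 - u) * (psum ?j a - real (Suc i)) = 0 \<and> u * (psum ?j c - real (Suc i)) = 0"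
        using u by (subst (asm) add_nonneg_eq_0_iff) auto
      then show ?thesis using u prefix[OF i] za by simp
    next
      \<comment> \<open>At the end of the last block the bound is only \<open>r - 1\<close>; the
        total \<open>r\<close> takes its place.\<close>
      case False
      then have ir: "Suc i = r" using i by simp
      have "(\<Sum>l<r. \<Sum>v\<in>B l. lk y v) = real r" if y: "y \<in> maxcell r m k" "\<And>v. v \<notin> supp r B \<Longrightarrow> lk y v = 0" for y
      proof -
        have "(\<Sum>v\<le>m. lk y v) = (\<Sum>l<r. \<Sum>v\<in>B l \<inter> {..m}. lk y v)"
          by (rule sum_lk_blocks[OF b y(2)]) auto
        also have "\<dots> = (\<Sum>l<r. \<Sum>v\<in>B l. lk y v)"
        proof (rule sum.cong[OF refl])
          fix l assume "l \<in> {..<r}"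
          then have "B l \<inter> {..m} = B l" using sm by (auto simp: supp_def)
          then show "(\<Sum>v\<in>B l \<inter> {..m}. lk y v) = (\<Sum>v\<in>B l. lk y v)" by simp
        qed
        finally show ?thesis using y(1) by (simp add: maxcell_def big_simplex_def)
      qed
      then show ?thesis unfolding ir using ac za by blast
    qed
    have "(\<Sum>v\<in>B i. lk a v) = 1 \<and> (\<Sum>v\<in>B i. lk c v) = 1" if i: "i < r" for i
    proof (cases i)
      case 0
      then show ?thesis using pre[OF i] by simp
    next
      case (Suc i')
      then show ?thesis using pre[OF i] pre[of i'] i by simp
    qed
    then show ?thesis using nna za by (simp add: cell_def)
  qed
  ultimately have "cell r B face_of maxcell r m k"
    unfolding face_of_def in_segment using convex_cell by (intro conjI ballI impI) blast+
  then show ?thesis using k by (auto simp: staircase_subdivision_def)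
qed

section \<open>Outward vectors and cells that are points\<close>

lemma cell_del:
  assumes "blocks d B" "blocks d (del B u)"
  shows "cell d (del B u) = {x \<in> cell d B. lk x u = 0}"
proof -
  have "del B u i \<subseteq> B i" for i by (auto simp: del_def)
  then show ?thesis
    using cell_mono[OF assms] by (auto simp: supp_del cell_def)
qed

text \<open>Every vector that \<open>outward\<close> may select leads from a point with positive
  coordinate \<open>u\<close> to one where it is 0. These two properties are all that is used of the
  choice.\<close>

lemma outward_cell:
  assumes b: "blocks d B" "blocks d (del B u)" and u: "u \<in> supp d B"
  shows "outward (cell d B) (cell d (del B u)) \<in> lin d B"
    and "lk (outward (cell d B) (cell d (del B u))) u < 0"
proof -
  let ?F = "cell d B" and ?G = "cell d (del B u)"
  obtain p where "p \<in> ?F" "0 < lk p u" using cell_interior[OF b(1)] u by metis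
  moreover obtain q where "q \<in> ?G" using cell_nonempty[OF b(2)] by blast
  ultimately have "\<exists>o'. \<exists>p\<in>?F - ?G. \<exists>q\<in>?G. o' = q - p" using cell_del[OF b] by force
  then have "\<exists>p\<in>?F - ?G. \<exists>q\<in>?G. outward ?F ?G = q - p"
    unfolding outward_def by (rule someI_ex)
  then obtain p q where pq: "p \<in> ?F" "p \<notin> ?G" "q \<in> ?G" and eq: "outward ?F ?G = q - p" by blast
  have q: "q \<in> ?F" "lk q u = 0" using pq(3) cell_del[OF b] by auto
  have "lk p u \<noteq> 0" using pq cell_del[OF b] by auto
  then have "0 < lk p u" using pq(1) by (simp add: cell_def less_le)
  then show "lk (outward ?F ?G) u < 0" using q by (simp add: eq lookup_minus)
  have "q - p \<in> differences ?F" using q pq by (auto simp: differences_def)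
  then show "outward ?F ?G \<in> lin d B"
    unfolding eq span_differences_cell[OF b(1), symmetric] by (rule span_base)
qed

lemma cell_singleton:
  assumes "blocks d B" "lin d B = {0}"
  obtains p where "cell d B = {p}"
proof -
  obtain p where p: "p \<in> cell d B" using cell_nonempty[OF assms(1)] by blast
  have "q = p" if "q \<in> cell d B" for q
  proof -
    have "q - p \<in> differences (cell d B)" using that p by (auto simp: differences_def)
    then have "q - p \<in> lin d B" unfolding span_differences_cell[OF assms(1), symmetric] by (rule span_base)
    then show ?thesis using assms(2) by simp
  qed
  then show thesis using p that by blast
qed

lemma differences_singleton [simp]: "differences {p} = {0}"
  by (auto simp: differences_def)

lemma pdim_singleton [simp]: "pdim {p} = 0"
  unfolding pdim_def differences_singleton
  by (metis card.empty dim_eq_card_independent dim_span independent_empty span_empty)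

subsection \<open>Chains over a field\<close>

text \<open>The boundary in one fixed multidegree, where the monomial factors are absorbed and the
  coefficients are scalars; \<open>aug\<close> is the augmentation there.\<close>

definition bd :: "'a::real_vector set set \<Rightarrow> ('a set \<Rightarrow> 'a list) \<Rightarrow> ('a set \<Rightarrow> 'k::field) \<Rightarrow> 'a set \<Rightarrow> 'k" where
  "bd X b z G = (\<Sum>F | F \<in> X \<and> is_facet G F. of_int (incidence b F G) * z F)"

definition aug :: "'a::real_vector set set \<Rightarrow> ('a set \<Rightarrow> 'k::field) \<Rightarrow> 'k" where
  "aug X z = (\<Sum>v | {v} \<in> X. z {v})"

lemma bd_diff: "bd X b (\<lambda>F. z F - w F) G = bd X b z G - bd X b w G"
  by (simp add: bd_def algebra_simps sum_subtractf)

lemma bd_add: "bd X b (\<lambda>F. z F + w F) G = bd X b z G + bd X b w G"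
  by (simp add: bd_def algebra_simps sum.distrib)

lemma bd_zero: "bd X b (\<lambda>_. 0) G = 0"
  by (simp add: bd_def)

lemma aug_diff: "aug X (\<lambda>F. z F - w F) = aug X z - aug X w"
  by (simp add: aug_def sum_subtractf)

lemma incidence_square: "(of_int (incidence b F G) :: 'k::field) * of_int (incidence b F G) = 1"
  by (simp add: incidence_def)

text \<open>
  One step of algebraic Morse theory. The cells of \<open>L\<close> are removed by boundaries of their partners, and
  those partners then drop out because they are the only cells left that have a facet in \<open>L\<close>. The only
  property of the signs that enters is that the boundary of a boundary vanishes.
\<close>

lemma eliminate:
  fixes z :: "'a::real_vector set \<Rightarrow> 'k::field"
  assumes fin: "finite X" and PX: "P \<subseteq> X" and LP: "L \<subseteq> P"
    and face: "\<And>F G. F \<in> X \<Longrightarrow> is_facet G F \<Longrightarrow> G \<in> X"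
    and upP: "\<And>F. F \<in> L \<Longrightarrow> up F \<in> P - L \<and> is_facet F (up F)"
    and others: "\<And>F G. F \<in> L \<Longrightarrow> is_facet G (up F) \<Longrightarrow> G \<in> X \<Longrightarrow> G \<noteq> F \<Longrightarrow> G \<in> P - L"
    and uniq: "\<And>F G. F \<in> L \<Longrightarrow> G \<in> P - L \<Longrightarrow> is_facet F G \<Longrightarrow> G = up F"
    and bdbd: "\<And>(w :: 'a set \<Rightarrow> 'k) G. bd X b (bd X b w) G = 0"
    and z: "\<And>F. z F \<noteq> 0 \<Longrightarrow> F \<in> P" and cyc: "\<And>G. bd X b z G = 0"
  obtains w where "\<And>H. w H \<noteq> 0 \<Longrightarrow> \<exists>F\<in>L. z F \<noteq> 0 \<and> H = up F"
    and "\<And>F. z F - bd X b w F \<noteq> 0 \<Longrightarrow> F \<in> P - L - up ` L"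
proof -
  let ?i = "\<lambda>F G. of_int (incidence b F G) :: 'k"
  define w where "w H = (\<Sum>F\<in>L. if H = up F then ?i H F * z F else 0)" for H
  have finL: "finite L" using fin PX LP by (meson finite_subset)
  have w0: "\<exists>F\<in>L. z F \<noteq> 0 \<and> H = up F" if "w H \<noteq> 0" for H
  proof (rule ccontr)
    assume "\<not> ?thesis"
    then have "w H = 0" unfolding w_def by (intro sum.neutral) auto
    then show False using that by simp
  qed
  have bdw: "bd X b w G = (\<Sum>F\<in>L. if is_facet G (up F) then ?i (up F) G * ?i (up F) F * z F else 0)"
    for G
  proof -
    have "bd X b w G = (\<Sum>H | H \<in> X \<and> is_facet G H. \<Sum>F\<in>L.
        if H = up F then ?i H G * (?i H F * z F) else 0)"
      unfolding bd_def w_def sum_distrib_left by (intro sum.cong refl) simp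
    also have "\<dots> = (\<Sum>F\<in>L. \<Sum>H | H \<in> X \<and> is_facet G H.
        if H = up F then ?i H G * (?i H F * z F) else 0)"
      by (rule sum.swap)
    also have "\<dots> = (\<Sum>F\<in>L. if is_facet G (up F) then ?i (up F) G * ?i (up F) F * z F else 0)"
    proof (rule sum.cong[OF refl])
      fix F assume F: "F \<in> L"
      have "up F \<in> X" using upP[OF F] PX by blast
      then show "(\<Sum>H | H \<in> X \<and> is_facet G H.
        if H = up F then ?i H G * (?i H F * z F) else 0)
        = (if is_facet G (up F) then ?i (up F) G * ?i (up F) F * z F else 0)"
        using fin by (simp add: mult.assoc)
    qed
    finally show ?thesis .
  qed
  have onL: "bd X b w G = z G" if G: "G \<in> L" for G
  proof -
    have "is_facet G (up F) \<longleftrightarrow> F = G" if F: "F \<in> L" for F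
      using others[OF F, of G] upP[OF F] upP[OF G] G PX LP by blast
    then have "bd X b w G = (\<Sum>F\<in>L. if F = G then z F else 0)"
      unfolding bdw by (intro sum.cong) (auto simp: incidence_square)
    then show ?thesis using G finL by simp
  qed
  \<comment> \<open>The facets of \<open>up F\<close> are \<open>F\<close> itself or lie in
    \<open>P - L\<close>, so the correction stays inside \<open>P\<close>.\<close>
  have offP: "bd X b w G = 0" if G: "G \<notin> P" for G
    unfolding bdw
  proof (rule sum.neutral, rule ballI)
    fix F assume F: "F \<in> L"
    have "\<not> is_facet G (up F)"
      using others[OF F] face[of "up F" G] upP[OF F] F G PX LP by blast
    then show "(if is_facet G (up F) then ?i (up F) G * ?i (up F) F * z F else 0) = 0"
      by simp
  qed
  define z' where "z' F = z F - bd X b w F" for F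
  have z'PL: "F \<in> P - L" if "z' F \<noteq> 0" for F
    using that onL[of F] offP[of F] z[of F] by (cases "F \<in> P"; cases "F \<in> L") (auto simp: z'_def)
  have z'cyc: "bd X b z' G = 0" for G
    unfolding z'_def bd_diff by (simp add: cyc bdbd)
  \<comment> \<open>The cycle \<open>z'\<close> has no cell of \<open>L\<close> in its support, so
    \<open>up F\<close> is the only cell there that can have \<open>F\<close> as a facet. Up to sign
    its coefficient is the boundary at \<open>F\<close>.\<close>
  have "z' (up F) = 0" if F: "F \<in> L" for F
  proof -
    have up: "up F \<in> X" "is_facet F (up F)" using upP[OF F] PX by auto
    have "bd X b z' F = (\<Sum>H | H \<in> X \<and> is_facet F H. if H = up F then ?i (up F) F * z' (up F) else 0)"
      unfolding bd_def
    proof (rule sum.cong[OF refl])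
      fix H assume "H \<in> {H. H \<in> X \<and> is_facet F H}"
      then have "H = up F" if "z' H \<noteq> 0" using uniq[OF F z'PL[OF that]] by blast
      then show "?i H F * z' H = (if H = up F then ?i (up F) F * z' (up F) else 0)"
        by (cases "H = up F") auto
    qed
    also have "\<dots> = ?i (up F) F * z' (up F)"
      using up fin by simp
    finally show ?thesis using z'cyc[of F] by (simp add: incidence_def split: if_splits)
  qed
  then have "F \<in> P - L - up ` L" if "z' F \<noteq> 0" for F using that z'PL by auto
  then show thesis using that[of w] w0 unfolding z'_def by blast
qed

section \<open>Boundaries in complexes of products of simplices\<close>

locale cell_complex =
  fixes d :: nat and S :: "(nat \<Rightarrow> nat set) set" and b :: "point set \<Rightarrow> point list"
  assumes S_blocks: "B \<in> S \<Longrightarrow> blocks d B"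
    and S_sub: "B \<in> S \<Longrightarrow> blocks d C \<Longrightarrow> (\<And>i. C i \<subseteq> B i) \<Longrightarrow> C \<in> S"
    and S_finite: "finite S"
    and orient: "orientation b (insert {} (cell d ` S))"
begin

definition X where "X = insert {} (cell d ` S)"

lemma finite_X: "finite X"
  by (simp add: X_def S_finite)

lemma in_X: "B \<in> S \<Longrightarrow> cell d B \<in> X"
  by (simp add: X_def)

lemma X_cases: "F \<in> X \<Longrightarrow> is_facet G F \<Longrightarrow> \<exists>B\<in>S. F = cell d B"
  by (auto simp: X_def is_facet_def)

lemma facet_iff:
  assumes "B \<in> S"
  shows "is_facet G (cell d B) \<longleftrightarrow> (\<exists>u. u \<in> supp d B \<and> del B u \<in> S \<and> G = cell d (del B u))"
  unfolding is_facet_cell_iff[OF S_blocks[OF assms]]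
  using S_blocks S_sub[OF assms] by (auto simp: del_def)

lemma facet_in_X: "F \<in> X \<Longrightarrow> is_facet G F \<Longrightarrow> G \<in> X"
  using X_cases facet_iff in_X by metis

lemma lbasis_cell:
  assumes "B \<in> S"
  shows "lbasis (b (cell d B)) (lin d B)"
  using orient assms cell_nonempty[OF S_blocks[OF assms]]
  by (simp add: orientation_def lbasis_def span_differences_cell[OF S_blocks[OF assms]])

lemma cell_eq: "B \<in> S \<Longrightarrow> C \<in> S \<Longrightarrow> cell d B = cell d C \<longleftrightarrow> B = C"
  by (simp add: cell_inject S_blocks)

text \<open>If \<open>G\<close> arises from \<open>B\<close> by removing \<open>u\<close> and
  \<open>w\<close>, exactly the facet without \<open>u\<close> and the facet without
  \<open>w\<close> lie in between. The coordinates \<open>u\<close> and \<open>w\<close> are the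
  functionals for \<open>incidence_sign_diamond\<close>, since they are negative on the outward
  vectors.\<close>

lemma diamond:
  assumes B: "B \<in> S"
  shows "(\<Sum>H | H \<in> X \<and> is_facet G H \<and> is_facet H (cell d B).
    incidence b (cell d B) H * incidence b H G) = 0"
proof (cases "{H. H \<in> X \<and> is_facet G H \<and> is_facet H (cell d B)} = {}")
  case False
  let ?F = "cell d B"
  from False obtain H where H: "is_facet G H" "is_facet H ?F" by blast
  from H(2) obtain u where u: "u \<in> supp d B" "del B u \<in> S" "H = cell d (del B u)"
    unfolding facet_iff[OF B] by blast
  from H(1) obtain w where w: "w \<in> supp d (del B u)" "del (del B u) w \<in> S" "G = cell d (del (del B u) w)"
    unfolding u(3) facet_iff[OF u(2)] by blast
  define C where "C = del (del B u) w"
  have C2: "C = del (del B w) u" by (auto simp: C_def del_def)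
  have CS: "C \<in> S" using w(2) by (simp add: C_def)
  have uw: "u \<noteq> w" "w \<in> supp d B" using w(1) by (auto simp: supp_del)
  \<comment> \<open>The first \<open>d\<close> blocks of \<open>del B w\<close> are nonempty because
    those of the smaller \<open>C\<close> are.\<close>
  have wS: "del B w \<in> S"
  proof (rule S_sub[OF B])
    show "blocks d (del B w)"
      using blocks_nonempty[OF S_blocks[OF CS]]
      by (intro blocks_subset[OF S_blocks[OF B]]) (auto simp: C2 del_def)
  qed (auto simp: del_def)
  let ?H1 = "cell d (del B u)" and ?H2 = "cell d (del B w)"
  have "{H. H \<in> X \<and> is_facet G H \<and> is_facet H ?F} = {?H1, ?H2}"
  proof (intro subset_antisym subsetI)
    fix K assume K: "K \<in> {H. H \<in> X \<and> is_facet G H \<and> is_facet H ?F}"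
    then obtain v where v: "v \<in> supp d B" "del B v \<in> S" "K = cell d (del B v)"
      using facet_iff[OF B] by blast
    obtain v' where v': "v' \<in> supp d (del B v)" "del (del B v) v' \<in> S" "G = cell d (del (del B v) v')"
      using K facet_iff[OF v(2)] v(3) by blast
    have "C = del (del B v) v'" using w(3) v'(3) cell_eq[OF CS v'(2)] by (simp add: C_def)
    then have "supp d B - {u} - {w} = supp d B - {v} - {v'}" by (simp add: C_def flip: supp_del)
    then have "v = u \<or> v = w" using v(1) by blast
    then show "K \<in> {?H1, ?H2}" using v(3) by blast
  next
    fix K assume "K \<in> {?H1, ?H2}"
    moreover have "is_facet G ?H1" using H(1) u(3) by simp
    moreover have "is_facet G ?H2"
      unfolding facet_iff[OF wS] using w(2,3) C2 u(1) uw by (auto simp: C_def supp_del)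
    moreover have "is_facet ?H1 ?F" "is_facet ?H2 ?F"
      unfolding facet_iff[OF B] using u wS uw by auto
    ultimately show "K \<in> {H. H \<in> X \<and> is_facet G H \<and> is_facet H ?F}"
      using u(2) wS in_X by auto
  qed
  moreover have "?H1 \<noteq> ?H2"
  proof -
    have "u \<in> supp d (del B w)" "u \<notin> supp d (del B u)" using u uw by (auto simp: supp_del)
    then show ?thesis using cell_eq[OF u(2) wS] by metis
  qed
  moreover have "incidence b ?F ?H1 * incidence b ?H1 G + incidence b ?F ?H2 * incidence b ?H2 G = 0"
  proof -
    have bl: "blocks d B" "blocks d (del B u)" "blocks d (del B w)" "blocks d (del (del B u) w)" "blocks d (del (del B w) u)"
      using S_blocks B u(2) wS CS C2 by (auto simp: C_def)
    have uw': "u \<in> supp d (del B w)" "w \<in> supp d (del B u)" using u uw by (auto simp: supp_del)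
    note G = w(3)
    have G2: "G = cell d (del (del B w) u)" using w(3) C2 by (simp add: C_def)
    have "(coord_det (b ?F) (outward ?F ?H1 # b ?H1) > 0 \<longleftrightarrow> coord_det (b ?H1) (outward ?H1 G # b G) > 0) \<longleftrightarrow>
      \<not> (coord_det (b ?F) (outward ?F ?H2 # b ?H2) > 0 \<longleftrightarrow> coord_det (b ?H2) (outward ?H2 G # b G) > 0)"
    proof (rule incidence_sign_diamond[where f = "\<lambda>x. lk x u" and g = "\<lambda>x. lk x w" and U = "lin d B"])
      show "linear (\<lambda>x :: point. lk x u)" "linear (\<lambda>x :: point. lk x w)"
        by (auto intro!: linearI simp: lookup_add)
      show "lbasis (b ?F) (lin d B)" using lbasis_cell[OF B] .
      show "lbasis (b ?H1) {x \<in> lin d B. lk x u = 0}"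
        using lbasis_cell[OF u(2)] by (simp add: lin_del[OF bl(1)])
      show "lbasis (b ?H2) {x \<in> lin d B. lk x w = 0}"
        using lbasis_cell[OF wS] by (simp add: lin_del[OF bl(1)])
      show "lbasis (b G) {x \<in> lin d B. lk x u = 0 \<and> lk x w = 0}"
        using lbasis_cell[OF w(2)] by (simp add: G lin_del[OF bl(1)] lin_del[OF bl(2)] conj_assoc)
      show "outward ?F ?H1 \<in> lin d B" "lk (outward ?F ?H1) u < 0"
        using outward_cell[OF bl(1,2) u(1)] .
      show "outward ?F ?H2 \<in> lin d B" "lk (outward ?F ?H2) w < 0"
        using outward_cell[OF bl(1,3) uw(2)] .
      show "outward ?H1 G \<in> lin d B" "lk (outward ?H1 G) u = 0" "lk (outward ?H1 G) w < 0"
        using outward_cell[OF bl(2,4) uw'(2)] by (auto simp: G lin_del[OF bl(1)])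
      show "outward ?H2 G \<in> lin d B" "lk (outward ?H2 G) w = 0" "lk (outward ?H2 G) u < 0"
        using outward_cell[OF bl(3,5) uw'(1)] by (auto simp: G2 lin_del[OF bl(1)])
    qed (rule subspace_lin)
    then show ?thesis by (auto simp: incidence_def)
  qed
  ultimately show ?thesis by simp
next
  case True
  show ?thesis unfolding True by simp
qed

lemma bd_bd: "bd X b (bd X b z) G = (0 :: 'k::field)"
proof -
  let ?i = "\<lambda>F H. of_int (incidence b F H) :: 'k"
  have "bd X b (bd X b z) G = (\<Sum>H | H \<in> X \<and> is_facet G H. \<Sum>F | F \<in> X \<and> is_facet H F. ?i H G * (?i F H * z F))"
    by (simp add: bd_def sum_distrib_left)
  also have "\<dots> = (\<Sum>H\<in>X. \<Sum>F\<in>X. if is_facet G H \<and> is_facet H F then ?i H G * (?i F H * z F) else 0)"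
  proof -
    have "(\<Sum>H | H \<in> X \<and> is_facet G H. \<Sum>F | F \<in> X \<and> is_facet H F. ?i H G * (?i F H * z F))
      = (\<Sum>H\<in>X. if is_facet G H then \<Sum>F\<in>X. if is_facet H F then ?i H G * (?i F H * z F) else 0 else 0)"
      by (simp add: sum.inter_filter[OF finite_X])
    also have "\<dots> = (\<Sum>H\<in>X. \<Sum>F\<in>X. if is_facet G H \<and> is_facet H F then ?i H G * (?i F H * z F) else 0)"
      by (intro sum.cong) auto
    finally show ?thesis .
  qed
  also have "\<dots> = (\<Sum>F\<in>X. \<Sum>H\<in>X. if is_facet G H \<and> is_facet H F then ?i H G * (?i F H * z F) else 0)"
    by (rule sum.swap)
  also have "\<dots> = (\<Sum>F\<in>X. 0)"
  proof (rule sum.cong[OF refl])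
    fix F assume F: "F \<in> X"
    have "(\<Sum>H\<in>X. if is_facet G H \<and> is_facet H F then ?i H G * (?i F H * z F) else 0)
      = (\<Sum>H | H \<in> X \<and> is_facet G H \<and> is_facet H F. of_int (incidence b F H * incidence b H G) * z F)"
      by (simp add: sum.inter_filter[OF finite_X]) (intro sum.cong, auto simp: mult_ac)
    also have "\<dots> = of_int (\<Sum>H | H \<in> X \<and> is_facet G H \<and> is_facet H F. incidence b F H * incidence b H G) * z F"
      by (simp add: sum_distrib_right)
    also have "\<dots> = 0"
    proof (cases "\<exists>H. is_facet H F")
      case True
      then obtain B where "B \<in> S" "F = cell d B" using X_cases[OF F] by blast
      then show ?thesis using diamond by simp
    qed simp
    finally show "(\<Sum>H\<in>X. if is_facet G H \<and> is_facet H F then ?i H G * (?i F H * z F) else 0) = 0" .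
  qed
  finally show ?thesis by simp
qed

text \<open>A cell with a point as a facet is a segment: one block is {u, w}, all others are
  singletons, and \<epsilon> spans the direction space. The outward vectors at the two ends are
  multiples of \<epsilon> of opposite sign.\<close>

lemma edge_signs:
  assumes B: "B \<in> S"
  shows "(\<Sum>v | {v} \<in> X \<and> is_facet {v} (cell d B). incidence b (cell d B) {v}) = 0"
proof (cases "{v. {v} \<in> X \<and> is_facet {v} (cell d B)} = {}")
  case False
  let ?F = "cell d B"
  note bl = S_blocks[OF B]
  from False obtain p where p: "is_facet {p} ?F" by blast
  then obtain u where u: "u \<in> supp d B" "del B u \<in> S" "{p} = cell d (del B u)"
    unfolding facet_iff[OF B] by blast
  obtain i where i: "i < d" "u \<in> B i" using u(1) by (auto simp: supp_def)
  obtain w where w: "w \<in> B i" "w \<noteq> u"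
    using blocks_nonempty[OF S_blocks[OF u(2)] i(1)] by (auto simp: del_def)
  define \<epsilon> :: point where "\<epsilon> = Poly_Mapping.single u 1 - Poly_Mapping.single w 1"
  have \<epsilon>: "\<epsilon> \<in> lin d B" "lk \<epsilon> u = 1" "lk \<epsilon> w = -1"
    using edge_in_lin[OF bl i(2) w(1)] w(2) by (auto simp: \<epsilon>_def lookup_minus lookup_single when_def)
  have "lin d (del B u) = {0}"
    using span_differences_cell[OF S_blocks[OF u(2)]] by (simp flip: u(3))
  then have z: "x = 0" if "x \<in> lin d B" "lk x u = 0" for x
    using that lin_del[OF bl, of u] by blast
  have mult: "x = lk x u *\<^sub>R \<epsilon>" if "x \<in> lin d B" for x
  proof -
    have "x - lk x u *\<^sub>R \<epsilon> = 0"
      using that \<epsilon> by (intro z subspace_diff subspace_scale subspace_lin) (simp_all add: lookup_minus)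
    then show ?thesis by simp
  qed
  have wS: "del B w \<in> S"
    using i w by (intro S_sub[OF B blocks_del[OF bl w(1)]]) (auto simp: del_def)
  have "lin d (del B w) \<subseteq> {0}"
  proof
    fix x assume "x \<in> lin d (del B w)"
    then have x: "x \<in> lin d B" "lk x w = 0" by (auto simp: lin_del[OF bl])
    have "lk x w = lk (lk x u *\<^sub>R \<epsilon>) w" using mult[OF x(1)] by simp
    then have "lk x u = 0" using x(2) \<epsilon> by simp
    then show "x \<in> {0}" using z x by simp
  qed
  then have "lin d (del B w) = {0}" using subspace_0[OF subspace_lin[of d "del B w"]] by blast
  then obtain q where q: "cell d (del B w) = {q}" by (rule cell_singleton[OF S_blocks[OF wS]])
  have ws: "w \<in> supp d B" using w i by (auto simp: supp_def)
  have pq: "p \<noteq> q"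
  proof
    assume "p = q"
    then have "cell d (del B u) = cell d (del B w)" unfolding u(3)[symmetric] q by simp
    then have "del B u = del B w" unfolding cell_eq[OF u(2) wS] .
    then have "supp d B - {u} = supp d B - {w}" by (simp flip: supp_del)
    then show False using u(1) w(2) by blast
  qed
  have "{v. {v} \<in> X \<and> is_facet {v} ?F} = {p, q}"
  proof (intro subset_antisym subsetI)
    fix v assume "v \<in> {v. {v} \<in> X \<and> is_facet {v} ?F}"
    then obtain t where t: "t \<in> supp d B" "del B t \<in> S" "{v} = cell d (del B t)"
      using facet_iff[OF B] by blast
    obtain j where j: "j < d" "t \<in> B j" using t(1) by (auto simp: supp_def)
    obtain t' where t': "t' \<in> B j" "t' \<noteq> t"
      using blocks_nonempty[OF S_blocks[OF t(2)] j(1)] by (auto simp: del_def)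
    \<comment> \<open>If a third vertex \<open>t\<close> could be removed, its block would contain
      another vertex \<open>s\<close>, giving a nonzero edge direction with coordinate
      \<open>u\<close> equal to 0, against \<open>z\<close>. For this \<open>s\<close> must differ
      from \<open>u\<close>, so in block \<open>i\<close> it is taken to be
      \<open>w\<close>.\<close>
    have "t = u \<or> t = w"
    proof (rule ccontr)
      assume n: "\<not> (t = u \<or> t = w)"
      define s where "s = (if j = i then w else t')"
      have "t' \<noteq> u" if "j \<noteq> i" using blocks_disjoint[OF bl i(2)] t'(1) that by blast
      then have s: "s \<in> B j" "s \<noteq> t" "s \<noteq> u"
        using n t' w by (auto simp: s_def)
      have "Poly_Mapping.single t 1 - Poly_Mapping.single s (1::real) = 0"
        using edge_in_lin[OF bl j(2) s(1)] n s
        by (intro z) (auto simp: lookup_minus lookup_single when_def)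
      then have "lk (Poly_Mapping.single t 1 - Poly_Mapping.single s (1::real)) t = 0" by simp
      then show False using s by (simp add: lookup_minus lookup_single when_def)
    qed
    then show "v \<in> {p, q}" using t(3) u(3) q by auto
  next
    fix v assume "v \<in> {p, q}"
    moreover have "is_facet {p} ?F" "is_facet {q} ?F" "{p} \<in> X" "{q} \<in> X"
      using p facet_iff[OF B] ws wS q in_X[OF u(2)] in_X[OF wS] u(3) by auto
    ultimately show "v \<in> {v. {v} \<in> X \<and> is_facet {v} ?F}" by blast
  qed
  moreover have "incidence b ?F {p} + incidence b ?F {q} = 0"
  proof -
    let ?o1 = "outward ?F {p}" and ?o2 = "outward ?F {q}"
    have o1: "?o1 \<in> lin d B" "lk ?o1 u < 0"
      using outward_cell[OF bl S_blocks[OF u(2)] u(1)] u(3) by simp_all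
    have o2: "?o2 \<in> lin d B" "lk ?o2 w < 0"
      using outward_cell[OF bl S_blocks[OF wS] ws] q by simp_all
    have "lk ?o2 w = lk (lk ?o2 u *\<^sub>R \<epsilon>) w" using mult[OF o2(1)] by simp
    then have o2u: "0 < lk ?o2 u" using o2(2) \<epsilon> by simp
    have e0: "\<epsilon> \<noteq> 0" using \<epsilon>(2) by force
    have "span {\<epsilon>} = lin d B"
    proof
      show "span {\<epsilon>} \<subseteq> lin d B" using \<epsilon>(1) subspace_lin by (intro span_minimal) auto
      show "lin d B \<subseteq> span {\<epsilon>}" using mult span_scale[OF span_base] by (metis singletonI subsetI)
    qed
    then have lb: "lbasis [\<epsilon>] (lin d B)" using e0 by (simp add: lbasis_def)
    have "length (b ?F) = 1"
      using lbasis_length[OF lb] lbasis_length[OF lbasis_cell[OF B]] by simp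
    then obtain \<beta> where \<beta>: "b ?F = [\<beta>]" by (metis One_nat_def length_0_conv length_Suc_conv)
    have lb': "lbasis [\<beta>] (lin d B)" using lbasis_cell[OF B] \<beta> by simp
    then have ind: "independent {\<beta>}" and \<beta>l: "\<beta> \<in> lin d B" and sp: "span {\<beta>} = lin d B"
      using span_base[of \<beta> "{\<beta>}"] by (auto simp: lbasis_def)
    \<comment> \<open>At a point the basis is empty, so the determinant in \<open>incidence\<close>
      is the single coordinate of the outward vector.\<close>
    have bv: "b {v} = []" if "{v} = cell d (del B t)" "del B t \<in> S" for v t
    proof -
      have "length (b {v}) = pdim {v}"
        unfolding pdim_span that(1) span_differences_cell[OF S_blocks[OF that(2)]]
        by (rule lbasis_length[OF lbasis_cell[OF that(2)]])
      then show ?thesis by simp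
    qed
    have cd: "coord_det [\<beta>] [x] = representation {\<beta>} x \<beta>" for x
      by (simp add: coord_det_def det_single)
    have rep: "lk x u = representation {\<beta>} x \<beta> * lk \<beta> u" if "x \<in> lin d B" for x
    proof -
      have "(\<Sum>c\<in>{\<beta>}. representation {\<beta>} x c *\<^sub>R c) = x"
        using ind sp that by (intro sum_representation_eq) auto
      then have "lk (representation {\<beta>} x \<beta> *\<^sub>R \<beta>) u = lk x u" by simp
      then show ?thesis by simp
    qed
    have "representation {\<beta>} ?o1 \<beta> * lk \<beta> u < 0" "0 < representation {\<beta>} ?o2 \<beta> * lk \<beta> u"
      using rep[OF o1(1)] rep[OF o2(1)] o1 o2u by simp_all
    then have "0 < representation {\<beta>} ?o1 \<beta> \<longleftrightarrow> \<not> 0 < representation {\<beta>} ?o2 \<beta>"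
      by (smt (verit) mult_less_0_iff zero_less_mult_iff)
    then show ?thesis
      by (simp add: incidence_def \<beta> bv[OF u(3) u(2)] bv[OF q[symmetric] wS] cd)
  qed
  ultimately show ?thesis using pq by simp
next
  case True
  show ?thesis unfolding True by simp
qed

lemma finite_points: "finite {v. {v} \<in> X}"
  using finite_X by (rule finite_inverse_image[unfolded vimage_def]) (simp add: inj_on_def)

lemma aug_bd: "aug X (bd X b z) = (0 :: 'k::field)"
proof -
  let ?i = "\<lambda>F H. of_int (incidence b F H) :: 'k"
  let ?V = "{v. {v} \<in> X}"
  have "aug X (bd X b z) = (\<Sum>v\<in>?V. \<Sum>F\<in>X. if is_facet {v} F then ?i F {v} * z F else 0)"
    unfolding aug_def bd_def by (simp add: sum.inter_filter[OF finite_X])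
  also have "\<dots> = (\<Sum>F\<in>X. \<Sum>v\<in>?V. if is_facet {v} F then ?i F {v} * z F else 0)"
    by (rule sum.swap)
  also have "\<dots> = (\<Sum>F\<in>X. 0)"
  proof (rule sum.cong[OF refl])
    fix F assume F: "F \<in> X"
    have "(\<Sum>v\<in>?V. if is_facet {v} F then ?i F {v} * z F else 0)
      = (\<Sum>v | v \<in> ?V \<and> is_facet {v} F. ?i F {v} * z F)"
      by (simp only: sum.inter_filter[OF finite_points])
    also have "\<dots> = of_int (\<Sum>v | {v} \<in> X \<and> is_facet {v} F. incidence b F {v}) * z F"
      by (simp add: sum_distrib_right)
    also have "\<dots> = 0"
    proof (cases "\<exists>H. is_facet H F")
      case True
      then obtain B where "B \<in> S" "F = cell d B" using X_cases[OF F] by blast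
      then show ?thesis using edge_signs by simp
    qed simp
    finally show "(\<Sum>v\<in>?V. if is_facet {v} F then ?i F {v} * z F else 0) = 0" .
  qed
  finally show ?thesis by simp
qed

end

subsection \<open>Acyclicity\<close>

text \<open>The form in which the cointerval condition enters the proof of acyclicity.\<close>

locale insertion_complex = cell_complex +
  assumes insert_block: "B \<in> S \<Longrightarrow> B' \<in> S \<Longrightarrow> j < d \<Longrightarrow> (\<And>i. i < j \<Longrightarrow> B i = {v i} \<and> B' i = {v i}) \<Longrightarrow>
    a \<in> B' j \<Longrightarrow> (\<And>c. c \<in> B j \<Longrightarrow> a \<le> c) \<Longrightarrow> B(j := insert a (B j)) \<in> S"
begin

text \<open>What is left of the strand on the vertices \<open>W\<close> once the blocks below
  \<open>j\<close> have been reduced to the vertices \<open>v i\<close>.\<close>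

definition stage :: "nat set \<Rightarrow> nat \<Rightarrow> (nat \<Rightarrow> nat) \<Rightarrow> (nat \<Rightarrow> nat set) set" where
  "stage W j v = {B \<in> S. supp d B \<subseteq> W \<and> (\<forall>i<j. B i = {v i})}"

text \<open>Induction from \<open>j = d\<close> downwards. Elimination in block \<open>j\<close>
  leaves a homologous cycle on the next stage, where the induction hypothesis applies, and the two
  bounding chains are added. The augmentation decides the case \<open>j = d\<close>, where at most
  one cell is left and is a point.\<close>

lemma stage_acyclic:
  fixes z :: "point set \<Rightarrow> 'k::field"
  assumes "j \<le> d"
    and "\<And>F. z F \<noteq> 0 \<Longrightarrow> F \<in> cell d ` stage W j v \<and> pdim F = n"
    and "\<And>G. bd X b z G = 0" and "n = 0 \<Longrightarrow> aug X z = 0"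
  shows "\<exists>w. (\<forall>F. w F \<noteq> 0 \<longrightarrow> F \<in> cell d ` stage W j v \<and> pdim F = n + 1) \<and> (\<forall>G. z G = bd X b w G)"
  using assms
proof (induction j arbitrary: v z rule: inc_induct)
  case base
  have "z F = 0" for F
  proof (rule ccontr)
    assume zF: "z F \<noteq> 0"
    then obtain B where B: "B \<in> stage W d v" "F = cell d B" and n: "pdim F = n"
      using base.prems(1) by blast
    have sing: "B i = {v i}" if "i < d" for i using B(1) that by (auto simp: stage_def)
    have BS: "B \<in> S" using B(1) by (auto simp: stage_def)
    have "lin d B = {0}" using sing by (intro lin_singletons S_blocks BS) (auto simp: is_singleton_def)
    then obtain p where p: "cell d B = {p}" by (rule cell_singleton[OF S_blocks[OF BS]])
    have "n = 0" using n p B by simp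
    then have "aug X z = 0" using base.prems(3) by blast
    moreover have "aug X z = z F"
    proof -
      \<comment> \<open>On the last stage all blocks are prescribed, so the augmentation reads off
        the coefficient of one point.\<close>
      have "z {q} = 0" if "q \<noteq> p" for q
      proof (rule ccontr)
        assume "z {q} \<noteq> 0"
        then obtain C where C: "C \<in> stage W d v" "{q} = cell d C" using base.prems(1) by blast
        have "blocks d C" "blocks d B" using C(1) BS S_blocks by (auto simp: stage_def)
        then have "C i = B i" if "\<not> i < d" for i
          using that unfolding blocks_def by (metis not_less)
        moreover have "C i = B i" if "i < d" for i
          using C(1) sing[OF that] that by (simp add: stage_def)
        ultimately have "C = B" by blast
        then show False using C(2) p that by simp
      qed
      then have "aug X z = (\<Sum>q | {q} \<in> X. if q = p then z {p} else 0)"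
        unfolding aug_def by (intro sum.cong) auto
      also have "\<dots> = z {p}" using in_X[OF BS] p finite_points by simp
      finally show ?thesis using B(2) p by simp
    qed
    ultimately show False using zF by simp
  qed
  then show ?case by (intro exI[of _ "\<lambda>_. 0"]) (simp add: bd_zero)
next
  case (step j)
  show ?case
  proof (cases "stage W j v = {}")
    case True
    then have "z F = 0" for F using step.prems(1) by blast
    then show ?thesis by (intro exI[of _ "\<lambda>_. 0"]) (simp add: bd_zero)
  next
    case False
    let ?P = "stage W j v"
    have jd: "j < d" using step.hyps by simp
    have PS: "B \<in> S" "supp d B \<subseteq> W" "\<And>i. i < j \<Longrightarrow> B i = {v i}" if "B \<in> ?P" for B
      using that by (auto simp: stage_def)
    define A where "A = (\<Union>B\<in>?P. B j)"
    obtain B0 where B0: "B0 \<in> ?P" using False by blast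
    have "A \<noteq> {}" using B0 blocks_nonempty[OF S_blocks[OF PS(1)[OF B0]] jd] by (auto simp: A_def)
    define a where "a = (LEAST a. a \<in> A)"
    have aA: "a \<in> A" using \<open>A \<noteq> {}\<close> unfolding a_def by (metis LeastI ex_in_conv)
    then obtain B' where B': "B' \<in> ?P" "a \<in> B' j" by (auto simp: A_def)
    have amin: "a \<le> c" if "B \<in> ?P" "c \<in> B j" for B c
      unfolding a_def using that by (intro Least_le) (auto simp: A_def)
    define ins where "ins B = B(j := insert a (B j))" for B :: "nat \<Rightarrow> nat set"
    have insP: "ins B \<in> ?P" if B: "B \<in> ?P" for B
    proof -
      have "ins B \<in> S" unfolding ins_def
        by (rule insert_block[OF PS(1)[OF B] PS(1)[OF B'(1)] jd _ B'(2) amin[OF B]])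
          (auto simp: PS(3)[OF B] PS(3)[OF B'(1)])
      moreover have "a \<in> W" using B'(2) PS(2)[OF B'(1)] jd by (auto simp: supp_def)
      then have "supp d (ins B) \<subseteq> W"
        using PS(2)[OF B] by (auto simp: supp_def ins_def split: if_splits)
      ultimately show ?thesis using B by (simp add: stage_def ins_def)
    qed
    \<comment> \<open>Otherwise \<open>ins B\<close>, which belongs to \<open>S\<close>, would
      contain \<open>a\<close> in two blocks.\<close>
    have a_only: "i = j" if "B \<in> ?P" "a \<in> B i" for B i
    proof -
      have "a \<in> ins B i" "a \<in> ins B j" using that by (auto simp: ins_def)
      then show ?thesis using blocks_disjoint[OF S_blocks[OF PS(1)[OF insP[OF that(1)]]]] by blast
    qed
    have delP: "del B u \<in> ?P" if "B \<in> ?P" "del B u \<in> S" for B u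
    proof -
      have "del B u i = {v i}" if "i < j" for i
        using PS(3)[OF \<open>B \<in> ?P\<close> that] blocks_nonempty[OF S_blocks[OF \<open>del B u \<in> S\<close>], of i] that jd
        by (auto simp: del_def)
      then show ?thesis using that PS(2)[OF that(1)] by (auto simp: stage_def supp_del)
    qed
    have del_ins: "del (ins B) a = B" if "B \<in> ?P" "a \<notin> B j" for B
    proof (rule ext)
      fix i
      have "a \<notin> B i" if "i \<noteq> j" using a_only[OF \<open>B \<in> ?P\<close>] that by blast
      then show "del (ins B) a i = B i"
        using that(2) by (cases "i = j") (simp_all add: del_def ins_def)
    qed
    have ins_del: "ins (del B a) = B" if "B \<in> ?P" "a \<in> B j" for B
    proof (rule ext)
      fix i
      have "a \<notin> B i" if "i \<noteq> j" using a_only[OF \<open>B \<in> ?P\<close>] that by blast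
      then show "ins (del B a) i = B i"
        using that(2) by (cases "i = j") (simp_all add: del_def ins_def insert_absorb)
    qed
    define L where "L = cell d ` {B \<in> ?P. a \<notin> B j}"
    \<comment> \<open>The blocks are recovered from the cell, uniquely by
      \<open>cell_eq\<close>.\<close>
    define up where "up F = cell d (ins (THE B. B \<in> S \<and> F = cell d B))" for F
    have up: "up (cell d B) = cell d (ins B)" if "B \<in> S" for B
    proof -
      have "(THE C. C \<in> S \<and> cell d B = cell d C) = B" using that cell_eq by (intro the_equality) auto
      then show ?thesis by (simp add: up_def)
    qed
    have notL: "cell d B \<in> L \<longleftrightarrow> a \<notin> B j" if "B \<in> ?P" for B
      using that cell_eq PS(1) by (auto simp: L_def)
    have facet_ins: "is_facet (cell d B) (cell d (ins B))" if B: "B \<in> ?P" "a \<notin> B j" for B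
      unfolding facet_iff[OF PS(1)[OF insP[OF B(1)]]]
      using del_ins[OF B] PS(1)[OF B(1)] jd by (intro exI[of _ a]) (auto simp: supp_def ins_def)
    obtain w where w: "\<And>H. w H \<noteq> 0 \<Longrightarrow> \<exists>F\<in>L. z F \<noteq> 0 \<and> H = up F"
      and z': "\<And>F. z F - bd X b w F \<noteq> 0 \<Longrightarrow> F \<in> cell d ` ?P - L - up ` L"
    proof (rule eliminate[OF finite_X, where P = "cell d ` ?P" and L = L and up = up and z = z and b = b])
      show "G \<in> X" if "F \<in> X" "is_facet G F" for F G using facet_in_X[OF that] .
      show "cell d ` ?P \<subseteq> X" using PS(1) in_X by blast
      show "L \<subseteq> cell d ` ?P" by (auto simp: L_def)
      show "up F \<in> cell d ` ?P - L \<and> is_facet F (up F)" if "F \<in> L" for F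
      proof -
        obtain B where B: "B \<in> ?P" "a \<notin> B j" "F = cell d B" using \<open>F \<in> L\<close> unfolding L_def by blast
        have "a \<in> ins B j" by (simp add: ins_def)
        then show ?thesis
          using notL[OF insP[OF B(1)]] insP[OF B(1)] facet_ins[OF B(1,2)] up[OF PS(1)[OF B(1)]] B(3) by auto
      qed
      show "G \<in> cell d ` ?P - L" if "F \<in> L" "is_facet G (up F)" "G \<in> X" "G \<noteq> F" for F G
      proof -
        obtain B where B: "B \<in> ?P" "a \<notin> B j" "F = cell d B" using \<open>F \<in> L\<close> unfolding L_def by blast
        have iS: "ins B \<in> S" using PS(1)[OF insP[OF B(1)]] .
        from that(2) obtain u where u: "del (ins B) u \<in> S" "G = cell d (del (ins B) u)"
          unfolding B(3) up[OF PS(1)[OF B(1)]] facet_iff[OF iS] by blast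
        have "u \<noteq> a" using u(2) that(4) del_ins[OF B(1,2)] B(3) by auto
        then have "a \<in> del (ins B) u j" by (simp add: del_def ins_def)
        then show ?thesis using notL[OF delP[OF insP[OF B(1)] u(1)]] delP[OF insP[OF B(1)] u(1)] u(2) by blast
      qed
      show "G = up F" if F: "F \<in> L" and G: "G \<in> cell d ` ?P - L" and fac: "is_facet F G" for F G
      proof -
        obtain C where C: "C \<in> ?P" "a \<notin> C j" "F = cell d C" using F by (auto simp: L_def)
        obtain B where B: "B \<in> ?P" "G = cell d B" "a \<in> B j" using G notL by blast
        obtain u where u: "del B u \<in> S" "F = cell d (del B u)"
          using fac unfolding B(2) facet_iff[OF PS(1)[OF B(1)]] by blast
        have eq: "C = del B u" using C(3) u cell_eq[OF PS(1)[OF C(1)] u(1)] by simp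
        then have "u = a" using C(2) B(3) by (auto simp: del_def)
        then have "ins C = B" using eq ins_del[OF B(1,3)] by simp
        then show ?thesis using up[OF PS(1)[OF C(1)]] C(3) B(2) by simp
      qed
      show "F \<in> cell d ` ?P" if "z F \<noteq> 0" for F using step.prems(1)[OF that] by blast
      show "bd X b z G = 0" for G using step.prems(2) .
      show "bd X b (bd X b w) G = 0" for w :: "point set \<Rightarrow> 'k" and G by (rule bd_bd)
    qed (rule that)
    have wdim: "H \<in> cell d ` ?P \<and> pdim H = n + 1" if H: "w H \<noteq> 0" for H
    proof -
      from w[OF H] obtain B where B: "B \<in> ?P" "a \<notin> B j" "z (cell d B) \<noteq> 0" "H = up (cell d B)"
        by (auto simp: L_def)
      have "pdim H = pdim (cell d B) + 1"
        using facet_ins[OF B(1,2)] B(4) up[OF PS(1)[OF B(1)]] by (simp add: is_facet_def)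
      then show ?thesis
        using step.prems(1)[OF B(3)] insP[OF B(1)] B(4) up[OF PS(1)[OF B(1)]] by auto
    qed
    define z1 where "z1 F = z F - bd X b w F" for F
    have "\<exists>w'. (\<forall>F. w' F \<noteq> 0 \<longrightarrow> F \<in> cell d ` stage W (Suc j) (v(j := a)) \<and> pdim F = n + 1) \<and> (\<forall>G. z1 G = bd X b w' G)"
    proof (rule step.IH)
      show "bd X b z1 G = 0" for G unfolding z1_def bd_diff by (simp add: step.prems(2) bd_bd)
      show "aug X z1 = 0" if "n = 0" unfolding z1_def aug_diff by (simp add: step.prems(3)[OF that] aug_bd)
      fix F assume F: "z1 F \<noteq> 0"
      then have "F \<in> cell d ` ?P - L - up ` L" using z' by (simp add: z1_def)
      then obtain B where B: "B \<in> ?P" "F = cell d B" "a \<in> B j" and nup: "F \<notin> up ` L" using notL by blast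
      have "B j = {a}"
      proof (rule ccontr)
        \<comment> \<open>A cell with further vertices in block \<open>j\<close> is the partner of
          the cell without \<open>a\<close> and has been eliminated.\<close>
        assume ne: "B j \<noteq> {a}"
        have "del B a \<in> S"
          by (rule S_sub[OF PS(1)[OF B(1)] blocks_del[OF S_blocks[OF PS(1)[OF B(1)]] B(3) ne]]) (auto simp: del_def)
        then have dP: "del B a \<in> ?P" using delP[OF B(1)] by blast
        then have "cell d (del B a) \<in> L" using notL by (simp add: del_def)
        moreover have "up (cell d (del B a)) = F" using up[OF PS(1)[OF dP]] ins_del[OF B(1,3)] B(2) by simp
        ultimately show False using nup by blast
      qed
      then have "F \<in> cell d ` stage W (Suc j) (v(j := a))"
        using B by (auto simp: stage_def less_Suc_eq)
      moreover have "pdim F = n"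
      proof (cases "z F = 0")
        case True
        then have "bd X b w F \<noteq> 0" using F by (simp add: z1_def)
        \<comment> \<open>A correction at \<open>F\<close> comes from a cell of \<open>w\<close>
          with facet \<open>F\<close>, and such a cell has dimension \<open>n + 1\<close>.\<close>
        then obtain H where H: "is_facet F H" "w H \<noteq> 0"
          unfolding bd_def by (metis (mono_tags, lifting) mem_Collect_eq mult_zero_right sum.neutral)
        then show ?thesis using wdim[OF H(2)] by (simp add: is_facet_def)
      qed (use step.prems(1) in blast)
      ultimately show "F \<in> cell d ` stage W (Suc j) (v(j := a)) \<and> pdim F = n" by blast
    qed
    then obtain w' where w': "\<And>F. w' F \<noteq> 0 \<Longrightarrow> F \<in> cell d ` stage W (Suc j) (v(j := a)) \<and> pdim F = n + 1"
      "\<And>G. z1 G = bd X b w' G" by blast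
    have "stage W (Suc j) (v(j := a)) \<subseteq> ?P" by (auto simp: stage_def)
    then have "F \<in> cell d ` ?P \<and> pdim F = n + 1" if "w F + w' F \<noteq> 0" for F
      using that wdim[of F] w'(1)[of F] by (cases "w F = 0") auto
    moreover have "z G = bd X b (\<lambda>F. w F + w' F) G" for G
      unfolding bd_add w'(2)[symmetric] z1_def by simp
    ultimately show ?thesis by (intro exI[of _ "\<lambda>F. w F + w' F"]) simp
  qed
qed

end

subsection \<open>Monomials and multidegrees\<close>

definition divides :: "expo \<Rightarrow> expo \<Rightarrow> bool" where
  "divides s a \<longleftrightarrow> (\<exists>t. a = s + t)"

lemma poly_mapping_sum_singles: "p = (\<Sum>t\<in>ks p. Poly_Mapping.single t (lk p t))"
proof (rule poly_mapping_eqI)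
  fix s
  have "lk (\<Sum>t\<in>ks p. Poly_Mapping.single t (lk p t)) s = (\<Sum>t\<in>ks p. if t = s then lk p t else 0)"
    unfolding lookup_sum by (intro sum.cong) (auto simp: lookup_single when_def)
  also have "\<dots> = lk p s" by (simp add: in_keys_iff)
  finally show "lk p s = lk (\<Sum>t\<in>ks p. Poly_Mapping.single t (lk p t)) s" by simp
qed

text \<open>Exponents are natural numbers, so \<open>a - s\<close> is truncated and means division
  only under \<open>divides s a\<close>.\<close>

lemma lk_monomial_mult:
  "lk (monomial s * p) a = (if divides s a then lk p (a - s) else 0)"
proof -
  have "monomial s * p = (\<Sum>t\<in>ks p. Poly_Mapping.single (s + t) (lk p t))"
    by (subst poly_mapping_sum_singles[of p]) (simp add: monomial_def sum_distrib_left mult_single)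
  then have eq: "lk (monomial s * p) a = (\<Sum>t\<in>ks p. if s + t = a then lk p t else 0)"
    by (simp add: lookup_sum lookup_single when_def)
  show ?thesis
  proof (cases "divides s a")
    case True
    then obtain r where r: "a = s + r" by (auto simp: divides_def)
    have "(\<Sum>t\<in>ks p. if s + t = a then lk p t else 0) = (\<Sum>t\<in>ks p. if t = r then lk p t else 0)"
      by (intro sum.cong) (auto simp: r)
    also have "\<dots> = lk p r" by (simp add: in_keys_iff)
    finally show ?thesis using eq True by (simp add: r)
  next
    case False
    then have "(\<Sum>t\<in>ks p. if s + t = a then lk p t else 0) = 0"
      by (intro sum.neutral) (auto simp: divides_def)
    then show ?thesis using eq False by simp
  qed
qed

lemma monomial_mult_single: "monomial s * Poly_Mapping.single t x = Poly_Mapping.single (s + t) x"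
  by (simp add: monomial_def mult_single)

lemma lk_incidence_mult: "lk (of_int (incidence b F G) * p) a = of_int (incidence b F G) * lk p a"
  by (simp add: incidence_def)

lemma single_incidence: "of_int (incidence b F G) * Poly_Mapping.single t x = Poly_Mapping.single t (of_int (incidence b F G) * x)"
  by (simp add: incidence_def single_uminus)

section \<open>The polynomial ring and its ideals\<close>

lemma pol_ring_simps [simp]:
  "p \<in> carrier (pol_ring V) \<longleftrightarrow> (\<forall>a \<in> ks p. ks a \<subseteq> V)"
  "mult (pol_ring V) = (*)" "one (pol_ring V) = 1" "ring.zero (pol_ring V) = 0" "add (pol_ring V) = (+)"
  by (simp_all add: pol_ring_def)

abbreviation Pol :: "int set \<Rightarrow> 'k::field pol set" where
  "Pol V \<equiv> carrier (pol_ring V)"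

lemma pol_add: "p \<in> Pol V \<Longrightarrow> q \<in> Pol V \<Longrightarrow> p + q \<in> Pol V"
  using keys_add[of p q] by auto

lemma pol_uminus: "p \<in> Pol V \<Longrightarrow> - p \<in> Pol V"
  by (auto simp: in_keys_iff)

lemma pol_mult: 
  assumes "p \<in> Pol V" "q \<in> Pol V"
  shows "p * q \<in> Pol V"
proof -
  have "ks a \<subseteq> V" if a: "a \<in> ks (p * q)" for a
  proof -
    obtain s t where "a = s + t" "s \<in> ks p" "t \<in> ks q"
      using a keys_mult[of p q] by blast
    then show ?thesis using assms keys_add[of s t] by fastforce
  qed
  then show ?thesis by simp
qed

lemma pol_zero: "0 \<in> Pol V"
  by simp

lemma pol_one: "1 \<in> Pol V"
  by simp

lemma pol_single: "ks s \<subseteq> V \<Longrightarrow> Poly_Mapping.single s x \<in> Pol V"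
  by simp

lemma pol_monomial: "ks s \<subseteq> V \<Longrightarrow> monomial s \<in> Pol V"
  by (simp add: monomial_def)

lemma pol_incidence: "of_int (incidence b F G) \<in> Pol V"
  unfolding incidence_def using pol_uminus[OF pol_one, of V] pol_one by (auto split: if_splits)

lemma pol_sum: "(\<And>i. i \<in> I \<Longrightarrow> f i \<in> Pol V) \<Longrightarrow> sum f I \<in> Pol V"
  by (induction I rule: infinite_finite_induct) (simp_all only: sum.infinite sum.empty sum.insert pol_zero pol_add insert_iff simp_thms)

lemma ring_pol_ring: "ring (pol_ring V :: 'k::field pol ring)"
proof (rule ringI)
  show "abelian_group (pol_ring V :: 'k pol ring)"
  proof (rule abelian_groupI)
    show "\<exists>q\<in>Pol V. q \<oplus>\<^bsub>pol_ring V\<^esub> p = \<zero>\<^bsub>pol_ring V\<^esub>" if "p \<in> Pol V" for p :: "'k pol"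
      using pol_uminus[OF that] by (intro bexI[of _ "- p"]) simp_all
  qed (simp_all only: pol_ring_simps(2-) pol_add pol_zero add_ac add_0_left add_0_right)
  show "Group.monoid (pol_ring V :: 'k pol ring)"
    by (rule monoidI) (simp_all only: pol_ring_simps(2-) pol_mult pol_one mult.assoc mult_1_left mult_1_right)
qed (simp_all only: pol_ring_simps(2-) distrib_left distrib_right)

lemma ideal_sum:
  assumes "ideal J (pol_ring V)" "\<And>i. i \<in> I \<Longrightarrow> f i \<in> J"
  shows "sum f I \<in> J"
proof -
  have "0 \<in> J" using additive_subgroup.zero_closed[OF ideal.axioms(1)[OF assms(1)]] by simp
  moreover have "p + q \<in> J" if "p \<in> J" "q \<in> J" for p q
    using additive_subgroup.a_closed[OF ideal.axioms(1)[OF assms(1)] that] by simp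
  ultimately show ?thesis
    using assms(2) by (induction I rule: infinite_finite_induct) auto
qed

lemma ideal_mult:
  assumes "ideal J (pol_ring V)" "p \<in> J" "q \<in> Pol V"
  shows "p * q \<in> J"
  using ideal.I_r_closed[OF assms] by simp

text \<open>Brings the generated ideal, defined as an intersection, into the form of an image of the
  augmentation.\<close>

lemma genideal_finite_family:
  fixes g :: "'i \<Rightarrow> 'k::field pol"
  assumes fin: "finite I" and g: "\<And>i. i \<in> I \<Longrightarrow> g i \<in> Pol V"
  shows "genideal (pol_ring V) (g ` I) = {\<Sum>i\<in>I. g i * c i |c. \<forall>i\<in>I. c i \<in> Pol V}" (is "_ = ?S")
proof
  have SI: "(\<Sum>i\<in>I. g i * c i) \<in> ?S" if "\<And>i. i \<in> I \<Longrightarrow> c i \<in> Pol V" for c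
    using that by blast
  show "genideal (pol_ring V) (g ` I) \<subseteq> ?S"
    unfolding genideal_def
  proof (rule Inter_lower, rule CollectI, rule conjI)
    have sub: "?S \<subseteq> Pol V"
      using g by (auto simp only: intro!: pol_sum pol_mult)
    show "ideal ?S (pol_ring V)"
    proof (rule idealI[OF ring_pol_ring])
      show "subgroup ?S (add_monoid (pol_ring V))"
      proof
        show "?S \<subseteq> carrier (add_monoid (pol_ring V))" using sub by simp
        show "p \<otimes>\<^bsub>add_monoid (pol_ring V)\<^esub> q \<in> ?S" if pq: "p \<in> ?S" "q \<in> ?S" for p q
        proof -
          obtain c e where "p = (\<Sum>i\<in>I. g i * c i)" "\<forall>i\<in>I. c i \<in> Pol V"
            "q = (\<Sum>i\<in>I. g i * e i)" "\<forall>i\<in>I. e i \<in> Pol V"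
            using pq by blast
          then have "p + q = (\<Sum>i\<in>I. g i * (c i + e i))" and "\<And>i. i \<in> I \<Longrightarrow> c i + e i \<in> Pol V"
            by (simp_all only: distrib_left sum.distrib pol_add)
          then have "p + q \<in> ?S" using SI[of "\<lambda>i. c i + e i"] by simp
          then show ?thesis by simp
        qed
        show "\<one>\<^bsub>add_monoid (pol_ring V)\<^esub> \<in> ?S"
          using pol_zero by (auto simp only: monoid.simps pol_ring_simps(2-) mem_Collect_eq intro!: exI[of _ "\<lambda>_. 0"]) simp
        show "inv\<^bsub>add_monoid (pol_ring V)\<^esub> p \<in> ?S" if p: "p \<in> ?S" for p
        proof -
          obtain c where c: "p = (\<Sum>i\<in>I. g i * c i)" "\<forall>i\<in>I. c i \<in> Pol V" using p by blast
          have pc: "p \<in> Pol V" using p sub by blast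
          have "\<ominus>\<^bsub>pol_ring V\<^esub> p = - p"
          proof (rule abelian_group.minus_equality[OF ring.is_abelian_group[OF ring_pol_ring]])
            show "- p \<oplus>\<^bsub>pol_ring V\<^esub> p = \<zero>\<^bsub>pol_ring V\<^esub>" by simp
          qed (simp_all only: pc pol_uminus[OF pc])
          also have "- p = (\<Sum>i\<in>I. g i * (- c i))" by (simp add: c(1) sum_negf)
          also have "\<dots> \<in> ?S" using c(2) pol_uminus by (intro SI) blast
          finally show ?thesis by (simp add: a_inv_def)
        qed
      qed
      show "x \<otimes>\<^bsub>pol_ring V\<^esub> p \<in> ?S" "p \<otimes>\<^bsub>pol_ring V\<^esub> x \<in> ?S"
        if p: "p \<in> ?S" and x: "x \<in> Pol V" for p x
      proof -
        obtain c where c: "p = (\<Sum>i\<in>I. g i * c i)" "\<forall>i\<in>I. c i \<in> Pol V" using p by blast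
        have "p * x = (\<Sum>i\<in>I. g i * (c i * x))" by (simp add: c(1) sum_distrib_right mult.assoc)
        moreover have "c i * x \<in> Pol V" if "i \<in> I" for i using c(2) x pol_mult that by blast
        ultimately have "p * x \<in> ?S" using SI[of "\<lambda>i. c i * x"] by simp
        then show "x \<otimes>\<^bsub>pol_ring V\<^esub> p \<in> ?S" "p \<otimes>\<^bsub>pol_ring V\<^esub> x \<in> ?S"
          by (simp_all add: mult.commute)
      qed
    qed
    show "g ` I \<subseteq> ?S"
    proof
      fix p assume "p \<in> g ` I"
      then obtain j where j: "j \<in> I" "p = g j" by blast
      have "(\<Sum>i\<in>I. g i * (if i = j then 1 else 0)) = (\<Sum>i\<in>I. if i = j then g j else 0)"
        by (intro sum.cong) auto
      then have "p = (\<Sum>i\<in>I. g i * (if i = j then 1 else 0))" using j fin by simp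
      moreover have "(\<Sum>i\<in>I. g i * (if i = j then 1 else 0)) \<in> ?S" by (intro SI) simp
      ultimately show "p \<in> ?S" by simp
    qed
  qed
  show "?S \<subseteq> genideal (pol_ring V) (g ` I)"
    unfolding genideal_def
  proof (intro subsetI InterI)
    fix p J assume p: "p \<in> ?S" and "J \<in> {J. ideal J (pol_ring V) \<and> g ` I \<subseteq> J}"
    then have J: "ideal J (pol_ring V)" "g ` I \<subseteq> J" by auto
    obtain c where c: "p = (\<Sum>i\<in>I. g i * c i)" "\<forall>i\<in>I. c i \<in> Pol V" using p by blast
    show "p \<in> J" unfolding c(1) using J c(2) by (intro ideal_sum[OF J(1)] ideal_mult[OF J(1)]) auto
  qed
qed

lemma prod_var: "finite e \<Longrightarrow> (\<Prod>v\<in>e. var v) = monomial (\<Sum>v\<in>e. Poly_Mapping.single v 1)"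
  by (induction e rule: finite_induct) (simp_all add: var_def monomial_def mult_single)

subsection \<open>From multigraded strands to the resolution\<close>

text \<open>\<open>facet_label\<close> makes the truncated differences of labels in
  \<open>boundary\<close> exact.\<close>

locale labelled_complex =
  fixes V :: "int set" and X :: "'a::real_vector set set" and b :: "'a set \<Rightarrow> 'a list" and l :: "'a \<Rightarrow> expo"
  assumes finite_cells: "finite X"
    and facet_cell: "F \<in> X \<Longrightarrow> is_facet G F \<Longrightarrow> G \<in> X"
    and facet_label: "F \<in> X \<Longrightarrow> is_facet G F \<Longrightarrow> \<exists>u\<in>V. face_label l F = face_label l G + Poly_Mapping.single u 1"
    and point_label: "{v} \<in> X \<Longrightarrow> face_label l {v} = l v"
    and label_keys: "F \<in> X \<Longrightarrow> F \<noteq> {} \<Longrightarrow> ks (face_label l F) \<subseteq> V"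
begin

abbreviation L where "L \<equiv> face_label l"

text \<open>The component of multidegree \<open>a\<close>: the generator of \<open>F\<close> has
  degree \<open>L F\<close>, so the exponent \<open>a - L F\<close> of its coefficient is the
  relevant one.\<close>

definition strand :: "expo \<Rightarrow> ('a set \<Rightarrow> 'k::field pol) \<Rightarrow> 'a set \<Rightarrow> 'k" where
  "strand a c F = (if divides (L F) a then lk (c F) (a - L F) else 0)"

text \<open>Conversely, the homogeneous chain of multidegree \<open>a\<close> with scalars
  \<open>z\<close>.\<close>

definition homog :: "expo \<Rightarrow> ('a set \<Rightarrow> 'k) \<Rightarrow> 'a set \<Rightarrow> 'k::field pol" where
  "homog a z F = Poly_Mapping.single (a - L F) (z F)"

text \<open>The factor \<open>monomial (L F - L G)\<close> moves the exponent \<open>a - L F\<close>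
  to \<open>a - L G\<close>, so in degree \<open>a\<close> the operator \<open>boundary\<close>
  becomes \<open>bd\<close>.\<close>

lemma strand_boundary: "strand a (boundary X b l c) G = bd X b (strand a c) G"
proof -
  have term_eq: "(if divides (L G) a
      then lk (of_int (incidence b F G) * monomial (L F - L G) * c F) (a - L G) else 0)
    = of_int (incidence b F G) * strand a c F" if F: "F \<in> X" "is_facet G F" for F
  proof -
    obtain u where u: "L F = L G + Poly_Mapping.single u 1"
      using facet_label[OF F] by blast
    let ?t = "Poly_Mapping.single u (1::nat)"
    show ?thesis
    proof (cases "divides (L G) a")
      case True
      then obtain r where r: "a = L G + r" by (auto simp: divides_def)
      have "divides ?t r \<longleftrightarrow> divides (L F) a"
        by (simp add: divides_def r u add.assoc)
      moreover have "r - ?t = a - L F"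
        by (simp add: r u diff_diff_add[symmetric])
      ultimately show ?thesis
        using True by (simp add: mult.assoc lk_incidence_mult lk_monomial_mult strand_def u r)
    next
      case False
      then have "\<not> divides (L F) a" by (auto simp: divides_def u add.assoc)
      then show ?thesis using False by (simp add: strand_def)
    qed
  qed
  have "strand a (boundary X b l c) G = (\<Sum>F | F \<in> X \<and> is_facet G F. if divides (L G) a
      then lk (of_int (incidence b F G) * monomial (L F - L G) * c F) (a - L G) else 0)"
    by (simp add: strand_def boundary_def lookup_sum)
  also have "\<dots> = bd X b (strand a c) G"
    unfolding bd_def by (intro sum.cong) (auto simp: term_eq)
  finally show ?thesis .
qed

lemma strand_augmentation: "lk (augmentation X l c) a = aug X (strand a c)"
  unfolding augmentation_def aug_def lookup_sum
  by (intro sum.cong) (auto simp: lk_monomial_mult strand_def point_label)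

lemma strand_eq_zero: "(\<And>a. strand a c F = 0) \<Longrightarrow> c F = 0"
proof (rule poly_mapping_eqI)
  fix t assume "\<And>a. strand a c F = 0"
  then have "strand (L F + t) c F = 0" .
  then show "lk (c F) t = lk 0 t" by (simp add: strand_def divides_def)
qed

text \<open>Divisibility guarantees that the truncated differences \<open>L F - L G\<close> and
  \<open>a - L F\<close> add up to \<open>a - L G\<close>.\<close>

lemma boundary_homog:
  assumes "\<And>F. z F \<noteq> 0 \<Longrightarrow> divides (L F) a"
  shows "boundary X b l (homog a z) G = homog a (bd X b z) G"
proof -
  have "of_int (incidence b F G) * monomial (L F - L G) * homog a z F
      = Poly_Mapping.single (a - L G) (of_int (incidence b F G) * z F)"
    if F: "F \<in> X" "is_facet G F" for F
  proof (cases "z F = 0")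
    case False
    obtain u where u: "L F = L G + Poly_Mapping.single u 1"
      using facet_label[OF F] by blast
    obtain r where r: "a = L F + r" using assms[OF False] by (auto simp: divides_def)
    show ?thesis
      by (simp add: homog_def mult.assoc monomial_mult_single single_incidence)
        (simp add: r u add.assoc)
  qed (simp add: homog_def)
  then have "boundary X b l (homog a z) G = (\<Sum>F | F \<in> X \<and> is_facet G F. Poly_Mapping.single (a - L G) (of_int (incidence b F G) * z F))"
    unfolding boundary_def by (intro sum.cong) auto
  also have "\<dots> = homog a (bd X b z) G"
    unfolding homog_def bd_def by (rule poly_mapping_eqI) (simp add: lookup_sum lookup_single when_def)
  finally show ?thesis .
qed

lemma boundary_sum: "boundary X b l (\<lambda>F. \<Sum>a\<in>A. h a F) G = (\<Sum>a\<in>A. boundary X b l (h a) G)"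
  unfolding boundary_def sum_distrib_left by (rule sum.swap)

text \<open>Only the degrees \<open>L F + t\<close> occur, with \<open>t\<close> an exponent in the
  coefficient of \<open>F\<close>.\<close>

lemma chain_degrees:
  assumes "c \<in> chains V X n"
  shows "\<exists>A. finite A \<and> (\<forall>a\<in>A. ks a \<subseteq> V) \<and> (\<forall>F. c F = (\<Sum>a\<in>A. homog a (strand a c) F))"
proof -
  let ?A = "\<Union>F\<in>X - {{}}. (\<lambda>t. L F + t) ` ks (c F)"
  have fin: "finite ?A" using finite_cells by auto
  have "ks a \<subseteq> V" if "a \<in> ?A" for a
  proof -
    obtain F t where F: "F \<in> X" "F \<noteq> {}" "t \<in> ks (c F)" "a = L F + t" using \<open>a \<in> ?A\<close> by blast
    have "c F \<in> Pol V" using assms unfolding chains_def by blast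
    then have "ks t \<subseteq> V" using F(3) by simp
    then show ?thesis using label_keys[OF F(1,2)] keys_add[of "L F" t] F(4) by blast
  qed
  moreover have "c F = (\<Sum>a\<in>?A. homog a (strand a c) F)" for F
  proof (rule poly_mapping_eqI)
    fix t
    have "lk (homog a (strand a c) F) t = (if a = L F + t then lk (c F) t else 0)" for a
    proof (cases "divides (L F) a")
      case True
      then obtain r where r: "a = L F + r" by (auto simp: divides_def)
      then show ?thesis using True by (simp add: homog_def strand_def lookup_single when_def)
    next
      case False
      then show ?thesis by (auto simp: homog_def strand_def divides_def)
    qed
    then have "lk (\<Sum>a\<in>?A. homog a (strand a c) F) t = (\<Sum>a\<in>?A. if a = L F + t then lk (c F) t else 0)"
      by (simp add: lookup_sum)
    also have "\<dots> = (if L F + t \<in> ?A then lk (c F) t else 0)" using fin by simp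
    also have "\<dots> = lk (c F) t"
    proof (cases "lk (c F) t = 0")
      case False
      then have "c F \<noteq> 0" by auto
      then have "F \<in> X - {{}}" using assms by (auto simp: chains_def)
      moreover have "t \<in> ks (c F)" using False by (simp add: in_keys_iff)
      ultimately have "L F + t \<in> ?A" by blast
      then show ?thesis by simp
    qed simp
    finally show "lk (c F) t = lk (\<Sum>a\<in>?A. homog a (strand a c) F) t" by simp
  qed
  ultimately show ?thesis using fin by blast
qed

lemma boundary_chain:
  assumes c: "c \<in> chains V X (n + 1)"
  shows "boundary X b l c \<in> chains V X n"
  unfolding chains_def
proof (intro CollectI conjI allI impI)
  fix G
  show "boundary X b l c G \<in> Pol V"
    unfolding boundary_def
  proof (rule pol_sum)
    fix F assume "F \<in> {F. F \<in> X \<and> is_facet G F}"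
    then have F: "F \<in> X" "is_facet G F" by auto
    obtain u where u: "u \<in> V" "L F = L G + Poly_Mapping.single u 1"
      using facet_label[OF F] by blast
    have "c F \<in> Pol V" using c unfolding chains_def by blast
    moreover have "monomial (L F - L G) \<in> Pol V"
      using u by (intro pol_monomial) simp
    ultimately show "of_int (incidence b F G) * monomial (L F - L G) * c F \<in> Pol V"
      by (intro pol_mult pol_incidence)
  qed
  assume "boundary X b l c G \<noteq> 0"
  then obtain F where F: "F \<in> X" "is_facet G F" "c F \<noteq> 0"
    unfolding boundary_def by (metis (mono_tags, lifting) mem_Collect_eq mult_zero_right sum.neutral)
  then have "pdim F = n + 1" using c by (auto simp: chains_def)
  then show "G \<in> X" "G \<noteq> {}" "pdim G = n" using F facet_cell by (auto simp: is_facet_def)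
qed

text \<open>The cycle is bounded in each degree separately, and the homogeneous lifts of the
  solutions are added over the finitely many degrees of \<open>c\<close>.\<close>

lemma exact_at:
  fixes c :: "'a set \<Rightarrow> 'k::field pol"
  assumes acyclic: "\<And>a (z :: 'a set \<Rightarrow> 'k). (\<And>F. z F \<noteq> 0 \<Longrightarrow> F \<in> X \<and> F \<noteq> {} \<and> divides (L F) a \<and> pdim F = n) \<Longrightarrow>
      (\<And>G. bd X b z G = 0) \<Longrightarrow> (n = 0 \<Longrightarrow> aug X z = 0) \<Longrightarrow>
      \<exists>w. (\<forall>F. w F \<noteq> 0 \<longrightarrow> F \<in> X \<and> F \<noteq> {} \<and> divides (L F) a \<and> pdim F = n + 1) \<and> (\<forall>G. z G = bd X b w G)"
    and c: "c \<in> chains V X n" and cyc: "boundary X b l c = (\<lambda>_. 0)" and cyc0: "n = 0 \<Longrightarrow> augmentation X l c = 0"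
  shows "c \<in> boundary X b l ` chains V X (n + 1)"
proof -
  obtain A where A: "finite A" "\<And>a. a \<in> A \<Longrightarrow> ks a \<subseteq> V" "\<And>F. c F = (\<Sum>a\<in>A. homog a (strand a c) F)"
    using chain_degrees[OF c] by blast
  have "\<exists>w. (\<forall>F. w F \<noteq> 0 \<longrightarrow> F \<in> X \<and> F \<noteq> {} \<and> divides (L F) a \<and> pdim F = n + 1) \<and> (\<forall>G. strand a c G = bd X b w G)" for a
  proof (rule acyclic)
    show "F \<in> X \<and> F \<noteq> {} \<and> divides (L F) a \<and> pdim F = n" if "strand a c F \<noteq> 0" for F
    proof -
      have "divides (L F) a" "c F \<noteq> 0" using that by (auto simp: strand_def split: if_splits)
      then show ?thesis using c by (auto simp: chains_def)
    qed
    show "bd X b (strand a c) G = 0" for G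
      unfolding strand_boundary[symmetric] cyc by (simp add: strand_def)
    show "aug X (strand a c) = 0" if "n = 0" 
      unfolding strand_augmentation[symmetric] cyc0[OF that] by simp
  qed
  then obtain w where w: "\<And>a F. w a F \<noteq> 0 \<Longrightarrow> F \<in> X \<and> F \<noteq> {} \<and> divides (L F) a \<and> pdim F = n + 1"
    "\<And>a G. strand a c G = bd X b (w a) G" by metis
  define c' where "c' F = (\<Sum>a\<in>A. homog a (w a) F)" for F
  have "boundary X b l c' G = c G" for G
  proof -
    have "boundary X b l c' G = (\<Sum>a\<in>A. homog a (bd X b (w a)) G)"
      unfolding c'_def boundary_sum using w(1) by (intro sum.cong refl boundary_homog) blast
    also have "\<dots> = c G" unfolding A(3)[of G] by (simp add: homog_def w(2))
    finally show ?thesis .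
  qed
  moreover have "c' \<in> chains V X (n + 1)"
    unfolding chains_def
  proof (intro CollectI conjI allI impI)
    fix F
    show "c' F \<in> Pol V"
      unfolding c'_def
    proof (rule pol_sum)
      fix a assume a: "a \<in> A"
      show "homog a (w a) F \<in> Pol V"
        unfolding homog_def
      proof (rule pol_single)
        show "ks (a - L F) \<subseteq> V"
          using A(2)[OF a] by (auto simp: in_keys_iff lookup_minus)
      qed
    qed
    assume "c' F \<noteq> 0"
    then obtain a where "w a F \<noteq> 0"
      unfolding c'_def homog_def by (metis (mono_tags, lifting) single_zero sum.neutral)
    then show "F \<in> X" "F \<noteq> {}" "pdim F = n + 1" using w(1) by blast+
  qed
  ultimately show ?thesis by (intro image_eqI[of _ _ c']) auto
qed

theorem minimal_resolution:
  fixes I :: "'k::field pol set"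
  assumes acyclic: "\<And>n a (z :: 'a set \<Rightarrow> 'k). (\<And>F. z F \<noteq> 0 \<Longrightarrow> F \<in> X \<and> F \<noteq> {} \<and> divides (L F) a \<and> pdim F = n) \<Longrightarrow>
      (\<And>G. bd X b z G = 0) \<Longrightarrow> (n = 0 \<Longrightarrow> aug X z = 0) \<Longrightarrow>
      \<exists>w. (\<forall>F. w F \<noteq> 0 \<longrightarrow> F \<in> X \<and> F \<noteq> {} \<and> divides (L F) a \<and> pdim F = n + 1) \<and> (\<forall>G. z G = bd X b w G)"
    and bdbd: "\<And>(z :: 'a set \<Rightarrow> 'k) G. bd X b (bd X b z) G = 0"
    and augbd: "\<And>z :: 'a set \<Rightarrow> 'k. aug X (bd X b z) = 0"
    and I: "augmentation X l ` chains V X 0 = I"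
  shows "minimal_cellular_resolution V X b l I"
  unfolding minimal_cellular_resolution_def cellular_resolution_def
proof (intro conjI allI impI ballI)
  show "augmentation X l ` chains V X 0 = I" by (rule I)
  have strand_zero: "strand a (\<lambda>_. 0 :: 'k pol) = (\<lambda>_. 0)" for a by (auto simp: strand_def)
  have sb: "strand a (boundary X b l c) = bd X b (strand a c)" for a and c :: "'a set \<Rightarrow> 'k pol"
    by (rule ext) (rule strand_boundary)
  show "{c \<in> chains V X 0. augmentation X l c = (0 :: 'k pol)} = boundary X b l ` chains V X 1"
  proof
    show "{c \<in> chains V X 0. augmentation X l c = (0 :: 'k pol)} \<subseteq> boundary X b l ` chains V X 1"
    proof
      fix c :: "'a set \<Rightarrow> 'k pol" assume c: "c \<in> {c \<in> chains V X 0. augmentation X l c = 0}"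
      \<comment> \<open>\<open>exact_at\<close> asks for a vanishing boundary also for
        \<open>n = 0\<close>; it holds because \<open>is_facet\<close> gives a cell of dimension 0
        no facets.\<close>
      have "boundary X b l c G = 0" for G
        unfolding boundary_def
      proof (rule sum.neutral, rule ballI)
        fix F assume "F \<in> {F. F \<in> X \<and> is_facet G F}"
        then have "pdim F \<noteq> 0" by (simp add: is_facet_def)
        then have "c F = 0" using c by (auto simp: chains_def)
        then show "of_int (incidence b F G) * monomial (L F - L G) * c F = 0" by simp
      qed
      then have "boundary X b l c = (\<lambda>_. 0)" by blast
      then show "c \<in> boundary X b l ` chains V X 1"
        using exact_at[OF acyclic, of 0 c] c by simp
    qed
    show "boundary X b l ` chains V X 1 \<subseteq> {c \<in> chains V X 0. augmentation X l c = (0 :: 'k pol)}"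
    proof (intro image_subsetI CollectI conjI)
      fix c :: "'a set \<Rightarrow> 'k pol" assume "c \<in> chains V X 1"
      then show "boundary X b l c \<in> chains V X 0" using boundary_chain[of c 0] by simp
      show "augmentation X l (boundary X b l c) = 0"
        by (rule poly_mapping_eqI) (simp add: strand_augmentation sb augbd)
    qed
  qed
  fix n :: nat assume n: "1 \<le> n"
  show "{c \<in> chains V X n. boundary X b l c = (\<lambda>_. 0 :: 'k pol)} = boundary X b l ` chains V X (n + 1)"
  proof
    show "{c \<in> chains V X n. boundary X b l c = (\<lambda>_. 0 :: 'k pol)} \<subseteq> boundary X b l ` chains V X (n + 1)"
      using exact_at[OF acyclic, of n] n by auto
    show "boundary X b l ` chains V X (n + 1) \<subseteq> {c \<in> chains V X n. boundary X b l c = (\<lambda>_. 0 :: 'k pol)}"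
    proof (intro image_subsetI CollectI conjI)
      fix c :: "'a set \<Rightarrow> 'k pol" assume c: "c \<in> chains V X (n + 1)"
      show "boundary X b l c \<in> chains V X n" using boundary_chain[OF c] .
      show "boundary X b l (boundary X b l c) = (\<lambda>_. 0)"
      proof (rule ext)
        show "boundary X b l (boundary X b l c) G = 0" for G
          by (rule strand_eq_zero[of "boundary X b l (boundary X b l c)"]) (simp add: sb bdbd)
      qed
    qed
  qed
  fix c :: "'a set \<Rightarrow> 'k pol" and G assume c: "c \<in> chains V X n"
  show "boundary X b l c G \<in> genideal (pol_ring V) (var ` V)"
    unfolding genideal_def
  proof (rule InterI)
    fix J assume "J \<in> {J. ideal J (pol_ring V) \<and> var ` V \<subseteq> (J :: 'k pol set)}"
    then have J: "ideal J (pol_ring V)" "var ` V \<subseteq> J" by auto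
    show "boundary X b l c G \<in> J"
      unfolding boundary_def
    proof (rule ideal_sum[OF J(1)])
      fix F assume "F \<in> {F. F \<in> X \<and> is_facet G F}"
      then have F: "F \<in> X" "is_facet G F" by auto
      obtain u where u: "u \<in> V" "L F = L G + Poly_Mapping.single u 1"
        using facet_label[OF F] by blast
      have cF: "c F \<in> Pol V" using c unfolding chains_def by blast
      have "of_int (incidence b F G) * monomial (L F - L G) * c F
        = var u * (of_int (incidence b F G) * c F)"
        by (simp add: u(2) var_def mult_ac)
      also have "\<dots> \<in> J" using J u(1) by (intro ideal_mult[OF J(1)] pol_mult pol_incidence cF) auto
      finally show "of_int (incidence b F G) * monomial (L F - L G) * c F \<in> J" .
    qed
  qed
qed

end

subsection \<open>Cointerval graphs\<close>

text \<open>If \<open>x\<close> is the least vertex of \<open>e\<close>, condition (2) applies to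
  \<open>v < x\<close>. Otherwise the least vertex \<open>p\<close> stays, \<open>v\<close> lies
  above it, and the exchange takes place in the layer of \<open>p\<close>. The larger vertex
  \<open>y\<close> keeps the recursion from ending at a 1-graph, where no exchange is
  guaranteed.\<close>

lemma cointerval_exchange:
  assumes "cointerval d V E" "d_graph d V E" "e \<in> E" "x \<in> e" "y \<in> e" "x < y"
    and "v \<in> V" "v < x" "\<And>u. u \<in> e \<Longrightarrow> u < x \<Longrightarrow> u < v"
  shows "insert v (e - {x}) \<in> E"
  using assms
proof (induction d V E arbitrary: e rule: cointerval.induct)
  case (2 V E)
  then have "card e = 1" by (auto simp: d_graph_def)
  then show ?case using "2.prems" by (metis card_1_singletonE less_irrefl singletonD)
next
  case (3 d V E)
  have eV: "e \<subseteq> V" and ce: "card e = Suc (Suc d)" and fe: "finite e"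
    using "3.prems"(2,3) by (auto simp: d_graph_def intro: finite_subset)
  define p where "p = Min e"
  have p: "p \<in> e" "\<And>w. w \<in> e \<Longrightarrow> p \<le> w"
    using Min_in[OF fe] Min_le[OF fe] "3.prems"(4) unfolding p_def by blast+
  have ins_p: "insert p (e - {p}) = e" using p(1) by blast
  have rest: "e - {p} \<in> layer_edges E p"
    unfolding layer_edges_def using p "3.prems"(3) by (auto simp: insert_absorb order_less_le)
  show ?case
  proof (cases "x = p")
    case True
    have "layer_edges E x \<subseteq> layer_edges E v"
      using "3.prems"(1,4,7,8) eV by (simp, blast)
    then have "e - {p} \<in> layer_edges E v" using rest True by blast
    then show ?thesis using True by (simp add: layer_edges_def)
  next
    case False
    let ?V = "{w \<in> V. p < w}"
    have px: "p < x" using False p(2)[OF "3.prems"(4)] by simp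
    have "insert v ((e - {p}) - {x}) \<in> layer_edges E p"
    proof (rule "3.IH"[of p])
      show "p \<in> V" using p eV by blast
      show "cointerval (Suc d) ?V (layer_edges E p)" using "3.prems"(1) p eV by auto
      show "d_graph (Suc d) ?V (layer_edges E p)"
        unfolding d_graph_def
      proof (intro conjI ballI)
        show "finite ?V" using "3.prems"(2) by (simp add: d_graph_def)
        fix f assume f: "f \<in> layer_edges E p"
        then have g: "insert p f \<in> E" "p \<notin> f" "\<forall>w\<in>f. p < w" by (auto simp: layer_edges_def)
        then have "insert p f \<subseteq> V" "card (insert p f) = Suc (Suc d)" "finite V"
          using "3.prems"(2) by (auto simp: d_graph_def)
        then show "f \<subseteq> ?V" "card f = Suc d" using g by (auto dest: finite_subset)
      qed
      show "e - {p} \<in> layer_edges E p" by (rule rest)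
      show "x \<in> e - {p}" "y \<in> e - {p}" "x < y" "v < x" using "3.prems" px by auto
      show "v \<in> ?V" using "3.prems"(7) "3.prems"(9)[OF p(1) px] by simp
      show "u < v" if "u \<in> e - {p}" "u < x" for u using that "3.prems"(9) by blast
    qed
    then have "insert p (insert v ((e - {p}) - {x})) \<in> E" by (simp add: layer_edges_def)
    moreover have "insert p (insert v ((e - {p}) - {x})) = insert v (e - {x})" using p(1) False by blast
    ultimately show ?thesis by simp
  qed
qed simp

text \<open>\<open>t\<close> ranges over the vertices of the cell, one element from each block.\<close>

definition edge_blocks :: "nat \<Rightarrow> (nat \<Rightarrow> int) \<Rightarrow> int set set \<Rightarrow> (nat \<Rightarrow> nat set) set" where
  "edge_blocks d g E = {B. blocks d B \<and> (\<forall>t. (\<forall>i<d. t i \<in> B i) \<longrightarrow> (\<lambda>i. g (t i)) ` {..<d} \<in> E)}"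

definition mon :: "(nat \<Rightarrow> int) \<Rightarrow> nat set \<Rightarrow> expo" where
  "mon g A = (\<Sum>a\<in>A. Poly_Mapping.single (g a) 1)"

lemma lk_mon:
  assumes "finite A" "inj g"
  shows "lk (mon g A) i = (if i \<in> g ` A then 1 else 0)"
proof (cases "i \<in> g ` A")
  case True
  then obtain a where a: "a \<in> A" "i = g a" by blast
  have "lk (mon g A) i = (\<Sum>c\<in>A. if c = a then 1 else 0)"
    unfolding mon_def lookup_sum a(2) using assms(2)
    by (intro sum.cong) (auto simp: lookup_single when_def inj_eq)
  then show ?thesis using a assms(1) True by simp
next
  case False
  then show ?thesis
    unfolding mon_def lookup_sum by (auto intro!: sum.neutral simp: lookup_single when_def)
qed

lemma keys_mon: "finite A \<Longrightarrow> inj g \<Longrightarrow> ks (mon g A) = g ` A"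
  by (auto simp: in_keys_iff lk_mon split: if_splits)

text \<open>\<open>mon g A\<close> is squarefree, so a strand depends only on which variables occur
  in \<open>a\<close>.\<close>

lemma divides_mon_iff:
  assumes "finite A" "inj g"
  shows "divides (mon g A) a \<longleftrightarrow> A \<subseteq> {u. g u \<in> ks a}"
proof
  assume "divides (mon g A) a"
  then obtain t where t: "a = mon g A + t" by (auto simp: divides_def)
  show "A \<subseteq> {u. g u \<in> ks a}"
    by (auto simp: t in_keys_iff lookup_add lk_mon[OF assms])
next
  assume sub: "A \<subseteq> {u. g u \<in> ks a}"
  have "a = mon g A + (a - mon g A)"
  proof (rule poly_mapping_eqI)
    fix i
    have "1 \<le> lk a i" if "i \<in> g ` A" using that sub by (auto simp: in_keys_iff Suc_le_eq)
    then show "lk a i = lk (mon g A + (a - mon g A)) i"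
      by (simp add: lookup_add lookup_minus lk_mon[OF assms])
  qed
  then show "divides (mon g A) a" unfolding divides_def by blast
qed

section \<open>Points of the complex and labels of cells\<close>

definition singles :: "nat \<Rightarrow> (nat \<Rightarrow> nat) \<Rightarrow> nat \<Rightarrow> nat set" where
  "singles d t i = (if i < d then {t i} else {})"

lemma blocks_singles: "(\<And>i j. i < j \<Longrightarrow> j < d \<Longrightarrow> t i < t j) \<Longrightarrow> blocks d (singles d t)"
  by (auto simp: blocks_def singles_def)

lemma supp_singles: "supp d (singles d t) = t ` {..<d}"
  by (auto simp: supp_def singles_def)

lemma cell_singles:
  assumes "blocks d (singles d t)"
  obtains p where "cell d (singles d t) = {p}"
  using cell_singleton[OF assms lin_singletons[OF assms]] by (auto simp: singles_def)

lemma keys_of_singleton_cell: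
  assumes "blocks d B" "cell d B = {p}"
  shows "ks p = supp d B"
proof -
  obtain x where "x \<in> cell d B" "\<And>a. a \<in> supp d B \<Longrightarrow> 0 < lk x a" using cell_interior[OF assms(1)] by blast
  then have "0 < lk p a" if "a \<in> supp d B" for a using that assms(2) by simp
  moreover have "lk p a = 0" if "a \<notin> supp d B" for a using that assms(2) by (auto simp: cell_def)
  ultimately have "lk p a \<noteq> 0 \<longleftrightarrow> a \<in> supp d B" for a by (metis less_irrefl)
  then show ?thesis by (auto simp: in_keys_iff)
qed

text \<open>Any choice \<open>t\<close> gives a vertex of the cell, hence its only point, and the
  support of that point is the whole of \<open>supp d B\<close>.\<close>

lemma singleton_cell_transversal:
  assumes "blocks d B" "cell d B = {p}" "\<And>i. i < d \<Longrightarrow> t i \<in> B i"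
  shows "supp d B = t ` {..<d}"
proof -
  have "vert d B t = p" using vert_in_cell[OF assms(1,3)] assms(2) by simp
  then have "lk p a = (if a \<in> t ` {..<d} then 1 else 0)" for a using lk_vert[OF assms(1,3)] by simp
  then have "ks p = t ` {..<d}" by (auto simp: in_keys_iff split: if_splits)
  then show ?thesis using keys_of_singleton_cell[OF assms(1,2)] by simp
qed

text \<open>All exponents are 0 or 1. Extreme points have their support in \<open>supp d B\<close>,
  and each element of \<open>supp d B\<close> is used by the extreme point of some
  transversal.\<close>

lemma face_label_cell:
  assumes b: "blocks d B" and g: "inj g"
  shows "face_label (\<lambda>x. mon g (ks x)) (cell d B) = mon g (supp d B)"
proof -
  let ?l = "\<lambda>x :: point. mon g (ks x)"
  let ?P = "{v. v extreme_point_of cell d B}"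
  have fin: "finite (supp d B)" using finite_supp[OF b] .
  have lkl: "lk (?l v) i = (if i \<in> g ` ks v then 1 else 0)" for v i
    by (rule lk_mon[OF finite_keys g])
  have vertex: "\<exists>v\<in>?P. ks v = t ` {..<d}" if t: "\<And>i. i < d \<Longrightarrow> t i \<in> B i" for t
  proof -
    have bt: "blocks d (singles d t)"
      using blocks_less[OF b t t] by (intro blocks_singles) auto
    then obtain p where p: "cell d (singles d t) = {p}" by (rule cell_singles)
    have "{p} face_of cell d B"
      unfolding p[symmetric] using t by (intro cell_face_subblocks[OF b bt]) (auto simp: singles_def)
    then show ?thesis
      using keys_of_singleton_cell[OF bt p] by (auto simp: face_of_singleton supp_singles)
  qed
  obtain t0 where t0: "\<And>j. j < d \<Longrightarrow> t0 j \<in> B j" using blocks_choose[OF b] by blast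
  then have ne: "?P \<noteq> {}" using vertex[of t0] by blast
  have through: "\<exists>v\<in>?P. a \<in> ks v" if a: "a \<in> supp d B" for a
  proof -
    obtain i where i: "i < d" "a \<in> B i" using a by (auto simp: supp_def)
    then have "(t0(i := a)) j \<in> B j" if "j < d" for j using t0[OF that] by simp
    then obtain v where v: "v \<in> ?P" "ks v = (t0(i := a)) ` {..<d}"
      using vertex[of "t0(i := a)"] by blast
    have "a \<in> (t0(i := a)) ` {..<d}" using i(1) by (intro image_eqI[of _ _ i]) auto
    then show ?thesis using v by blast
  qed
  have sub: "ks v \<subseteq> supp d B" if "v \<in> ?P" for v
    using that by (auto simp: extreme_point_of_def cell_def in_keys_iff)
  have "Max ((\<lambda>v. lk (?l v) i) ` ?P) = lk (mon g (supp d B)) i" for i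
  proof (rule Max_eqI)
    show "finite ((\<lambda>v. lk (?l v) i) ` ?P)"
      by (rule finite_subset[of _ "{0, 1}"]) (auto simp: lkl)
    show "y \<le> lk (mon g (supp d B)) i" if "y \<in> (\<lambda>v. lk (?l v) i) ` ?P" for y
      using that sub by (auto simp: lkl lk_mon[OF fin g])
    show "lk (mon g (supp d B)) i \<in> (\<lambda>v. lk (?l v) i) ` ?P"
    proof (cases "i \<in> g ` supp d B")
      case True
      then obtain a v where "i = g a" "v \<in> ?P" "a \<in> ks v" using through by blast
      then show ?thesis using True by (intro image_eqI[of _ _ v]) (auto simp: lkl lk_mon[OF fin g])
    next
      case False
      obtain v where v: "v \<in> ?P" using ne by blast
      then have "i \<notin> g ` ks v" using False sub[OF v] by blast
      then show ?thesis using v False by (intro image_eqI[of _ _ v]) (auto simp: lkl lk_mon[OF fin g])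
    qed
  qed
  then show ?thesis
    unfolding face_label_def by (simp add: lookup_inverse)
qed

section \<open>The complex of a cointerval graph\<close>

locale cointerval_complex =
  fixes d :: nat and V :: "int set" and E :: "int set set" and g :: "nat \<Rightarrow> int" and m :: nat
  assumes d: "1 \<le> d" and graph: "d_graph d V E" and coint: "cointerval d V E"
    and g_mono: "strict_mono g" and V_range: "V \<subseteq> g ` {..m}"
begin

abbreviation S where "S \<equiv> edge_blocks d g E"

lemma inj_g: "inj g"
  using g_mono by (rule strict_mono_imp_inj_on)

lemma g_less: "g a < g c \<longleftrightarrow> a < c"
  using g_mono by (rule strict_mono_less)

lemma edge_blocksD:
  assumes "B \<in> S"
  shows "blocks d B" "\<And>t. (\<And>i. i < d \<Longrightarrow> t i \<in> B i) \<Longrightarrow> (\<lambda>i. g (t i)) ` {..<d} \<in> E"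
  using assms by (auto simp: edge_blocks_def)

lemma edge_subset: "e \<in> E \<Longrightarrow> e \<subseteq> V"
  using graph by (simp add: d_graph_def)

lemma edge_blocks_vertices:
  assumes "B \<in> S" "a \<in> supp d B"
  shows "g a \<in> V" "a \<le> m"
proof -
  obtain i where i: "i < d" "a \<in> B i" using assms(2) by (auto simp: supp_def)
  obtain t0 where t0: "\<And>j. j < d \<Longrightarrow> t0 j \<in> B j" using blocks_choose[OF edge_blocksD(1)[OF assms(1)]] by blast
  have "(\<lambda>j. g ((t0(i := a)) j)) ` {..<d} \<in> E"
    using t0 i by (intro edge_blocksD(2)[OF assms(1)]) auto
  then have "(\<lambda>j. g ((t0(i := a)) j)) ` {..<d} \<subseteq> V" by (rule edge_subset)
  then have "g ((t0(i := a)) i) \<in> V" using i(1) by blast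
  then show "g a \<in> V" by simp
  then show "a \<le> m" using V_range inj_g by (auto dest: injD)
qed

lemma finite_edge_blocks: "finite (S)"
proof (rule finite_subset)
  show "S \<subseteq> {B. \<forall>i. (i \<in> {..<d} \<longrightarrow> B i \<in> Pow {..m}) \<and> (i \<notin> {..<d} \<longrightarrow> B i = {})}"
  proof (intro subsetI CollectI allI conjI impI)
    fix B i assume B: "B \<in> S"
    show "B i \<in> Pow {..m}" if "i \<in> {..<d}"
      using edge_blocks_vertices(2)[OF B] that by (auto simp: supp_def)
    show "B i = {}" if "i \<notin> {..<d}"
      using blocks_empty[OF edge_blocksD(1)[OF B]] that by simp
  qed
  show "finite \<dots>" by (rule finite_set_of_finite_funs) auto
qed

lemma edge_blocks_sub:
  assumes "B \<in> S" "blocks d C" "\<And>i. C i \<subseteq> B i"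
  shows "C \<in> S"
  using assms unfolding edge_blocks_def by blast

text \<open>New are the transversals \<open>t\<close> through \<open>a\<close>. In the last block
  such a \<open>t\<close> is a transversal of \<open>B'\<close>, since the earlier blocks are
  singletons common to both cells. In any other block \<open>a\<close> is first replaced by some
  \<open>c\<close> in \<open>B j\<close>, which gives an edge from \<open>B\<close>; it has a vertex
  above \<open>c\<close>, so \<open>cointerval_exchange\<close> lowers \<open>c\<close> to
  \<open>a\<close>.\<close>

lemma edge_blocks_insert:
  assumes B: "B \<in> S" and B': "B' \<in> S" and j: "j < d"
    and pre: "\<And>i. i < j \<Longrightarrow> B i = {v i} \<and> B' i = {v i}"
    and a: "a \<in> B' j" and amin: "\<And>c. c \<in> B j \<Longrightarrow> a \<le> c"
  shows "B(j := insert a (B j)) \<in> S"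
proof -
  let ?C = "B(j := insert a (B j))"
  note b = edge_blocksD(1)[OF B] and b' = edge_blocksD(1)[OF B']
  obtain c where c: "c \<in> B j" using blocks_nonempty[OF b j] by blast
  \<comment> \<open>\<open>a\<close> is above the earlier vertices in \<open>B'\<close>, and these
    are the same in \<open>B\<close>.\<close>
  have below: "v i < a" if "i < j" for i
    using blocks_less[OF b' _ a that, of "v i"] pre[OF that] by simp
  have above: "a < w" if "j < i" "w \<in> B i" for i w
    using blocks_less[OF b c that(2,1)] amin[OF c] by simp
  have "blocks d ?C"
    unfolding blocks_def
  proof (intro conjI allI impI ballI)
    show "finite (?C i)" for i using blocks_finite[OF b] by simp
    show "?C i \<noteq> {}" if "i < d" for i using blocks_nonempty[OF b that] by simp
    show "?C i = {}" if "d \<le> i" for i using blocks_empty[OF b that] that j by simp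
    show "x < y" if "i < k \<and> k < d" "x \<in> ?C i" "y \<in> ?C k" for i k x y
    proof -
      have ik: "i < k" using that by simp
      have "x \<in> B i \<or> i = j \<and> x = a" "y \<in> B k \<or> k = j \<and> y = a"
        using that(2,3) by (auto split: if_splits)
      then consider "k = j" "y = a" | "i = j" "x = a" | "x \<in> B i" "y \<in> B k"
        by blast
      then show ?thesis
      proof cases
        case 1
        then have "x \<in> B i" using that ik by simp
        then show ?thesis using 1 ik pre[of i] below[of i] by simp
      next
        case 2
        then have "y \<in> B k" using that ik by simp
        then show ?thesis using 2 ik above by simp
      qed (use blocks_less[OF b] ik in blast)
    qed
  qed
  moreover have "(\<lambda>i. g (t i)) ` {..<d} \<in> E" if t: "\<And>i. i < d \<Longrightarrow> t i \<in> ?C i" for t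
  proof (cases "t j \<in> B j")
    case True
    have "t i \<in> B i" if "i < d" for i using t[OF that] True by (auto split: if_splits)
    then show ?thesis using edge_blocksD(2)[OF B] by blast
  next
    case False
    then have tj: "t j = a" using t[OF j] by simp
    have ts: "t i \<in> B i" if "i < d" "i \<noteq> j" for i using t[OF that(1)] that(2) by simp
    have tpre: "t i = v i" if "i < j" for i using ts[of i] pre[OF that] that j by simp
    show ?thesis
    proof (cases "Suc j < d")
      case False
      have "t i \<in> B' i" if "i < d" for i
      proof (cases "i = j")
        case False
        then have "i < j" using that \<open>\<not> Suc j < d\<close> by simp
        then show ?thesis using tpre pre by simp
      qed (use tj a in simp)
      then show ?thesis using edge_blocksD(2)[OF B'] by blast
    next
      case True
      define t' where "t' = t(j := c)"
      have t': "t' i \<in> B i" if "i < d" for i using ts c that by (simp add: t'_def)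
      let ?e = "(\<lambda>i. g (t' i)) ` {..<d}"
      have eE: "?e \<in> E" using edge_blocksD(2)[OF B t'] by blast
      have t'less: "t' i < t' k" if "i < k" "k < d" for i k
        using blocks_less[OF b t' t'] that by simp
      have "a < c" using amin[OF c] False c tj by (metis order_le_less)
      have "insert (g a) (?e - {g c}) \<in> E"
      proof (rule cointerval_exchange[OF coint graph eE])
        show "g c \<in> ?e" using j by (intro image_eqI[of _ _ j]) (auto simp: t'_def)
        show "g (t' (Suc j)) \<in> ?e" using True by blast
        show "g c < g (t' (Suc j))" using t'less[of j "Suc j"] True by (simp add: g_less t'_def)
        show "g a \<in> V" using edge_blocks_vertices(1)[OF B'] a j by (auto simp: supp_def)
        show "g a < g c" using \<open>a < c\<close> by (simp add: g_less)
        show "u < g a" if u: "u \<in> ?e" "u < g c" for u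
        proof -
          obtain i where i: "i < d" "u = g (t' i)" using u(1) by blast
          have "t' i < t' j" using u(2) i(2) by (simp add: g_less t'_def)
          then have "i < j" using t'less[of j i] i(1) by (metis less_asym less_irrefl linorder_neqE_nat)
          then show ?thesis using i(2) tpre below by (simp add: t'_def g_less)
        qed
      qed
      moreover have "insert (g a) (?e - {g c}) = (\<lambda>i. g (t i)) ` {..<d}"
      proof -
        have "g (t' i) = g c \<longleftrightarrow> i = j" if "i < d" for i
        proof -
          have "t' i = t' j \<longleftrightarrow> i = j"
            using t'less[of i j] t'less[of j i] that j by (metis less_irrefl linorder_neqE_nat)
          then show ?thesis using inj_g by (simp add: t'_def inj_eq)
        qed
        then have "?e - {g c} = (\<lambda>i. g (t' i)) ` ({..<d} - {j})" by auto
        also have "\<dots> = (\<lambda>i. g (t i)) ` ({..<d} - {j})" by (intro image_cong) (auto simp: t'_def)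
        finally have eq: "?e - {g c} = (\<lambda>i. g (t i)) ` ({..<d} - {j})" .
        have "insert (g a) (?e - {g c}) = (\<lambda>i. g (t i)) ` insert j ({..<d} - {j})"
          unfolding eq image_insert tj ..
        also have "insert j ({..<d} - {j}) = {..<d}" using j by blast
        finally show ?thesis .
      qed
      ultimately show ?thesis by simp
    qed
  qed
  ultimately show ?thesis by (simp add: edge_blocks_def)
qed

lemma edge_cell:
  assumes e: "e \<in> E"
  obtains t where "singles d t \<in> S" "g ` supp d (singles d t) = e"
proof -
  define A where "A = {n. n \<le> m \<and> g n \<in> e}"
  have fin: "finite A" by (simp add: A_def)
  have eA: "g ` A = e" using edge_subset[OF e] V_range by (auto simp: A_def)
  have "card e = d" using e graph by (simp add: d_graph_def)
  then have cA: "card A = d" using eA card_image[of g A] inj_g by (metis inj_on_subset subset_UNIV)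
  define t where "t i = sorted_list_of_set A ! i" for i
  have len: "length (sorted_list_of_set A) = d" using cA by simp
  have less: "t i < t j" if "i < j" "j < d" for i j
    unfolding t_def using that len fin sorted_wrt_nth_less[OF strict_sorted_list_of_set, of i j A] by simp
  have tA: "t ` {..<d} = A"
  proof -
    have "t ` {..<d} = set (sorted_list_of_set A)"
      unfolding t_def using len by (auto simp: set_conv_nth)
    then show ?thesis using fin by simp
  qed
  have "(\<lambda>i. g (s i)) ` {..<d} \<in> E" if "\<And>i. i < d \<Longrightarrow> s i \<in> singles d t i" for s
  proof -
    have "(\<lambda>i. g (s i)) ` {..<d} = (\<lambda>i. g (t i)) ` {..<d}"
      using that by (intro image_cong) (auto simp: singles_def)
    also have "\<dots> = e" using eA tA by (metis image_image)
    finally show ?thesis using e by simp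
  qed
  then have "singles d t \<in> S"
    using blocks_singles[OF less] by (simp add: edge_blocks_def)
  then show thesis using that[of t] eA tA by (simp add: supp_singles)
qed

definition cells :: "point set set" where
  "cells = insert {} (cell d ` S)"

definition label :: "point \<Rightarrow> expo" where
  "label x = mon g (ks x)"

lemma face_label_cells: "B \<in> S \<Longrightarrow> face_label label (cell d B) = mon g (supp d B)"
  using face_label_cell[OF edge_blocksD(1) inj_g] by (simp add: label_def[abs_def])

lemma cells_subset_staircase: "cells \<subseteq> staircase_subdivision d m"
proof -
  have "cell d B \<in> staircase_subdivision d m" if "B \<in> S" for B
    using edge_blocks_vertices(2)[OF that] edge_blocksD(1)[OF that] by (intro cell_in_staircase[OF d]) auto
  moreover have "{} \<in> staircase_subdivision d m"
  proof -
    \<comment> \<open>Any stair will do; it provides a cell of which \<open>{}\<close> is a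
      face.\<close>
    have "stair d m (\<lambda>j. if j \<le> m then 0 else d - 1)" by (auto simp: stair_def mono_def)
    then show ?thesis by (auto simp: staircase_subdivision_def)
  qed
  ultimately show ?thesis by (auto simp: cells_def)
qed

text \<open>The intersection property is inherited from the staircase subdivision. Closure under
  faces holds because transversals of smaller blocks are still edges.\<close>

lemma polyhedral_complex_cells: "polyhedral_complex cells"
  unfolding polyhedral_complex_def
proof (intro conjI ballI allI impI)
  note Y = polyhedral_complex_staircase[OF d, of m, unfolded polyhedral_complex_def]
  show "finite cells" by (simp add: cells_def finite_edge_blocks)
  show "polytope F" if "F \<in> cells" for F using that cells_subset_staircase Y by blast
  show "F \<inter> G face_of F" "F \<inter> G face_of G" if "F \<in> cells" "G \<in> cells" for F G
    using that cells_subset_staircase Y by blast+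
  fix F G assume F: "F \<in> cells" and G: "G face_of F"
  show "G \<in> cells"
  proof (cases "G = {}")
    case False
    then have "F \<noteq> {}" using G face_of_imp_subset by blast
    then obtain B where B: "B \<in> S" "F = cell d B" using F unfolding cells_def by blast
    obtain C where "blocks d C" "\<And>i. C i \<subseteq> B i" "G = cell d C"
      using face_of_cell[OF edge_blocksD(1)[OF B(1)] G[unfolded B(2)] False] by metis
    then show ?thesis using edge_blocks_sub[OF B(1)] by (auto simp: cells_def)
  qed (simp add: cells_def)
qed

lemma orientation_exists: "\<exists>b. orientation b cells"
proof -
  have "\<exists>bs. distinct bs \<and> independent (set bs) \<and> span (set bs) = span (differences F)" if "F \<in> cells - {{}}" for F
  proof -
    obtain B where B: "B \<in> S" "F = cell d B" using \<open>F \<in> cells - {{}}\<close> unfolding cells_def by blast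
    obtain Q where Q: "finite Q" "independent Q" "span Q = lin d B" using lin_basis[OF edge_blocksD(1)[OF B(1)]] by blast
    obtain bs where "set bs = Q" "distinct bs" using finite_distinct_list[OF Q(1)] by blast
    then show ?thesis using Q span_differences_cell[OF edge_blocksD(1)[OF B(1)]] B(2) by auto
  qed
  then show ?thesis unfolding orientation_def by metis
qed

lemma point_cells: "{v} \<in> cells \<longleftrightarrow> (\<exists>B\<in>S. cell d B = {v})"
  by (auto simp: cells_def)

lemma label_monomial: "finite A \<Longrightarrow> (monomial (mon g A) :: 'k::field pol) = (\<Prod>v\<in>g ` A. var v)"
  using inj_g by (subst prod_var) (simp_all add: mon_def sum.reindex inj_on_subset[OF inj_g])

lemma label_point:
  assumes "B \<in> S" "cell d B = {v}"
  shows "label v = mon g (supp d B)"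
  using keys_of_singleton_cell[OF edge_blocksD(1)[OF assms(1)] assms(2)] by (simp add: label_def)

lemma edge_monomials:
  "(\<lambda>e. \<Prod>v\<in>e. var v) ` E = (\<lambda>v. monomial (label v) :: 'k::field pol) ` {v. {v} \<in> cells}"
proof (intro subset_antisym subsetI)
  fix p :: "'k pol" assume "p \<in> (\<lambda>e. \<Prod>v\<in>e. var v) ` E"
  then obtain e where e: "e \<in> E" "p = (\<Prod>v\<in>e. var v)" by blast
  obtain t where t: "singles d t \<in> S" "g ` supp d (singles d t) = e"
    using edge_cell[OF e(1)] by blast
  note bt = edge_blocksD(1)[OF t(1)]
  obtain v where v: "cell d (singles d t) = {v}" using cell_singles[OF bt] by blast
  have "monomial (label v) = p"
    unfolding label_point[OF t(1) v] label_monomial[OF finite_supp[OF bt]] t(2) e(2) ..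
  moreover have "{v} \<in> cells" unfolding point_cells using t(1) v by blast
  ultimately show "p \<in> (\<lambda>v. monomial (label v)) ` {v. {v} \<in> cells}" by blast
next
  fix p :: "'k pol" assume "p \<in> (\<lambda>v. monomial (label v)) ` {v. {v} \<in> cells}"
  then obtain v B where v: "p = monomial (label v)" "B \<in> S" "cell d B = {v}"
    unfolding point_cells by blast
  note b = edge_blocksD(1)[OF v(2)]
  obtain t where t: "\<And>i. i < d \<Longrightarrow> t i \<in> B i" using blocks_choose[OF b] by blast
  have s: "supp d B = t ` {..<d}" using singleton_cell_transversal[OF b v(3) t] .
  have "p = (\<Prod>v\<in>g ` supp d B. var v)"
    unfolding v(1) label_point[OF v(2,3)] label_monomial[OF finite_supp[OF b]] ..
  moreover have "g ` supp d B \<in> E" using edge_blocksD(2)[OF v(2) t] by (simp add: s image_image)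
  ultimately show "p \<in> (\<lambda>e. \<Prod>v\<in>e. var v) ` E" by blast
qed

lemma label_keys_subset: "{v} \<in> cells \<Longrightarrow> ks (label v) \<subseteq> V"
  unfolding point_cells
  using label_point edge_blocks_vertices(1) keys_mon[OF finite_supp[OF edge_blocksD(1)] inj_g] by fastforce

lemma finite_point_cells: "finite {v. {v} \<in> cells}"
  by (rule finite_inverse_image[unfolded vimage_def, of cells "\<lambda>v. {v}"])
    (simp_all add: cells_def finite_edge_blocks inj_on_def)

lemma augmentation_image:
  "augmentation cells label ` chains V cells 0 = (edge_ideal V E :: 'k::field pol set)"
proof -
  let ?P = "{v. {v} \<in> cells}"
  have "edge_ideal V E = {\<Sum>v\<in>?P. monomial (label v) * c v |c. \<forall>v\<in>?P. c v \<in> carrier (pol_ring V :: 'k pol ring)}"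
    unfolding edge_ideal_def edge_monomials
    by (rule genideal_finite_family[OF finite_point_cells]) (use label_keys_subset pol_monomial in blast)
  also have "\<dots> = augmentation cells label ` chains V cells 0"
  proof (intro subset_antisym subsetI)
    fix p :: "'k pol" assume "p \<in> {\<Sum>v\<in>?P. monomial (label v) * c v |c. \<forall>v\<in>?P. c v \<in> Pol V}"
    then obtain c :: "point \<Rightarrow> 'k pol" where c: "p = (\<Sum>v\<in>?P. monomial (label v) * c v)" "\<And>v. v \<in> ?P \<Longrightarrow> c v \<in> Pol V"
      by blast
    define c' where "c' F = (if F \<in> cells \<and> is_singleton F then c (the_elem F) else 0)" for F
    have "c' \<in> chains V cells 0"
      unfolding chains_def
    proof (intro CollectI conjI allI impI)
      show "c' F \<in> Pol V" for F
        unfolding c'_def using c(2)[of "the_elem F"] pol_zero by (auto simp only: is_singleton_the_elem mem_Collect_eq split: if_splits)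
      show "F \<in> cells" "F \<noteq> {}" "pdim F = 0" if "c' F \<noteq> 0" for F
        using that by (auto simp: c'_def is_singleton_def split: if_splits)
    qed
    moreover have "p = augmentation cells label c'"
      unfolding augmentation_def c(1) by (intro sum.cong) (auto simp: c'_def)
    ultimately show "p \<in> augmentation cells label ` chains V cells 0" by blast
  next
    fix p :: "'k pol" assume "p \<in> augmentation cells label ` chains V cells 0"
    then obtain c where c: "p = augmentation cells label c" "c \<in> chains V cells 0" by blast
    have "\<forall>v\<in>?P. c {v} \<in> Pol V" using c(2) unfolding chains_def by blast
    then show "p \<in> {\<Sum>v\<in>?P. monomial (label v) * c v |c. \<forall>v\<in>?P. c v \<in> Pol V}"
      unfolding c(1) augmentation_def by (intro CollectI exI[of _ "\<lambda>v. c {v}"] conjI refl)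
  qed
  finally show ?thesis by simp
qed

lemma minimal_resolution_cells:
  assumes orient: "orientation b cells"
  shows "minimal_cellular_resolution V cells b label (edge_ideal V E :: 'k::field pol set)"
proof -
  interpret I: insertion_complex d S b
  proof
    show "blocks d B" if "B \<in> S" for B using edge_blocksD(1)[OF that] .
    show "C \<in> S" if "B \<in> S" "blocks d C" "\<And>i. C i \<subseteq> B i" for B C
      using edge_blocks_sub[OF that] .
    show "finite (S)" by (rule finite_edge_blocks)
    show "orientation b (insert {} (cell d ` S))" using orient by (simp add: cells_def)
    show "B(j := insert a (B j)) \<in> S"
      if "B \<in> S" "B' \<in> S" "j < d" "\<And>i. i < j \<Longrightarrow> B i = {v i} \<and> B' i = {v i}"
        "a \<in> B' j" "\<And>c. c \<in> B j \<Longrightarrow> a \<le> c" for B B' j v a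
      using edge_blocks_insert[OF that] .
  qed
  have X: "I.X = cells" by (simp add: I.X_def cells_def)
  interpret L: labelled_complex V cells b label
  proof
    show "finite cells" using I.finite_X X by simp
    show "G \<in> cells" if "F \<in> cells" "is_facet G F" for F G using I.facet_in_X that X by simp
    show "\<exists>u\<in>V. face_label label F = face_label label G + Poly_Mapping.single u 1"
      if F: "F \<in> cells" "is_facet G F" for F G
    proof -
      obtain B where B: "B \<in> S" "F = cell d B" using I.X_cases F X by metis
      obtain u where u: "u \<in> supp d B" "del B u \<in> S" "G = cell d (del B u)"
        using F(2) I.facet_iff[OF B(1)] B(2) by blast
      have fin: "finite (supp d B)" using finite_supp[OF edge_blocksD(1)[OF B(1)]] .
      have "mon g (supp d B) = mon g (supp d B - {u}) + Poly_Mapping.single (g u) 1"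
        unfolding mon_def using fin u(1) by (subst sum.remove[of _ u]) (simp_all add: add.commute)
      then show ?thesis
        using face_label_cells[OF B(1)] face_label_cells[OF u(2)] edge_blocks_vertices(1)[OF B(1) u(1)]
        by (intro bexI[of _ "g u"]) (simp_all add: B(2) u(3) supp_del)
    qed
    show "face_label label {v} = label v" if "{v} \<in> cells" for v
    proof -
      obtain B where B: "B \<in> S" "cell d B = {v}" using \<open>{v} \<in> cells\<close> unfolding point_cells by blast
      show ?thesis using face_label_cells[OF B(1)] label_point[OF B] B(2) by simp
    qed
    show "ks (face_label label F) \<subseteq> V" if "F \<in> cells" "F \<noteq> {}" for F
    proof -
      obtain B where B: "B \<in> S" "F = cell d B" using \<open>F \<in> cells\<close> \<open>F \<noteq> {}\<close> unfolding cells_def by blast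
      show ?thesis
        using face_label_cells[OF B(1)] keys_mon[OF finite_supp[OF edge_blocksD(1)[OF B(1)]] inj_g]
          edge_blocks_vertices(1)[OF B(1)] B(2) by auto
    qed
  qed
  show ?thesis
  proof (rule L.minimal_resolution)
    show "bd cells b (bd cells b z) G = 0" for z :: "point set \<Rightarrow> 'k" and G
      using I.bd_bd X by simp
    show "aug cells (bd cells b z) = 0" for z :: "point set \<Rightarrow> 'k"
      using I.aug_bd X by simp
    show "augmentation cells label ` chains V cells 0 = (edge_ideal V E :: 'k pol set)"
      by (rule augmentation_image)
    fix n a and z :: "point set \<Rightarrow> 'k"
    assume z: "\<And>F. z F \<noteq> 0 \<Longrightarrow> F \<in> cells \<and> F \<noteq> {} \<and> divides (face_label label F) a \<and> pdim F = n"
      and cyc: "\<And>G. bd cells b z G = 0" and cyc0: "n = 0 \<Longrightarrow> aug cells z = 0"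
    \<comment> \<open>By squarefreeness the label of a cell divides \<open>a\<close> exactly if its
      vertices lie in this set. Stage 0 puts no constraint on the singletons, hence the arbitrary
      \<open>\<lambda>_. 0\<close> below.\<close>
    let ?W = "{u. g u \<in> ks a}"
    have stage: "F \<in> cell d ` I.stage ?W 0 v \<longleftrightarrow> F \<in> cells \<and> F \<noteq> {} \<and> divides (face_label label F) a" for F v
    proof -
      have "supp d B \<subseteq> ?W \<longleftrightarrow> divides (face_label label (cell d B)) a" if "B \<in> S" for B
        using divides_mon_iff[OF finite_supp[OF edge_blocksD(1)[OF that]] inj_g] face_label_cells[OF that] by simp
      moreover have "cell d B \<noteq> {}" if "B \<in> S" for B
        using cell_nonempty[OF edge_blocksD(1)[OF that]] .
      ultimately show ?thesis by (auto simp: I.stage_def cells_def)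
    qed
    have "\<exists>w. (\<forall>F. w F \<noteq> 0 \<longrightarrow> F \<in> cell d ` I.stage ?W 0 (\<lambda>_. 0) \<and> pdim F = n + 1) \<and> (\<forall>G. z G = bd cells b w G)"
      using I.stage_acyclic[of 0 z ?W "\<lambda>_. 0" n, unfolded X] z cyc cyc0 unfolding stage by blast
    then show "\<exists>w. (\<forall>F. w F \<noteq> 0 \<longrightarrow> F \<in> cells \<and> F \<noteq> {} \<and> divides (face_label label F) a \<and> pdim F = n + 1) \<and> (\<forall>G. z G = bd cells b w G)"
      unfolding stage by blast
  qed
qed

lemma supports_minimal_resolution:
  "supports_minimal_cellular_resolution V cells (edge_ideal V E :: 'k::field pol set)"
  unfolding supports_minimal_cellular_resolution_def
  using polyhedral_complex_cells orientation_exists minimal_resolution_cells label_keys_subset by blast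

end

theorem corollary5p6:
  fixes d :: nat and V :: "int set" and E :: "int set set"
  assumes "d \<ge> 1"
    and "d_graph d V E"
    and "cointerval d V E"
  shows "\<exists>r m Y X. r \<ge> 1 \<and> mixed_subdivision r m Y \<and> subcomplex X Y \<and>
    supports_minimal_cellular_resolution V X (edge_ideal V E :: 'k::field pol set)"
proof -
  have fin: "finite V" using assms(2) by (simp add: d_graph_def)
  \<comment> \<open>Vertices are numbered by their distance from \<open>c\<close>; the inserted 0
    covers an empty \<open>V\<close>.\<close>
  define c where "c = Min (insert 0 V)"
  define m where "m = nat (Max (insert 0 V) - c)"
  have "V \<subseteq> (\<lambda>n. c + int n) ` {..m}"
  proof
    fix v assume v: "v \<in> V"
    then have "c \<le> v" "v \<le> Max (insert 0 V)" using fin by (auto simp: c_def)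
    then have "v = c + int (nat (v - c))" "nat (v - c) \<le> m" by (auto simp: m_def)
    then show "v \<in> (\<lambda>n. c + int n) ` {..m}" by blast
  qed
  then interpret cointerval_complex d V E "\<lambda>n. c + int n" m
    using assms by unfold_locales (auto simp: strict_mono_def)
  \<comment> \<open>The dilation factor is \<open>d\<close>, and \<open>Y\<close> is the staircase
    subdivision for \<open>d\<close> and \<open>m\<close>.\<close>
  show ?thesis
    using assms(1) mixed_subdivision_staircase[OF assms(1)] cells_subset_staircase
      polyhedral_complex_cells supports_minimal_resolution unfolding subcomplex_def by blast
qed

end
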